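(* Let $\nu\in\mathbb{R}$ and $\beta>0$. Suppose that $g,\gamma\in\mathcal{S}_0(\mathbb{R})$. If $S^\nu_{g,\gamma}=I$ on $L^2_\nu(0,1)$ or, equivalently, if there exists $\gamma\in\mathcal{S}_0(\mathbb{R})$ such that $$\beta^{-1}\sum_{n\in\mathbb{Z}}\left\langle\gamma,M_kT_{\frac n\beta}g\right\rangle_{L^2(\mathbb{R})}e^{2\pi i\frac{nl}{\beta}}=\delta_{k,0}\quad\text{for all }k,l\in\mathbb{Z},$$ then $\mathcal{G}_\nu(g,Z_\beta)$ is a Gabor frame for $L^2_\nu(0,1)$.
   Context: $L^2_\nu(0,1)$ is the Hilbert space of measurable $f:\mathbb{R}\to\mathbb{C}$ with $f(t+k)=e^{2\pi ik\nu}f(t)$ for all $k\in\mathbb{Z}$ and $\int_0^1|f|^2<\infty$, with the inner product of $L^2(0,1)$. $M_\xi f(t)=e^{2\pi i\xi t}f(t)$, $T_xf(t)=f(t-x)$, $V_gf(x,\xi)=\int_{\mathbb{R}}f(t)\overline{g(t-x)}e^{-2\pi i\xi t}dt$, $h_0(t)=2^{1/4}e^{-\pi t^2}$, and $\mathcal{S}_0(\mathbb{R})=\{g\in L^2(\mathbb{R}):V_{h_0}g\in L^1(\mathbb{R}^2)\}$ (Feichtinger's algebra). Windows $g$ are normalized by $\|g\|_{L^2(\mathbb{R})}=1$. $\Sigma_\nu f(t)=\sum_{k\in\mathbb{Z}}e^{2\pi ik\nu}f(t-k)$. The frame-type operator is $S^\nu_{g,\gamma}f=\sum_{n\in\mathbb{Z}}\langle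 f,\Sigma_\nu M_{\beta n}g\rangle_{L^2_\nu(0,1)}\Sigma_\nu(M_{\beta n}\gamma)$, which converges in $L^2_\nu(0,1)$ for $g,\gamma\in\mathcal{S}_0(\mathbb{R})$. $Z_\beta=\{(0,\beta n):n\in\mathbb{Z}\}$; $\mathcal{G}_\nu(g,Z_\beta)=\{\Sigma_\nu(M_{\beta n}g):n\in\mathbb{Z}\}$ is a Gabor frame for $L^2_\nu(0,1)$ if there are $A,B>0$ with $A\|f\|^2\le\sum_{n}|\langle f,\Sigma_\nu(M_{\beta n}g)\rangle_{L^2_\nu(0,1)}|^2\le B\|f\|^2$ for all $f\in L^2_\nu(0,1)$. $\delta_{k,0}$ is the Kronecker delta.
   Formalization: The phase e^{2πi nl/β} in the displayed condition is corrected to e^{2πi n(l-ν)/β}; as printed the claim fails, e.g. for β=1, ν=1/2, g=h_0, where a dual γ satisfies the printed condition but the system is not a frame. *)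

theory Defs
  imports "HOL-Analysis.Analysis"
begin

(* Elements of the L^2 spaces are represented by Borel functions; every class of Lebesgue
   measurable functions modulo null sets has such a representative.  Identities in L^2 are
   therefore stated through norms of differences, never as pointwise equalities. *)

definition L2 :: "(real \<Rightarrow> complex) set" where
  "L2 = {f. f \<in> borel_measurable lborel \<and> integrable lborel (\<lambda>t. (cmod (f t))\<^sup>2)}"

definition L2_inner :: "(real \<Rightarrow> complex) \<Rightarrow> (real \<Rightarrow> complex) \<Rightarrow> complex" where
  "L2_inner f g = (LINT t|lborel. f t * cnj (g t))"

definition L2_norm :: "(real \<Rightarrow> complex) \<Rightarrow> real" where
  "L2_norm f = sqrt (LINT t|lborel. (cmod (f t))\<^sup>2)"

definition modulation :: "real \<Rightarrow> (real \<Rightarrow> complex) \<Rightarrow> real \<Rightarrow> complex" where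
  "modulation \<xi> f = (\<lambda>t. cis (2 * pi * \<xi> * t) * f t)"

definition translation :: "real \<Rightarrow> (real \<Rightarrow> complex) \<Rightarrow> real \<Rightarrow> complex" where
  "translation x f = (\<lambda>t. f (t - x))"

definition STFT :: "(real \<Rightarrow> complex) \<Rightarrow> (real \<Rightarrow> complex) \<Rightarrow> real \<Rightarrow> real \<Rightarrow> complex" where
  "STFT g f x \<xi> = (LINT t|lborel. f t * cnj (g (t - x)) * cis (- 2 * pi * \<xi> * t))"

definition gauss :: "real \<Rightarrow> complex" where
  "gauss t = complex_of_real (2 powr (1/4) * exp (- pi * t\<^sup>2))"

text \<open>Feichtinger's algebra\<close>

definition S0 :: "(real \<Rightarrow> complex) set" where
  "S0 = {g \<in> L2. integrable (lborel :: (real \<times> real) measure) (\<lambda>(x, \<xi>). STFT gauss g x \<xi>)}"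

definition quasi_periodize :: "real \<Rightarrow> (real \<Rightarrow> complex) \<Rightarrow> real \<Rightarrow> complex" where
  "quasi_periodize \<nu> f = (\<lambda>t. \<Sum>\<^sub>\<infinity>k\<in>(UNIV :: int set). cis (2 * pi * of_int k * \<nu>) * f (t - of_int k))"

definition L2_quasi :: "real \<Rightarrow> (real \<Rightarrow> complex) set" where
  "L2_quasi \<nu> = {f. f \<in> borel_measurable lborel
     \<and> (\<forall>t. \<forall>k::int. f (t + of_int k) = cis (2 * pi * of_int k * \<nu>) * f t)
     \<and> set_integrable lborel {0<..<1} (\<lambda>t. (cmod (f t))\<^sup>2)}"

definition L2_01_inner :: "(real \<Rightarrow> complex) \<Rightarrow> (real \<Rightarrow> complex) \<Rightarrow> complex" where
  "L2_01_inner f g = (LINT t:{0<..<1}|lborel. f t * cnj (g t))"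

definition L2_01_norm :: "(real \<Rightarrow> complex) \<Rightarrow> real" where
  "L2_01_norm f = sqrt (LINT t:{0<..<1}|lborel. (cmod (f t))\<^sup>2)"

definition gabor_system :: "real \<Rightarrow> real \<Rightarrow> (real \<Rightarrow> complex) \<Rightarrow> int \<Rightarrow> real \<Rightarrow> complex" where
  "gabor_system \<nu> \<beta> g n = quasi_periodize \<nu> (modulation (\<beta> * of_int n) g)"

(* The summability condition is needed because a divergent infinite sum has value 0. *)
definition is_gabor_frame :: "real \<Rightarrow> real \<Rightarrow> (real \<Rightarrow> complex) \<Rightarrow> bool" where
  "is_gabor_frame \<nu> \<beta> g \<longleftrightarrow>
     (\<exists>A>0. \<exists>B>0. \<forall>f\<in>L2_quasi \<nu>.
        (\<lambda>n. (cmod (L2_01_inner f (gabor_system \<nu> \<beta> g n)))\<^sup>2) summable_on UNIV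
      \<and> A * (L2_01_norm f)\<^sup>2 \<le> (\<Sum>\<^sub>\<infinity>n. (cmod (L2_01_inner f (gabor_system \<nu> \<beta> g n)))\<^sup>2)
      \<and> (\<Sum>\<^sub>\<infinity>n. (cmod (L2_01_inner f (gabor_system \<nu> \<beta> g n)))\<^sup>2) \<le> B * (L2_01_norm f)\<^sup>2)"

(* frame_op_value \<nu> \<beta> g \<gamma> f h expresses that the frame-type operator with analysis
   window g and synthesis window \<gamma> maps f to h, i.e. that the defining series converges to h
   in L^2(0,1).  As a limit in norm, h is only determined up to null sets, hence a relation. *)
definition frame_op_value ::
    "real \<Rightarrow> real \<Rightarrow> (real \<Rightarrow> complex) \<Rightarrow> (real \<Rightarrow> complex) \<Rightarrow> (real \<Rightarrow> complex) \<Rightarrow> (real \<Rightarrow> complex) \<Rightarrow> bool"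
  where
  "frame_op_value \<nu> \<beta> g \<gamma> f h \<longleftrightarrow>
     ((\<lambda>F. L2_01_norm (\<lambda>t. (\<Sum>n\<in>F. L2_01_inner f (gabor_system \<nu> \<beta> g n) * gabor_system \<nu> \<beta> \<gamma> n t) - h t))
        \<longlongrightarrow> 0) (finite_subsets_at_top UNIV)"

definition frame_op_eq_id :: "real \<Rightarrow> real \<Rightarrow> (real \<Rightarrow> complex) \<Rightarrow> (real \<Rightarrow> complex) \<Rightarrow> bool" where
  "frame_op_eq_id \<nu> \<beta> g \<gamma> \<longleftrightarrow> (\<forall>f\<in>L2_quasi \<nu>. frame_op_value \<nu> \<beta> g \<gamma> f f)"

(* By Poisson summation the frame-type operator is the superposition
     (1/\<beta>) * sum over k, n of L2_inner \<gamma> (M_k T_{n/\<beta>} g) * (M_k T_{n/\<beta>} f),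
   where M is modulation and T is translation.
   On the basis function e_{-l}(t) = cis (2 pi (\<nu> - l) t) of L2_quasi \<nu>, the operator
   M_k T_{n/\<beta>} gives cis (2 pi n (l - \<nu>) / \<beta>) * e_{k-l}.  The shift of l by \<nu> comes from
   here; without it the condition below would describe the identity on L2_quasi 0. *)
definition duality_condition :: "real \<Rightarrow> real \<Rightarrow> (real \<Rightarrow> complex) \<Rightarrow> (real \<Rightarrow> complex) \<Rightarrow> bool" where
  "duality_condition \<nu> \<beta> g \<gamma> \<longleftrightarrow>
     (\<forall>k l :: int.
        complex_of_real (1 / \<beta>) *
          (\<Sum>\<^sub>\<infinity>n\<in>(UNIV :: int set).
             L2_inner \<gamma> (modulation (of_int k) (translation (of_int n / \<beta>) g))
               * cis (2 * pi * (of_int n * (of_int l - \<nu>) / \<beta>)))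
        = (if k = 0 then 1 else 0))"

end

theory Submission
  imports Defs "HOL-Probability.Characteristic_Functions"
begin

text \<open>
  Write \<open>T = 1 / \<beta>\<close> and \<open>G n = \<Sigma>\<^sub>\<nu> (M\<^sub>\<beta>\<^sub>n g)\<close>.  Everything rests on one observation: unfolding the
  periodization over \<open>\<int>\<close> and folding the real line again over \<open>T \<int>\<close> gives
  \<open>\<langle>f, G n\<rangle> = \<integral>\<^sub>\<real> f \<sqdot> cnj g \<sqdot> exp (- 2 \<pi> i n t / T) dt = n\<close>-th Fourier coefficient on \<open>(0, T)\<close> of
  \<open>P\<^sub>g f (t) = (\<Sum>j\<in>\<int>. f (t + j T) \<sqdot> cnj (g (t + j T)))\<close>
  (lemma \<open>gabor_coefficient\<close>; \<open>P\<^sub>g\<close> is \<open>fold_window\<close>).  All questions about the Gabor system thus become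
  questions about Fourier series on \<open>(0, T)\<close>, where the trigonometric system is complete
  (\<open>trig_complete\<close>) and Parseval's identity holds:
  \<open>(\<Sum>n. \<bar>\<langle>f, G n\<rangle>\<bar>\<^sup>2) = T \<parallel>P\<^sub>g f\<parallel>\<^sup>2\<close> and
  \<open>\<langle>S f, h\<rangle> = T \<langle>P\<^sub>g f, P\<^sub>\<gamma> h\<rangle>\<close>, the form \<open>frame_form\<close>.

  The map \<open>P\<^sub>g\<close> is bounded from \<open>L\<^sup>2\<^sub>\<nu>(0,1)\<close> to \<open>L\<^sup>2(0,T)\<close> as soon as the sums
  \<open>\<Sum>k. \<bar>g (t + k a)\<bar>\<close> are essentially bounded, for every step \<open>a > 0\<close> (\<open>fold_window_bounded\<close>).
  Feichtinger's algebra provides this (\<open>S0_imp_wiener\<close>): by Fourier inversion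
  \<open>\<bar>g t\<bar> h\<^sub>0(t - x)\<close> is at most \<open>v x\<close>, the integral of \<open>\<bar>V g (x, \<xi>)\<bar>\<close> over \<open>\<xi>\<close>, and averaging over
  \<open>x\<close> in a window of length \<open>a\<close> bounds the sum by a multiple of \<open>\<parallel>v\<parallel>\<^sub>1\<close>.

  Now \<open>S = I\<close> means that \<open>T \<langle>P\<^sub>g f, P\<^sub>\<gamma> h\<rangle> = \<langle>f, h\<rangle>\<close> for all \<open>f\<close>, \<open>h\<close> (\<open>frame_op_eq_id_iff_form\<close>).
  Boundedness reduces this to the basis \<open>e l = exp (2 \<pi> i (\<nu> + l) t)\<close> of \<open>L\<^sup>2\<^sub>\<nu>(0,1)\<close>
  (\<open>frame_form_eq_inner_on_iff_basis\<close>), and on basis functions the form, unfolded from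
  \<open>(0, T)\<close> to \<open>\<real>\<close>, is literally the left-hand side of the duality condition
  (\<open>frame_form_basis_eq_duality_sum\<close>).  The upper frame bound is the boundedness of \<open>P\<^sub>g\<close>; the
  lower one follows from
  \<open>\<parallel>f\<parallel>\<^sup>2 = T \<langle>P\<^sub>g f, P\<^sub>\<gamma> f\<rangle> \<le> T \<parallel>P\<^sub>g f\<parallel> \<sqdot> K \<parallel>f\<parallel>\<close>, which bounds \<open>\<parallel>f\<parallel>\<close> by \<open>\<parallel>P\<^sub>g f\<parallel>\<close>
  (\<open>frame_op_eq_id_imp_gabor_frame\<close>).
\<close>

section \<open>Square-integrable functions on a measure space\<close>

lemma borel_measurable_cnj [measurable (raw)]:
  "f \<in> borel_measurable M \<Longrightarrow> (\<lambda>t. cnj (f t)) \<in> borel_measurable M"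
  by (rule borel_measurable_continuous_on[of cnj f M]) (simp_all add: continuous_on_cnj)

text \<open>Elements of \<open>L\<^sup>2\<close> are represented by functions here as well, so \<open>norm_on\<close> is only a seminorm and
limits in norm are unique only almost everywhere.\<close>

definition square_integrable :: "'a measure \<Rightarrow> ('a \<Rightarrow> complex) \<Rightarrow> bool" where
  "square_integrable M f \<longleftrightarrow> f \<in> borel_measurable M \<and> integrable M (\<lambda>t. (cmod (f t))\<^sup>2)"

definition inner_on :: "'a measure \<Rightarrow> ('a \<Rightarrow> complex) \<Rightarrow> ('a \<Rightarrow> complex) \<Rightarrow> complex" where
  "inner_on M f g = (LINT t|M. f t * cnj (g t))"

definition norm_on :: "'a measure \<Rightarrow> ('a \<Rightarrow> complex) \<Rightarrow> real" where
  "norm_on M f = sqrt (LINT t|M. (cmod (f t))\<^sup>2)"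

lemma square_integrable_measurable: "square_integrable M f \<Longrightarrow> f \<in> borel_measurable M"
  by (simp add: square_integrable_def)

lemma square_integrable_integrable: "square_integrable M f \<Longrightarrow> integrable M (\<lambda>t. (cmod (f t))\<^sup>2)"
  by (simp add: square_integrable_def)

lemma norm_on_nonneg [simp]: "0 \<le> norm_on M f"
  by (simp add: norm_on_def)

lemma norm_on_square: "(norm_on M f)\<^sup>2 = (LINT t|M. (cmod (f t))\<^sup>2)"
  by (simp add: norm_on_def)

lemma integrable_mult_cnj:
  assumes "square_integrable M f" "square_integrable M g"
  shows "integrable M (\<lambda>t. f t * cnj (g t))"
proof (rule Bochner_Integration.integrable_bound)
  show "integrable M (\<lambda>t. (cmod (f t))\<^sup>2 + (cmod (g t))\<^sup>2)"
    using assms by (intro Bochner_Integration.integrable_add square_integrable_integrable)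
  show "(\<lambda>t. f t * cnj (g t)) \<in> borel_measurable M"
    using assms[THEN square_integrable_measurable] by (intro borel_measurable_times borel_measurable_cnj)
  have "a * b \<le> a\<^sup>2 + b\<^sup>2" if "a \<ge> 0" "b \<ge> 0" for a b :: real
  proof -
    have "a * b \<le> 2 * a * b" using that by simp
    then show ?thesis using sum_squares_bound[of a b] by linarith
  qed
  from this[OF norm_ge_zero norm_ge_zero]
  show "AE t in M. norm (f t * cnj (g t)) \<le> norm ((cmod (f t))\<^sup>2 + (cmod (g t))\<^sup>2)"
    by (intro AE_I2) (simp add: norm_mult)
qed

lemma square_integrable_add [intro]:
  assumes "square_integrable M f" "square_integrable M g" shows "square_integrable M (\<lambda>t. f t + g t)"
proof -
  have [measurable]: "f \<in> borel_measurable M" "g \<in> borel_measurable M"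
    using assms by (auto simp: square_integrable_def)
  have *: "(a + b)\<^sup>2 \<le> 2 * a\<^sup>2 + 2 * b\<^sup>2" for a b :: real
    using sum_squares_bound[of a b] by (simp add: power2_sum)
  have "integrable M (\<lambda>t. (cmod (f t + g t))\<^sup>2)"
  proof (rule Bochner_Integration.integrable_bound)
    show "integrable M (\<lambda>t. 2 * (cmod (f t))\<^sup>2 + 2 * (cmod (g t))\<^sup>2)"
      using assms by (intro Bochner_Integration.integrable_add integrable_mult_right square_integrable_integrable)
    have "(cmod (f t + g t))\<^sup>2 \<le> 2 * (cmod (f t))\<^sup>2 + 2 * (cmod (g t))\<^sup>2" for t
      by (rule order_trans[OF power_mono[OF norm_triangle_ineq norm_ge_zero] *])
    then show "AE t in M. norm ((cmod (f t + g t))\<^sup>2) \<le> norm (2 * (cmod (f t))\<^sup>2 + 2 * (cmod (g t))\<^sup>2)"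
      by simp
  qed simp
  then show ?thesis by (simp add: square_integrable_def)
qed

lemma square_integrable_scale [intro]: "square_integrable M f \<Longrightarrow> square_integrable M (\<lambda>t. c * f t)"
  by (auto simp: square_integrable_def norm_mult power_mult_distrib)

lemma square_integrable_zero [simp, intro]: "square_integrable M (\<lambda>t. 0)"
  by (simp add: square_integrable_def)

lemma square_integrable_diff [intro]:
  "square_integrable M f \<Longrightarrow> square_integrable M g \<Longrightarrow> square_integrable M (\<lambda>t. f t - g t)"
  using square_integrable_add[OF _ square_integrable_scale[of M g "-1"], of f] by simp

lemma square_integrable_sum [intro]:
  "(\<And>i. i \<in> F \<Longrightarrow> square_integrable M (f i)) \<Longrightarrow> square_integrable M (\<lambda>t. \<Sum>i\<in>F. f i t)"
  by (induction F rule: infinite_finite_induct) auto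

lemma square_integrable_bounded:
  assumes "finite_measure M" "f \<in> borel_measurable M" "AE t in M. cmod (f t) \<le> C"
  shows "square_integrable M f"
proof -
  interpret finite_measure M by fact
  have "integrable M (\<lambda>t. (cmod (f t))\<^sup>2)"
  proof (rule integrable_const_bound[where B="C\<^sup>2"])
    show "AE t in M. norm ((cmod (f t))\<^sup>2) \<le> C\<^sup>2"
      using assms(3) by eventually_elim (simp add: power_mono)
  qed (use assms in simp)
  with assms show ?thesis by (simp add: square_integrable_def)
qed

lemma square_integrable_dominated:
  assumes "square_integrable M g" "f \<in> borel_measurable M" "AE t in M. cmod (f t) \<le> cmod (g t)"
  shows "square_integrable M f"
  unfolding square_integrable_def
proof
  show "integrable M (\<lambda>t. (cmod (f t))\<^sup>2)"
  proof (rule Bochner_Integration.integrable_bound[OF square_integrable_integrable[OF assms(1)]])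
    show "AE t in M. norm ((cmod (f t))\<^sup>2) \<le> norm ((cmod (g t))\<^sup>2)"
      using assms(3) by eventually_elim (simp add: power_mono)
  qed (use assms in simp)
qed fact

lemma inner_on_cnj: "inner_on M g f = cnj (inner_on M f g)"
  unfolding inner_on_def Bochner_Integration.integral_cnj[symmetric] by (simp add: mult.commute)

lemma inner_on_self: "inner_on M f f = complex_of_real ((norm_on M f)\<^sup>2)"
  unfolding inner_on_def norm_on_square complex_mult_cnj cmod_power2 [symmetric]
  by (rule integral_complex_of_real)

lemma inner_on_add_left:
  "square_integrable M f \<Longrightarrow> square_integrable M g \<Longrightarrow> square_integrable M h \<Longrightarrow> inner_on M (\<lambda>t. f t + g t) h = inner_on M f h + inner_on M g h"
  by (simp add: inner_on_def distrib_right integrable_mult_cnj)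

lemma inner_on_scale_left: "inner_on M (\<lambda>t. c * f t) h = c * inner_on M f h"
  by (simp add: inner_on_def mult.assoc)

lemma inner_on_diff_left:
  "square_integrable M f \<Longrightarrow> square_integrable M g \<Longrightarrow> square_integrable M h \<Longrightarrow> inner_on M (\<lambda>t. f t - g t) h = inner_on M f h - inner_on M g h"
  by (simp add: inner_on_def left_diff_distrib integrable_mult_cnj)

lemma inner_on_sum_left:
  assumes "\<And>i. i \<in> F \<Longrightarrow> square_integrable M (f i)" "square_integrable M h"
  shows "inner_on M (\<lambda>t. \<Sum>i\<in>F. f i t) h = (\<Sum>i\<in>F. inner_on M (f i) h)"
  using assms by (simp add: inner_on_def sum_distrib_right integrable_mult_cnj)

lemma inner_on_diff_right:
  "square_integrable M f \<Longrightarrow> square_integrable M g \<Longrightarrow> square_integrable M h \<Longrightarrow> inner_on M h (\<lambda>t. f t - g t) = inner_on M h f - inner_on M h g"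
  by (simp add: inner_on_cnj[of M h] inner_on_diff_left)

lemma inner_on_add_right:
  "square_integrable M f \<Longrightarrow> square_integrable M g \<Longrightarrow> square_integrable M h \<Longrightarrow> inner_on M h (\<lambda>t. f t + g t) = inner_on M h f + inner_on M h g"
  by (simp add: inner_on_cnj[of M h] inner_on_add_left)

lemma inner_on_scale_right: "inner_on M h (\<lambda>t. c * f t) = cnj c * inner_on M h f"
  by (simp add: inner_on_def mult_ac)

lemma inner_on_cong_AE:
  assumes "f \<in> borel_measurable M" "f' \<in> borel_measurable M" "g \<in> borel_measurable M" "g' \<in> borel_measurable M"
    and "AE t in M. f t = f' t" "AE t in M. g t = g' t"
  shows "inner_on M f g = inner_on M f' g'"
  unfolding inner_on_def using assms by (intro integral_cong_AE) auto

lemma norm_on_scale: "norm_on M (\<lambda>t. c * f t) = cmod c * norm_on M f"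
  by (simp add: norm_on_def norm_mult power_mult_distrib real_sqrt_mult)

lemma Cauchy_Schwarz_inner_on:
  assumes f: "square_integrable M f" and g: "square_integrable M g"
  shows "cmod (inner_on M f g) \<le> norm_on M f * norm_on M g"
proof (cases "norm_on M g = 0")
  case True
  have "(LINT t|M. (cmod (g t))\<^sup>2) = 0" using True by (simp add: norm_on_def)
  then have "AE t in M. g t = 0"
    using integral_nonneg_eq_0_iff_AE[OF square_integrable_integrable[OF g]] by auto
  then have "inner_on M f g = inner_on M f (\<lambda>t. 0)"
    using f g by (intro inner_on_cong_AE) (auto simp: square_integrable_def)
  then show ?thesis using True by (simp add: inner_on_def)
next
  case False
  define N where "N = (norm_on M g)\<^sup>2"
  have N: "N > 0" using False by (simp add: N_def)
  \<comment> \<open>Subtracting the projection of f onto g leaves a vector of nonnegative squared norm.\<close>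
  define c where "c = inner_on M f g / of_real N"
  have cg: "square_integrable M (\<lambda>t. c * g t)" using g by auto
  have "0 \<le> Re (inner_on M (\<lambda>t. f t - c * g t) (\<lambda>t. f t - c * g t))"
    by (simp add: inner_on_self)
  also have "inner_on M (\<lambda>t. f t - c * g t) (\<lambda>t. f t - c * g t)
     = inner_on M f f - cnj c * inner_on M f g - c * inner_on M g f + c * (cnj c * inner_on M g g)"
    using f g cg square_integrable_diff[OF f cg]
    by (simp add: inner_on_diff_left inner_on_diff_right inner_on_scale_left inner_on_scale_right right_diff_distrib)
  also have "\<dots> = of_real ((norm_on M f)\<^sup>2) - of_real ((cmod (inner_on M f g))\<^sup>2 / N)"
  proof -
    have 1: "cnj c * inner_on M f g = of_real ((cmod (inner_on M f g))\<^sup>2 / N)"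
      by (simp add: c_def mult.commute complex_norm_square[symmetric] flip: of_real_power)
    have 2: "c * inner_on M g f = of_real ((cmod (inner_on M f g))\<^sup>2 / N)"
      by (simp add: c_def inner_on_cnj[of M g f] complex_norm_square[symmetric] flip: of_real_power)
    have 3: "c * (cnj c * inner_on M g g) = of_real ((cmod (inner_on M f g))\<^sup>2 / N)"
      using N by (simp add: inner_on_self c_def N_def[symmetric] field_simps complex_norm_square
          del: of_real_power)
    have 4: "x - y - y + y = x - y" for x y :: complex by simp
    show ?thesis unfolding 1 2 3 4 unfolding inner_on_self ..
  qed
  finally have "(cmod (inner_on M f g))\<^sup>2 / N \<le> (norm_on M f)\<^sup>2" by simp
  then have "(cmod (inner_on M f g))\<^sup>2 \<le> (norm_on M f * norm_on M g)\<^sup>2"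
    using N by (simp add: N_def field_simps power_mult_distrib)
  then show ?thesis by (rule power2_le_imp_le) simp
qed

lemma norm_on_triangle:
  assumes f: "square_integrable M f" and g: "square_integrable M g"
  shows "norm_on M (\<lambda>t. f t + g t) \<le> norm_on M f + norm_on M g"
proof (rule power2_le_imp_le)
  have "inner_on M (\<lambda>t. f t + g t) (\<lambda>t. f t + g t) = inner_on M f f + inner_on M g g + (inner_on M f g + inner_on M g f)"
    using f g square_integrable_add[OF f g] by (simp add: inner_on_add_left inner_on_add_right)
  also have "inner_on M f g + inner_on M g f = of_real (2 * Re (inner_on M f g))"
    unfolding inner_on_cnj[of M g f] complex_add_cnj ..
  finally have "complex_of_real ((norm_on M (\<lambda>t. f t + g t))\<^sup>2)
      = of_real ((norm_on M f)\<^sup>2 + (norm_on M g)\<^sup>2 + 2 * Re (inner_on M f g))"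
    unfolding inner_on_self of_real_add .
  then have "(norm_on M (\<lambda>t. f t + g t))\<^sup>2 = (norm_on M f)\<^sup>2 + (norm_on M g)\<^sup>2 + 2 * Re (inner_on M f g)"
    using of_real_eq_iff by blast
  also have "Re (inner_on M f g) \<le> norm_on M f * norm_on M g"
    using Cauchy_Schwarz_inner_on[OF f g] complex_Re_le_cmod order_trans by blast
  finally show "(norm_on M (\<lambda>t. f t + g t))\<^sup>2 \<le> (norm_on M f + norm_on M g)\<^sup>2"
    by (simp add: power2_sum)
qed auto

section \<open>Orthogonal expansions\<close>

text \<open>
  The common squared norm \<open>T\<close> is kept as a parameter: the exponentials on an interval of length \<open>T\<close>
  are then used without normalization, which keeps their values unimodular.
\<close>

locale orthogonal_system =
  fixes M :: "'a measure" and E :: "'i \<Rightarrow> 'a \<Rightarrow> complex" and T :: real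
  assumes T_pos: "T > 0"
    and square_integrable_E: "square_integrable M (E n)"
    and inner_on_E: "inner_on M (E m) (E n) = (if m = n then of_real T else 0)"
begin

definition expansion :: "'i set \<Rightarrow> ('a \<Rightarrow> complex) \<Rightarrow> 'a \<Rightarrow> complex" where
  "expansion F f t = (\<Sum>n\<in>F. inner_on M f (E n) / of_real T * E n t)"

lemma square_integrable_expansion: "square_integrable M (expansion F f)"
  unfolding expansion_def[abs_def] by (intro square_integrable_sum square_integrable_scale square_integrable_E)

lemma inner_on_expansion:
  assumes "square_integrable M g"
  shows "inner_on M (expansion F f) g = (\<Sum>n\<in>F. inner_on M f (E n) * cnj (inner_on M g (E n))) / of_real T"
  unfolding expansion_def[abs_def]
proof -
  have "inner_on M (\<lambda>t. \<Sum>n\<in>F. inner_on M f (E n) / of_real T * E n t) g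
      = (\<Sum>n\<in>F. inner_on M (\<lambda>t. inner_on M f (E n) / of_real T * E n t) g)"
    by (intro inner_on_sum_left square_integrable_scale square_integrable_E assms)
  also have "\<dots> = (\<Sum>n\<in>F. inner_on M f (E n) / of_real T * inner_on M (E n) g)"
    by (simp only: inner_on_scale_left)
  finally show "inner_on M (\<lambda>t. \<Sum>n\<in>F. inner_on M f (E n) / of_real T * E n t) g
      = (\<Sum>n\<in>F. inner_on M f (E n) * cnj (inner_on M g (E n))) / of_real T"
    by (simp add: sum_divide_distrib inner_on_cnj[of M _ g])
qed

lemma expansion_add:
  "square_integrable M f \<Longrightarrow> square_integrable M g \<Longrightarrow> expansion F (\<lambda>t. f t + g t) = (\<lambda>t. expansion F f t + expansion F g t)"
  by (rule ext) (simp add: expansion_def inner_on_add_left square_integrable_E add_divide_distrib distrib_right sum.distrib)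

lemma expansion_diff:
  "square_integrable M f \<Longrightarrow> square_integrable M g \<Longrightarrow> expansion F (\<lambda>t. f t - g t) = (\<lambda>t. expansion F f t - expansion F g t)"
  by (rule ext) (simp add: expansion_def inner_on_diff_left square_integrable_E diff_divide_distrib left_diff_distrib sum_subtractf)

lemma expansion_scale: "expansion F (\<lambda>t. c * f t) = (\<lambda>t. c * expansion F f t)"
  by (rule ext) (simp add: expansion_def inner_on_scale_left sum_distrib_left mult.assoc)

text \<open>Partial sums reproduce basis vectors; together with linearity this is all that is needed to see that
they reproduce the whole finite span eventually.\<close>

lemma expansion_E: "finite F \<Longrightarrow> n \<in> F \<Longrightarrow> expansion F (E n) = E n"
proof (rule ext)
  fix t
  assume F: "finite F" "n \<in> F"
  have "expansion F (E n) t = (\<Sum>m\<in>F. if n = m then E m t else 0)"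
    unfolding expansion_def using T_pos by (intro sum.cong) (auto simp: inner_on_E)
  then show "expansion F (E n) t = E n t" using F by simp
qed

text \<open>Bessel's inequality in the form in which it is used: taking away an orthogonal projection does not
increase the norm.\<close>

lemma norm_on_diff_expansion:
  assumes f: "square_integrable M f" and F: "finite F"
  shows "norm_on M (\<lambda>t. f t - expansion F f t) \<le> norm_on M f"
proof (rule power2_le_imp_le)
  let ?S = "expansion F f"
  have S: "square_integrable M ?S" by (rule square_integrable_expansion)
  have fS: "inner_on M ?S f = of_real ((\<Sum>n\<in>F. (cmod (inner_on M f (E n)))\<^sup>2) / T)"
    by (simp only: inner_on_expansion[OF f] complex_norm_square[symmetric]) simp
  have Sn: "inner_on M ?S (E n) = inner_on M f (E n)" if "n \<in> F" for n
  proof -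
    have "inner_on M ?S (E n) = (\<Sum>m\<in>F. if n = m then inner_on M f (E m) * of_real T else 0) / of_real T"
      unfolding inner_on_expansion[OF square_integrable_E] by (intro arg_cong2[of _ _ _ _ "(/)"] sum.cong) (auto simp: inner_on_E)
    then show ?thesis using that F T_pos by simp
  qed
  have "(\<Sum>n\<in>F. inner_on M f (E n) * cnj (inner_on M ?S (E n))) = (\<Sum>n\<in>F. inner_on M f (E n) * cnj (inner_on M f (E n)))"
    by (intro sum.cong) (auto simp: Sn)
  then have SS: "inner_on M ?S ?S = inner_on M ?S f"
    using S f by (simp add: inner_on_expansion)
  have "inner_on M (\<lambda>t. f t - ?S t) (\<lambda>t. f t - ?S t) = inner_on M f f - inner_on M f ?S"
    using f S square_integrable_diff[OF f S] SS by (simp add: inner_on_diff_left inner_on_diff_right)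
  also have "inner_on M f ?S = of_real ((\<Sum>n\<in>F. (cmod (inner_on M f (E n)))\<^sup>2) / T)"
    unfolding inner_on_cnj[of M f ?S] fS complex_cnj_complex_of_real ..
  finally have "complex_of_real ((norm_on M (\<lambda>t. f t - ?S t))\<^sup>2)
      = of_real ((norm_on M f)\<^sup>2 - (\<Sum>n\<in>F. (cmod (inner_on M f (E n)))\<^sup>2) / T)"
    unfolding inner_on_self of_real_diff .
  then have "(norm_on M (\<lambda>t. f t - ?S t))\<^sup>2 = (norm_on M f)\<^sup>2 - (\<Sum>n\<in>F. (cmod (inner_on M f (E n)))\<^sup>2) / T"
    using of_real_eq_iff by blast
  also have "\<dots> \<le> (norm_on M f)\<^sup>2"
    using T_pos by (simp add: sum_nonneg)
  finally show "(norm_on M (\<lambda>t. f t - ?S t))\<^sup>2 \<le> (norm_on M f)\<^sup>2" .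
qed simp

inductive_set finite_span :: "('a \<Rightarrow> complex) set" where
  member: "E n \<in> finite_span"
| scale: "f \<in> finite_span \<Longrightarrow> (\<lambda>t. c * f t) \<in> finite_span"
| add: "f \<in> finite_span \<Longrightarrow> g \<in> finite_span \<Longrightarrow> (\<lambda>t. f t + g t) \<in> finite_span"

lemma square_integrable_finite_span: "f \<in> finite_span \<Longrightarrow> square_integrable M f"
  by (induction rule: finite_span.induct) (auto intro: square_integrable_E)

lemma expansion_finite_span:
  "f \<in> finite_span \<Longrightarrow> \<exists>F0. finite F0 \<and> (\<forall>F. finite F \<longrightarrow> F0 \<subseteq> F \<longrightarrow> expansion F f = f)"
proof (induction rule: finite_span.induct)
  case (member n)
  show ?case by (rule exI[of _ "{n}"]) (auto intro: expansion_E)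
next
  case (scale f c)
  then show ?case by (metis expansion_scale)
next
  case (add f g)
  then obtain F G where "finite F" "\<And>H. finite H \<Longrightarrow> F \<subseteq> H \<Longrightarrow> expansion H f = f"
     "finite G" "\<And>H. finite H \<Longrightarrow> G \<subseteq> H \<Longrightarrow> expansion H g = g" by metis
  with add.hyps show ?case
    by (intro exI[of _ "F \<union> G"]) (auto simp: expansion_add square_integrable_finite_span)
qed

text \<open>Membership in the closed linear span of the system.\<close>

definition approximable :: "('a \<Rightarrow> complex) \<Rightarrow> bool" where
  "approximable f \<longleftrightarrow> square_integrable M f \<and> (\<forall>\<epsilon>>0. \<exists>R\<in>finite_span. norm_on M (\<lambda>t. f t - R t) < \<epsilon>)"

text \<open>If \<open>R\<close> in the finite span is close to \<open>f\<close>, then for all large \<open>F\<close> the remainder of \<open>f\<close> equals the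
remainder of \<open>f - R\<close>, because \<open>R\<close> is reproduced; the latter is small by Bessel.  No completeness of
\<open>L\<^sup>2\<close> as a metric space is involved.\<close>

lemma expansion_tendsto:
  assumes "approximable f"
  shows "((\<lambda>F. norm_on M (\<lambda>t. f t - expansion F f t)) \<longlongrightarrow> 0) (finite_subsets_at_top UNIV)"
proof (rule tendstoI)
  fix \<epsilon> :: real assume "\<epsilon> > 0"
  with assms obtain R where R: "R \<in> finite_span" "norm_on M (\<lambda>t. f t - R t) < \<epsilon>" and f: "square_integrable M f"
    unfolding approximable_def by blast
  obtain F0 where F0: "finite F0" "\<And>F. finite F \<Longrightarrow> F0 \<subseteq> F \<Longrightarrow> expansion F R = R"
    using expansion_finite_span[OF R(1)] by blast
  have "norm_on M (\<lambda>t. f t - expansion F f t) < \<epsilon>" if "finite F" "F0 \<subseteq> F" for F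
  proof -
    let ?h = "\<lambda>t. f t - R t"
    have "(\<lambda>t. f t - expansion F f t) = (\<lambda>t. ?h t - expansion F ?h t)"
      using F0(2)[OF that] by (simp add: expansion_diff f R square_integrable_finite_span)
    then show ?thesis
      using norm_on_diff_expansion[of ?h F] f R that by (simp add: square_integrable_diff square_integrable_finite_span)
  qed
  then show "\<forall>\<^sub>F F in finite_subsets_at_top UNIV. dist (norm_on M (\<lambda>t. f t - expansion F f t)) 0 < \<epsilon>"
    using F0(1) by (auto simp: eventually_finite_subsets_at_top)
qed

lemma Parseval:
  assumes f: "approximable f" and g: "square_integrable M g"
  shows "((\<lambda>n. inner_on M f (E n) * cnj (inner_on M g (E n))) has_sum of_real T * inner_on M f g) UNIV"
proof -
  have f': "square_integrable M f" using f by (simp add: approximable_def)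
  have "((\<lambda>F. inner_on M f g - inner_on M (expansion F f) g) \<longlongrightarrow> 0) (finite_subsets_at_top UNIV)"
  proof (rule Lim_null_comparison)
    show "\<forall>\<^sub>F F in finite_subsets_at_top UNIV. norm (inner_on M f g - inner_on M (expansion F f) g)
        \<le> norm_on M (\<lambda>t. f t - expansion F f t) * norm_on M g"
      using f' g by (intro always_eventually allI)
        (simp add: inner_on_diff_left[symmetric] square_integrable_expansion Cauchy_Schwarz_inner_on square_integrable_diff)
    show "((\<lambda>F. norm_on M (\<lambda>t. f t - expansion F f t) * norm_on M g) \<longlongrightarrow> 0) (finite_subsets_at_top UNIV)"
      using tendsto_mult_left_zero[OF expansion_tendsto[OF f]] .
  qed
  then have "((\<lambda>F. inner_on M f g - (inner_on M f g - inner_on M (expansion F f) g)) \<longlongrightarrow> inner_on M f g - 0) (finite_subsets_at_top UNIV)"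
    by (intro tendsto_diff tendsto_const)
  then have "((\<lambda>F. of_real T * inner_on M (expansion F f) g) \<longlongrightarrow> of_real T * inner_on M f g) (finite_subsets_at_top UNIV)"
    by (intro tendsto_mult tendsto_const) simp
  then show ?thesis
    using T_pos by (simp add: has_sum_def inner_on_expansion[OF g])
qed

lemma Parseval_norm:
  assumes f: "approximable f"
  shows "((\<lambda>n. (cmod (inner_on M f (E n)))\<^sup>2) has_sum T * (norm_on M f)\<^sup>2) UNIV"
proof -
  have "((\<lambda>n. inner_on M f (E n) * cnj (inner_on M f (E n))) has_sum of_real T * inner_on M f f) UNIV"
    using Parseval[OF f] f by (simp add: approximable_def)
  then have "((\<lambda>n. complex_of_real ((cmod (inner_on M f (E n)))\<^sup>2)) has_sum of_real (T * (norm_on M f)\<^sup>2)) UNIV"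
    by (simp only: complex_norm_square[symmetric] inner_on_self of_real_mult)
  from has_sum_Re[OF this] show ?thesis by simp
qed

end

section \<open>Periodization\<close>

text \<open>The open interval differs from a fundamental domain of \<open>T \<int>\<close> by a null set only, and it is the
interval in the definition of the inner product of \<open>L\<^sup>2\<^sub>\<nu>(0,1)\<close>.\<close>

definition lborel_upto :: "real \<Rightarrow> real measure" where
  "lborel_upto T = restrict_space lborel {0<..<T}"

lemma space_lborel_upto [simp]: "space (lborel_upto T) = {0<..<T}"
  by (simp add: lborel_upto_def space_restrict_space)

lemma borel_measurable_lborel_upto:
  "f \<in> borel_measurable borel \<Longrightarrow> f \<in> borel_measurable (lborel_upto T)"
  unfolding lborel_upto_def by (rule measurable_restrict_space1) simp

lemma measurable_ident_lborel_upto: "(\<lambda>t. t) \<in> lborel_upto T \<rightarrow>\<^sub>M borel"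
  unfolding lborel_upto_def by (rule measurable_restrict_space1) simp

lemma finite_measure_lborel_upto: "finite_measure (lborel_upto T)"
proof
  have "emeasure lborel {0<..<T} \<noteq> \<infinity>" by (cases "0 \<le> T") auto
  then show "emeasure (lborel_upto T) (space (lborel_upto T)) \<noteq> \<infinity>"
    by (simp add: lborel_upto_def emeasure_restrict_space space_restrict_space)
qed

interpretation lborel_upto: finite_measure "lborel_upto T"
  by (rule finite_measure_lborel_upto)

interpretation int_count: sigma_finite_measure "count_space (UNIV :: int set)"
  by (rule sigma_finite_measure_count_space)

interpretation upto_int: pair_sigma_finite "lborel_upto T" "count_space (UNIV :: int set)"
  by standard

interpretation real_int: pair_sigma_finite "lborel :: real measure" "count_space (UNIV :: int set)"
  by standard

lemma integral_lborel_upto: "(LINT t|lborel_upto T. f t) = (LINT t:{0<..<T}|lborel. f t)"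
  for f :: "real \<Rightarrow> 'b::{banach, second_countable_topology}"
  unfolding lborel_upto_def set_lebesgue_integral_def by (rule integral_restrict_space) simp

lemma integrable_lborel_upto: "integrable (lborel_upto T) f \<longleftrightarrow> set_integrable lborel {0<..<T} f"
  for f :: "real \<Rightarrow> 'b::{banach, second_countable_topology}"
  unfolding lborel_upto_def set_integrable_def by (rule integrable_restrict_space) simp

lemma AE_lborel_upto: "(AE t in lborel. P t) \<Longrightarrow> (AE t in lborel_upto T. P t)"
  unfolding lborel_upto_def by (subst AE_restrict_space_iff) auto

lemma AE_lborel_translate:
  assumes "AE t in lborel. P t" shows "AE t in lborel. P (t + c :: real)"
proof -
  have "AE t in distr lborel borel ((+) c). P t"
    using assms unfolding lborel_distr_plus .
  then have "AE t in lborel. P (c + t)"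
    by (rule AE_distrD[rotated]) simp
  then show ?thesis by (simp add: add.commute)
qed

lemma AE_lborel_translates:
  assumes "AE t in lborel. P t" shows "AE t in lborel. \<forall>k::int. P (t + of_int k * T :: real)"
  using AE_lborel_translate[OF assms] by (simp add: AE_all_countable)

lemma emeasure_lborel_translate:
  assumes [measurable]: "A \<in> sets borel"
  shows "emeasure lborel {t. t + c \<in> A} = emeasure lborel (A :: real set)"
proof -
  have "emeasure lborel A = emeasure (distr lborel borel ((+) c)) A"
    by (simp add: lborel_distr_plus)
  also have "\<dots> = emeasure lborel {t. t + c \<in> A}"
    by (subst emeasure_distr) (auto simp: vimage_def add.commute)
  finally show ?thesis ..
qed

lemma translate_measurable:
  assumes [measurable]: "(\<lambda>t. t) \<in> M \<rightarrow>\<^sub>M borel"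
  shows "(\<lambda>(t, k::int). t + of_int k * T :: real) \<in> M \<Otimes>\<^sub>M count_space UNIV \<rightarrow>\<^sub>M borel"
proof -
  have [measurable]: "(\<lambda>p. real_of_int (snd p)) \<in> borel_measurable (M \<Otimes>\<^sub>M count_space UNIV)"
    by (rule measurable_compose[OF measurable_snd]) simp
  have [measurable]: "fst \<in> borel_measurable (M \<Otimes>\<^sub>M count_space (UNIV :: int set))"
    using measurable_compose[OF measurable_fst assms] by simp
  show ?thesis unfolding case_prod_unfold by measurable
qed

lemmas translate_measurable_upto [measurable] = translate_measurable[OF measurable_ident_lborel_upto]

text \<open>The translates of \<open>(0, T)\<close> by \<open>T \<int>\<close> cover the line up to the null set \<open>T \<int>\<close>, once each.  Stated
as an equality of measures, this yields the unfolding identity for nonnegative and for integrable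
functions alike, by transport of integrals.\<close>

lemma tiling:
  assumes T: "T > 0"
  shows "distr (lborel_upto T \<Otimes>\<^sub>M count_space (UNIV :: int set)) lborel (\<lambda>(t, k). t + of_int k * T) = lborel"
proof (rule measure_eqI)
  let ?P = "lborel_upto T \<Otimes>\<^sub>M count_space (UNIV :: int set)"
  let ?s = "\<lambda>(t, k::int). t + of_int k * T :: real"
  fix A assume "A \<in> sets (distr ?P lborel ?s)"
  then have A [measurable]: "A \<in> sets borel" by simp
  define D where "D = (\<lambda>k::int. A \<inter> {of_int k * T<..<of_int k * T + T})"
  have D [measurable]: "D k \<in> sets borel" for k by (simp add: D_def)
  have fl: "k = \<lfloor>x / T\<rfloor>" if "of_int k * T < x" "x < of_int k * T + T" for x and k :: int
    using that T by (intro floor_unique[symmetric]) (auto simp: field_simps)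
  have disj: "disjoint_family D"
    unfolding disjoint_family_on_def D_def using fl by (auto simp: set_eq_iff)
  have "emeasure (distr ?P lborel ?s) A = emeasure ?P (?s -` A \<inter> space ?P)"
    by (rule emeasure_distr) auto
  also have "\<dots> = (\<integral>\<^sup>+k. emeasure (lborel_upto T) ((\<lambda>t. (t, k)) -` (?s -` A \<inter> space ?P)) \<partial>count_space UNIV)"
    by (rule upto_int.emeasure_pair_measure_alt2) auto
  also have "\<dots> = (\<integral>\<^sup>+k. emeasure lborel (D k) \<partial>count_space UNIV)"
  proof (rule nn_integral_cong)
    fix k :: int
    have "(\<lambda>t. (t, k)) -` (?s -` A \<inter> space ?P) = {t. t + of_int k * T \<in> D k}"
      by (auto simp: space_pair_measure D_def)
    moreover have "{t. t + of_int k * T \<in> D k} \<subseteq> {0<..<T}"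
      by (auto simp: D_def)
    moreover have "{t. t + of_int k * T \<in> D k} \<in> sets lborel"
      by measurable
    ultimately show "emeasure (lborel_upto T) ((\<lambda>t. (t, k)) -` (?s -` A \<inter> space ?P)) = emeasure lborel (D k)"
      unfolding lborel_upto_def by (simp add: emeasure_restrict_space emeasure_lborel_translate)
  qed
  also have "\<dots> = emeasure lborel (\<Union>k. D k)"
    by (rule emeasure_UN_countable[symmetric]) (use disj in auto)
  also have "\<dots> = emeasure lborel A"
  proof (rule emeasure_eq_AE)
    have "AE x in lborel. x \<notin> range (\<lambda>k::int. of_int k * T)"
      by (rule AE_not_in) (intro countable_imp_null_set_lborel, auto)
    then show "AE x in lborel. x \<in> (\<Union>k. D k) \<longleftrightarrow> x \<in> A"
    proof eventually_elim
      case (elim x)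
      have "of_int \<lfloor>x / T\<rfloor> * T \<le> x" "x < of_int \<lfloor>x / T\<rfloor> * T + T"
        using T of_int_floor_le[of "x / T"] floor_correct[of "x / T"] pos_le_divide_eq[OF T, of "of_int \<lfloor>x / T\<rfloor>" x]
        by (auto simp: field_simps)
      moreover have "of_int \<lfloor>x / T\<rfloor> * T \<noteq> x" using elim by (metis rangeI)
      ultimately have "x \<in> {of_int \<lfloor>x / T\<rfloor> * T<..<of_int \<lfloor>x / T\<rfloor> * T + T}" by auto
      then show ?case unfolding D_def by blast
    qed
  qed auto
  finally show "emeasure (distr ?P lborel ?s) A = emeasure lborel A" .
qed simp

lemma nn_integral_tiling:
  assumes "T > 0" and [measurable]: "u \<in> borel_measurable borel"
  shows "(\<integral>\<^sup>+s. u s \<partial>lborel) = (\<integral>\<^sup>+t. \<integral>\<^sup>+k. u (t + of_int k * T) \<partial>count_space (UNIV :: int set) \<partial>lborel_upto T)"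
proof -
  have "(\<integral>\<^sup>+s. u s \<partial>lborel)
      = (\<integral>\<^sup>+s. u s \<partial>distr (lborel_upto T \<Otimes>\<^sub>M count_space (UNIV :: int set)) lborel (\<lambda>(t, k). t + of_int k * T))"
    by (simp add: tiling assms)
  also have "\<dots> = (\<integral>\<^sup>+p. u (case p of (t, k) \<Rightarrow> t + of_int k * T) \<partial>(lborel_upto T \<Otimes>\<^sub>M count_space (UNIV :: int set)))"
    by (rule nn_integral_distr) auto
  also have "\<dots> = (\<integral>\<^sup>+t. \<integral>\<^sup>+k. u (t + of_int k * T) \<partial>count_space (UNIV :: int set) \<partial>lborel_upto T)"
    by (subst int_count.nn_integral_fst[symmetric]) auto
  finally show ?thesis .
qed

text \<open>The sum over \<open>\<int>\<close> is written as an integral over the counting measure, so that measurability and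
Fubini's theorem apply directly; both conventions give 0 to divergent sums.\<close>

definition periodize :: "real \<Rightarrow> (real \<Rightarrow> complex) \<Rightarrow> real \<Rightarrow> complex" where
  "periodize T u t = (LINT k|count_space (UNIV :: int set). u (t + of_int k * T))"

lemma infsum_eq_integral_count_space:
  fixes f :: "'i \<Rightarrow> complex"
  shows "(\<Sum>\<^sub>\<infinity>k\<in>UNIV. f k) = (LINT k|count_space UNIV. f k)"
proof (cases "integrable (count_space UNIV) f")
  case True
  then show ?thesis
    using infsetsum_infsum[of f UNIV] by (simp add: Infinite_Set_Sum.abs_summable_on_def infsetsum_def)
next
  case False
  then have "\<not> f summable_on UNIV"
    using abs_summable_equivalent[of f UNIV]
    by (simp add: Infinite_Set_Sum.abs_summable_on_def summable_on_iff_abs_summable_on_complex)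
  then show ?thesis using False by (simp add: infsum_not_exists not_integrable_integral_eq)
qed

lemma periodize_measurable [measurable]:
  assumes [measurable]: "u \<in> borel_measurable borel"
  shows "periodize T u \<in> borel_measurable borel"
proof -
  have [measurable]: "(\<lambda>(t, k::int). u (t + of_int k * T)) \<in> borel_measurable (borel \<Otimes>\<^sub>M count_space UNIV)"
    using measurable_compose[OF translate_measurable[of borel T] assms] by (simp add: case_prod_unfold)
  show ?thesis
    unfolding periodize_def[abs_def] by (rule int_count.borel_measurable_lebesgue_integral) measurable
qed

lemma integral_periodize:
  assumes T: "T > 0" and u: "integrable lborel u"
  shows "(LINT t|lborel_upto T. periodize T u t) = (LINT s|lborel. u s)"
proof -
  let ?P = "lborel_upto T \<Otimes>\<^sub>M count_space (UNIV :: int set)"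
  let ?s = "\<lambda>(t, k::int). t + of_int k * T :: real"
  have [measurable]: "u \<in> borel_measurable borel" using u by auto
  have "integrable (distr ?P lborel ?s) u" using u by (simp add: tiling T)
  then have *: "integrable ?P (\<lambda>(t, k). u (t + of_int k * T))"
    by (subst (asm) integrable_distr_eq) (auto simp: case_prod_unfold)
  have "(LINT s|lborel. u s) = (LINT s|distr ?P lborel ?s. u s)" by (simp add: tiling T)
  also have "\<dots> = (LINT p|?P. u (?s p))" by (rule integral_distr) auto
  also have "\<dots> = (LINT t|lborel_upto T. periodize T u t)"
    unfolding periodize_def upto_int.integral_fst[OF *] by (simp add: case_prod_unfold)
  finally show "(LINT t|lborel_upto T. periodize T u t) = (LINT s|lborel. u s)" ..
qed

lemma periodize_translate: "periodize T u (t + of_int j * T) = periodize T u t"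
proof -
  have "periodize T u t = (LINT k|distr (count_space UNIV) (count_space UNIV) ((+) j). u (t + of_int k * T))"
    unfolding periodize_def by (subst distr_bij_count_space) (auto intro: bij_plus)
  also have "\<dots> = (LINT k|count_space UNIV. u (t + of_int (j + k) * T))"
    by (rule integral_distr) auto
  also have "\<dots> = periodize T u (t + of_int j * T)"
    by (simp add: periodize_def algebra_simps)
  finally show ?thesis ..
qed

lemma periodize_mult_periodic:
  assumes "\<And>k::int. p (t + of_int k * T) = p t"
  shows "periodize T (\<lambda>t. u t * p t) t = periodize T u t * p t"
  using assms by (simp add: periodize_def)

section \<open>Completeness of the trigonometric system\<close>

text \<open>The usual \<open>\<pi>\<close>-\<open>\<lambda>\<close> argument for open intervals, packaged as an induction rule.\<close>

lemma borel_real_induct [consumes 1, case_names interval compl union]: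
  fixes A :: "real set"
  assumes A: "A \<in> sets borel"
    and interval: "\<And>a b. P {a<..<b}"
    and compl: "\<And>A. A \<in> sets borel \<Longrightarrow> P A \<Longrightarrow> P (- A)"
    and union: "\<And>A. (\<And>i::nat. A i \<in> sets borel) \<Longrightarrow> disjoint_family A \<Longrightarrow> (\<And>i. P (A i)) \<Longrightarrow> P (\<Union>i. A i)"
  shows "P A"
proof -
  let ?G = "range (\<lambda>(a::real, b). {a<..<b})"
  have B: "borel = sigma UNIV ?G"
    using borel_eq_box[where 'a=real] by simp
  have sets: "sets borel = sigma_sets UNIV ?G"
    by (subst B) (rule sets_measure_of, simp)
  have "Int_stable ?G"
  proof -
    have "{a<..<b} \<inter> {c<..<d} = {max a c<..<min b d}" for a b c d :: real by auto
    then show ?thesis by (force simp: Int_stable_def)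
  qed
  moreover have "?G \<subseteq> Pow UNIV" by simp
  moreover have "A \<in> sigma_sets UNIV ?G"
    using A unfolding sets .
  ultimately show ?thesis
  proof (induction rule: sigma_sets_induct_disjoint)
    case (basic A)
    then show ?case using interval by auto
  next
    case empty
    show ?case using interval[of 0 0] by simp
  next
    case (compl A)
    then show ?case using assms(3)[of A] unfolding sets Compl_eq_Diff_UNIV by blast
  next
    case (union A)
    then show ?case unfolding sets[symmetric] by (intro assms(4)) auto
  qed
qed

context orthogonal_system
begin

lemma approximable_square_integrable: "approximable f \<Longrightarrow> square_integrable M f"
  by (simp add: approximable_def)

lemma approximable_limit:
  assumes f: "square_integrable M f"
    and lim: "\<And>\<epsilon>. \<epsilon> > 0 \<Longrightarrow> \<exists>g. approximable g \<and> norm_on M (\<lambda>t. f t - g t) < \<epsilon>"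
  shows "approximable f"
  unfolding approximable_def
proof (intro conjI allI impI)
  fix \<epsilon> :: real assume "\<epsilon> > 0"
  then have \<epsilon>: "\<epsilon> / 2 > 0" by simp
  obtain g where g: "approximable g" "norm_on M (\<lambda>t. f t - g t) < \<epsilon> / 2"
    using lim[OF \<epsilon>] by blast
  obtain R where R: "R \<in> finite_span" "norm_on M (\<lambda>t. g t - R t) < \<epsilon> / 2"
    using g(1) \<epsilon> unfolding approximable_def by blast
  have "norm_on M (\<lambda>t. (f t - g t) + (g t - R t)) \<le> norm_on M (\<lambda>t. f t - g t) + norm_on M (\<lambda>t. g t - R t)"
    by (intro norm_on_triangle square_integrable_diff f approximable_square_integrable[OF g(1)] square_integrable_finite_span[OF R(1)])
  also have "\<dots> < \<epsilon>" using g R by simp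
  finally show "\<exists>R\<in>finite_span. norm_on M (\<lambda>t. f t - R t) < \<epsilon>"
    using R(1) by (auto intro!: bexI[of _ R])
qed fact

lemma approximable_finite_span: "f \<in> finite_span \<Longrightarrow> approximable f"
  unfolding approximable_def
proof (intro conjI allI impI)
  fix \<epsilon> :: real assume "f \<in> finite_span" "\<epsilon> > 0"
  then show "\<exists>R\<in>finite_span. norm_on M (\<lambda>t. f t - R t) < \<epsilon>"
    by (intro bexI[of _ f]) (simp_all add: norm_on_def)
qed (rule square_integrable_finite_span)

lemma approximable_scale:
  assumes "approximable f" shows "approximable (\<lambda>t. c * f t)"
proof (cases "c = 0")
  case True
  have "(\<lambda>t. 0 * E undefined t) \<in> finite_span" by (intro finite_span.intros)
  then show ?thesis using True approximable_finite_span by simp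
next
  case False
  show ?thesis
  proof (rule approximable_limit)
    show "square_integrable M (\<lambda>t. c * f t)" using assms by (intro square_integrable_scale approximable_square_integrable)
    fix \<epsilon> :: real assume "\<epsilon> > 0"
    then have "\<epsilon> / cmod c > 0" using False by simp
    then obtain R where R: "R \<in> finite_span" "norm_on M (\<lambda>t. f t - R t) < \<epsilon> / cmod c"
      using assms unfolding approximable_def by blast
    have "norm_on M (\<lambda>t. c * f t - c * R t) < \<epsilon>"
      unfolding right_diff_distrib[symmetric] norm_on_scale using R(2) False by (simp add: field_simps)
    with R(1) show "\<exists>g. approximable g \<and> norm_on M (\<lambda>t. c * f t - g t) < \<epsilon>"
      by (intro exI[of _ "\<lambda>t. c * R t"] conjI approximable_finite_span finite_span.scale)
  qed
qed

lemma approximable_add: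
  assumes "approximable f" "approximable g" shows "approximable (\<lambda>t. f t + g t)"
proof (rule approximable_limit)
  show "square_integrable M (\<lambda>t. f t + g t)" using assms by (intro square_integrable_add approximable_square_integrable)
  fix \<epsilon> :: real assume "\<epsilon> > 0"
  then have \<epsilon>: "\<epsilon> / 2 > 0" by simp
  obtain R S where R: "R \<in> finite_span" "norm_on M (\<lambda>t. f t - R t) < \<epsilon> / 2"
    and S: "S \<in> finite_span" "norm_on M (\<lambda>t. g t - S t) < \<epsilon> / 2"
    using assms \<epsilon> unfolding approximable_def by blast
  have "norm_on M (\<lambda>t. (f t - R t) + (g t - S t)) \<le> norm_on M (\<lambda>t. f t - R t) + norm_on M (\<lambda>t. g t - S t)"
    by (intro norm_on_triangle square_integrable_diff assms[THEN approximable_square_integrable] square_integrable_finite_span R(1) S(1))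
  also have "\<dots> < \<epsilon>" using R S by simp
  also have "(\<lambda>t. (f t - R t) + (g t - S t)) = (\<lambda>t. f t + g t - (R t + S t))" by (simp add: algebra_simps)
  finally show "\<exists>h. approximable h \<and> norm_on M (\<lambda>t. f t + g t - h t) < \<epsilon>"
    using R(1) S(1) by (intro exI[of _ "\<lambda>t. R t + S t"] conjI approximable_finite_span finite_span.add)
qed

lemma approximable_diff:
  "approximable f \<Longrightarrow> approximable g \<Longrightarrow> approximable (\<lambda>t. f t - g t)"
  using approximable_add[OF _ approximable_scale[of g "-1"], of f] by simp

lemma approximable_zero: "approximable (\<lambda>t. 0)"
  using approximable_scale[OF approximable_finite_span[OF finite_span.member[of undefined]], of 0] by simp

lemma approximable_sum:
  "(\<And>i. i \<in> F \<Longrightarrow> approximable (f i)) \<Longrightarrow> approximable (\<lambda>t. \<Sum>i\<in>F. f i t)"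
  by (induction F rule: infinite_finite_induct) (auto intro: approximable_zero approximable_add)

lemma approximable_cong:
  assumes "approximable f" "\<And>t. t \<in> space M \<Longrightarrow> f t = g t" shows "approximable g"
proof (rule approximable_limit)
  have "square_integrable M f" using assms(1) by (rule approximable_square_integrable)
  moreover have "g \<in> borel_measurable M"
    using assms(2) measurable_cong[of M f g] approximable_square_integrable[OF assms(1)] by (simp add: square_integrable_def)
  ultimately show g: "square_integrable M g"
    by (rule square_integrable_dominated) (use assms(2) in auto)
  have "norm_on M (\<lambda>t. g t - f t) = norm_on M (\<lambda>t. 0)"
    unfolding norm_on_def using assms(2) by (intro arg_cong[of _ _ sqrt] Bochner_Integration.integral_cong) auto
  then show "\<exists>h. approximable h \<and> norm_on M (\<lambda>t. g t - h t) < \<epsilon>" if "\<epsilon> > 0" for \<epsilon>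
    using assms(1) that by (auto intro!: exI[of _ f] simp: norm_on_def)
qed

text \<open>The closed span is closed under dominated pointwise limits.  This is what lets the approximation
climb from continuous functions to indicators and from simple functions to all of \<open>L\<^sup>2\<close>.\<close>

lemma approximable_dominated_convergence:
  assumes f: "\<And>i::nat. approximable (f i)" and G: "square_integrable M G" and g: "g \<in> borel_measurable M"
    and lim: "AE t in M. (\<lambda>i. f i t) \<longlonglongrightarrow> g t"
    and bound: "\<And>i. AE t in M. cmod (f i t) \<le> cmod (G t)"
  shows "approximable g"
proof (rule approximable_limit)
  have [measurable]: "f i \<in> borel_measurable M" "G \<in> borel_measurable M" "g \<in> borel_measurable M" for i
    using approximable_square_integrable[OF f] G g by (auto simp: square_integrable_def)
  have bound': "AE t in M. \<forall>i. cmod (f i t) \<le> cmod (G t)"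
    using bound by (simp add: AE_all_countable)
  have gG: "AE t in M. cmod (g t) \<le> cmod (G t)"
    using lim bound'
  proof eventually_elim
    case (elim t)
    show ?case by (rule LIMSEQ_le_const2[OF tendsto_norm[OF elim(1)]]) (use elim(2) in auto)
  qed
  show "square_integrable M g" by (rule square_integrable_dominated[OF G g gG])
  have "(\<lambda>i. LINT t|M. (cmod (g t - f i t))\<^sup>2) \<longlonglongrightarrow> (LINT t|M. 0)"
  proof (rule integral_dominated_convergence[where w="\<lambda>t. 4 * (cmod (G t))\<^sup>2"])
    show "AE t in M. (\<lambda>i. (cmod (g t - f i t))\<^sup>2) \<longlonglongrightarrow> 0"
      using lim
    proof eventually_elim
      case (elim t)
      have "(\<lambda>i. (cmod (g t - f i t))\<^sup>2) \<longlonglongrightarrow> (cmod (g t - g t))\<^sup>2"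
        by (intro tendsto_intros elim)
      then show ?case by simp
    qed
    show "integrable M (\<lambda>t. 4 * (cmod (G t))\<^sup>2)" using G by (simp add: square_integrable_def)
    show "AE t in M. norm ((cmod (g t - f i t))\<^sup>2) \<le> 4 * (cmod (G t))\<^sup>2" for i
      using bound[of i] gG
    proof eventually_elim
      case (elim t)
      have "cmod (g t - f i t) \<le> 2 * cmod (G t)"
        using norm_triangle_ineq4[of "g t" "f i t"] elim by simp
      from power_mono[OF this norm_ge_zero, of 2] show ?case by (simp add: power_mult_distrib)
    qed
  qed auto
  then have "(\<lambda>i. norm_on M (\<lambda>t. g t - f i t)) \<longlonglongrightarrow> sqrt 0"
    unfolding norm_on_def by (intro tendsto_real_sqrt) simp
  then show "\<exists>h. approximable h \<and> norm_on M (\<lambda>t. g t - h t) < \<epsilon>" if "\<epsilon> > 0" for \<epsilon>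
    using order_tendstoD(2)[of _ "sqrt 0" sequentially \<epsilon>] that f
    by (fastforce simp: eventually_sequentially)
qed

end

lemma measure_lborel_upto: "T > 0 \<Longrightarrow> measure (lborel_upto T) {0<..<T} = T"
proof -
  assume T: "T > 0"
  have "measure (lborel_upto T) {0<..<T} = measure lborel {0<..<T}"
    unfolding lborel_upto_def by (rule measure_restrict_space) simp_all
  also have "\<dots> = T - 0" by (rule measure_lborel_Ioo) (use T in simp)
  finally show ?thesis by simp
qed

definition trig :: "real \<Rightarrow> int \<Rightarrow> real \<Rightarrow> complex" where
  "trig T n t = cis (2 * pi * of_int n * t / T)"

lemma cis_borel [measurable]: "cis \<in> borel_measurable borel"
  by (intro borel_measurable_continuous_onI continuous_intros)

lemma trig_measurable [measurable]: "trig T n \<in> borel_measurable borel"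
  unfolding trig_def[abs_def] by (rule measurable_compose[OF _ cis_borel]) simp

lemma norm_trig [simp]: "cmod (trig T n t) = 1"
  by (simp add: trig_def)

lemma trig_mult: "trig T m t * trig T n t = trig T (m + n) t"
proof -
  have "2 * pi * of_int m * t / T + 2 * pi * of_int n * t / T = 2 * pi * of_int (m + n) * t / T"
    by (simp add: distrib_left distrib_right add_divide_distrib)
  then show ?thesis unfolding trig_def cis_mult by (rule arg_cong)
qed

lemma trig_0 [simp]: "trig T 0 t = 1"
  by (simp add: trig_def)

lemma cnj_trig: "cnj (trig T n t) = trig T (- n) t"
  unfolding trig_def cis_cnj by simp

lemma integral_trig:
  assumes T: "T > 0"
  shows "(LINT t|lborel_upto T. trig T n t) = (if n = 0 then of_real T else 0)"
proof -
  have ae: "AE t in lborel. t \<noteq> 0 \<and> t \<noteq> T"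
    using AE_lborel_singleton[of 0] AE_lborel_singleton[of T] by eventually_elim auto
  have "(LINT t|lborel_upto T. trig T n t) = (LINT t:{0..T}|lborel. trig T n t)"
    unfolding integral_lborel_upto set_lebesgue_integral_def
  proof (rule integral_cong_AE)
    show "AE t in lborel. indicat_real {0<..<T} t *\<^sub>R trig T n t = indicat_real {0..T} t *\<^sub>R trig T n t"
      using ae by eventually_elim (auto simp: indicator_def)
  qed auto
  also have "\<dots> = (if n = 0 then of_real T else 0)"
  proof (cases "n = 0")
    case True
    then show ?thesis using T by (simp add: trig_def set_lebesgue_integral_def scaleR_conv_of_real)
  next
    case False
    define c where "c = 2 * pi * of_int n / T"
    have c: "c \<noteq> 0" using False T by (simp add: c_def)
    have "(LINT t:{0..T}|lborel. trig T n t) = (LINT t|lborel. indicator {0..T} t *\<^sub>R cis (c * t))"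
      by (simp add: set_lebesgue_integral_def trig_def c_def)
    also have "\<dots> = cis (c * T) / (\<i> * of_real c) - cis (c * 0) / (\<i> * of_real c)"
    proof (rule integral_FTC_atLeastAtMost)
      fix x
      have "((\<lambda>z. exp (k * z) / k) has_field_derivative exp (k * w)) (at w)" if "k \<noteq> 0" for k w :: complex
      proof -
        have "((\<lambda>z. exp (k * z)) has_field_derivative exp (k * w) * k) (at w)"
          by (rule DERIV_chain2[OF DERIV_exp DERIV_cmult_Id])
        from DERIV_cdivide[OF this, of k] that show ?thesis by simp
      qed
      from has_vector_derivative_real_field[OF this, of "\<i> * of_real c" x "{0..T}"] c
      show "((\<lambda>t. cis (c * t) / (\<i> * of_real c)) has_vector_derivative cis (c * x)) (at x within {0..T})"
        by (simp only: cis_conv_exp of_real_mult mult.assoc) simp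
    next
      show "continuous_on {0..T} (\<lambda>t. cis (c * t))" by (intro continuous_intros)
    qed (use T in simp)
    also have "cis (c * T) = 1"
      using T cis_multiple_2pi[of n] by (simp add: c_def mult_ac)
    finally show ?thesis using False by simp
  qed
  finally show ?thesis .
qed

lemma orthogonal_system_trig:
  assumes "T > 0"
  shows "orthogonal_system (lborel_upto T) (trig T) T"
proof
  show "square_integrable (lborel_upto T) (trig T n)" for n
  proof (rule square_integrable_bounded[OF finite_measure_lborel_upto])
    show "AE t in lborel_upto T. cmod (trig T n t) \<le> 1" by simp
  qed (rule borel_measurable_lborel_upto[OF trig_measurable])
  show "inner_on (lborel_upto T) (trig T m) (trig T n) = (if m = n then of_real T else 0)" for m n
    unfolding inner_on_def cnj_trig trig_mult integral_trig[OF assms] by simp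
qed fact

context
  fixes T :: real assumes T: "T > 0"
begin

interpretation orthogonal_system "lborel_upto T" "trig T" T
  by (rule orthogonal_system_trig[OF T])

text \<open>Trigonometric polynomials form an algebra, which makes the theorem of Stone and Weierstrass
applicable to them.\<close>

lemma trig_polynomial_mult:
  assumes "f \<in> finite_span" "g \<in> finite_span" shows "(\<lambda>t. f t * g t) \<in> finite_span"
proof -
  have *: "(\<lambda>t. trig T m t * h t) \<in> finite_span" if "h \<in> finite_span" for h m
    using that
  proof (induction rule: finite_span.induct)
    case (member n)
    show ?case unfolding trig_mult by (rule finite_span.member)
  next
    case (scale f c)
    show ?case using finite_span.scale[OF scale.IH, of c] by (simp only: mult.left_commute)
  next
    case (add f g)
    show ?case using finite_span.add[OF add.IH] by (simp only: distrib_left)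
  qed
  from assms(1) show ?thesis
  proof (induction rule: finite_span.induct)
    case (member n)
    show ?case using assms(2) by (rule *)
  next
    case (scale f c)
    show ?case using finite_span.scale[OF scale.IH, of c] by (simp only: mult.assoc)
  next
    case (add f g)
    show ?case using finite_span.add[OF add.IH] by (simp only: distrib_right)
  qed
qed

text \<open>A real linear function of \<open>cis x\<close> is a combination of \<open>cis x\<close> and \<open>cis (- x)\<close>; sums and products are
covered by the algebra property.\<close>

lemma real_polynomial_on_circle:
  assumes "real_polynomial_function p"
  shows "(\<lambda>t. complex_of_real (p (cis (2 * pi * t / T)))) \<in> finite_span"
  using assms
proof (induction rule: real_polynomial_function.induct)
  case (linear f)
  interpret f: bounded_linear f by fact
  have lin: "f z = Re z * f 1 + Im z * f \<i>" for z
  proof -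
    have "z = Re z *\<^sub>R 1 + Im z *\<^sub>R \<i>" by (simp add: complex_eq_iff)
    then have "f z = f (Re z *\<^sub>R 1 + Im z *\<^sub>R \<i>)" by (rule arg_cong)
    then show ?thesis by (simp add: f.add f.scaleR)
  qed
  have "complex_of_real (f (cis x)) = (of_real (f 1) / 2 - \<i> * of_real (f \<i>) / 2) * cis x
     + (of_real (f 1) / 2 + \<i> * of_real (f \<i>) / 2) * cis (- x)" for x
    unfolding lin[of "cis x"] by (simp add: complex_eq_iff mult.commute)
  then have "(\<lambda>t. complex_of_real (f (cis (2 * pi * t / T))))
    = (\<lambda>t. (of_real (f 1) / 2 - \<i> * of_real (f \<i>) / 2) * trig T 1 t
     + (of_real (f 1) / 2 + \<i> * of_real (f \<i>) / 2) * trig T (-1) t)"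
    by (simp add: trig_def)
  then show ?case
    by (simp only:) (intro finite_span.intros)
next
  case (const c)
  have "(\<lambda>t. of_real c * trig T 0 t) \<in> finite_span" by (intro finite_span.intros)
  then show ?case by simp
next
  case (add f g)
  show ?case using finite_span.add[OF add.IH] by (simp only: of_real_add)
next
  case (mult f g)
  show ?case using trig_polynomial_mult[OF mult.IH] by (simp only: of_real_mult)
qed

text \<open>Stone-Weierstrass on the unit circle; uniform closeness \<open>\<delta>\<close> costs at most \<open>\<delta> \<sqdot> sqrt T\<close> in norm.\<close>

lemma approximable_continuous_on_circle:
  assumes "continuous_on (sphere 0 1) \<phi>"
  shows "approximable (\<lambda>t. complex_of_real (\<phi> (cis (2 * pi * t / T))))"
proof (rule approximable_limit)
  let ?f = "\<lambda>t. complex_of_real (\<phi> (cis (2 * pi * t / T)))"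
  have cont: "continuous_on UNIV ?f"
  proof -
    have "continuous_on UNIV (\<lambda>t. cis (2 * pi * t / T))"
      by (intro continuous_intros) (use T in simp)
    then have "continuous_on UNIV (\<lambda>t. \<phi> (cis (2 * pi * t / T)))"
      by (rule continuous_on_compose2[OF assms]) auto
    then show ?thesis by (rule continuous_on_of_real)
  qed
  have "bounded (\<phi> ` sphere 0 1)"
    by (rule compact_imp_bounded[OF compact_continuous_image[OF assms compact_sphere]])
  then obtain B where "\<forall>z\<in>sphere 0 1. \<bar>\<phi> z\<bar> \<le> B"
    unfolding bounded_iff by auto
  then have "AE t in lborel_upto T. cmod (?f t) \<le> B" by simp
  then show f: "square_integrable (lborel_upto T) ?f"
    by (rule square_integrable_bounded[OF finite_measure_lborel_upto
          borel_measurable_lborel_upto[OF borel_measurable_continuous_onI[OF cont]]])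
  fix \<epsilon> :: real assume \<epsilon>: "\<epsilon> > 0"
  define \<delta> where "\<delta> = \<epsilon> / (2 * sqrt T)"
  have \<delta>: "\<delta> > 0" using T \<epsilon> by (simp add: \<delta>_def)
  obtain p where p: "real_polynomial_function p" "\<And>z. z \<in> sphere 0 1 \<Longrightarrow> \<bar>\<phi> z - p z\<bar> < \<delta>"
    using Stone_Weierstrass_real_polynomial_function[OF _ assms \<delta>] by auto
  let ?p = "\<lambda>t. complex_of_real (p (cis (2 * pi * t / T)))"
  have P: "?p \<in> finite_span" using p(1) by (rule real_polynomial_on_circle)
  have "(LINT t|lborel_upto T. (cmod (?f t - ?p t))\<^sup>2) \<le> (LINT t|lborel_upto T. \<delta>\<^sup>2)"
  proof (rule integral_mono)
    show "integrable (lborel_upto T) (\<lambda>t. (cmod (?f t - ?p t))\<^sup>2)"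
      using square_integrable_diff[OF f square_integrable_finite_span[OF P]] by (rule square_integrable_integrable)
    show "(cmod (?f t - ?p t))\<^sup>2 \<le> \<delta>\<^sup>2" for t
    proof (rule power_mono)
      show "cmod (?f t - ?p t) \<le> \<delta>"
        unfolding of_real_diff[symmetric] norm_of_real
        using p(2)[of "cis (2 * pi * t / T)"] by simp
    qed simp
  qed auto
  also have "\<dots> = (\<delta> * sqrt T)\<^sup>2"
    using T by (simp add: measure_lborel_upto power_mult_distrib)
  finally have "norm_on (lborel_upto T) (\<lambda>t. ?f t - ?p t) \<le> sqrt ((\<delta> * sqrt T)\<^sup>2)"
    unfolding norm_on_def by (rule real_sqrt_le_mono)
  also have "\<dots> < \<epsilon>" using T \<epsilon> \<delta> by (simp add: \<delta>_def)
  finally show "\<exists>g. approximable g \<and> norm_on (lborel_upto T) (\<lambda>t. ?f t - g t) < \<epsilon>"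
    using approximable_finite_span[OF P] by blast
qed

lemma cis_circle_inj:
  assumes "cis (2 * pi * s / T) = cis (2 * pi * t / T)" "0 \<le> s" "s \<le> T" "0 < t" "t < T"
  shows "s = t"
proof -
  obtain n :: int where n: "2 * pi * s / T = 2 * pi * t / T + 2 * pi * of_int n"
    using assms(1) sin_cos_eq_iff[of "2 * pi * s / T" "2 * pi * t / T"] by (auto simp: complex_eq_iff)
  have "2 * pi * (s / T) = 2 * pi * (t / T + of_int n)" using n by (simp add: algebra_simps)
  then have *: "s / T = t / T + of_int n" by (subst (asm) mult_left_cancel) auto
  have "s / T - t / T < 1" "s / T - t / T > -1"
    using assms T by (auto simp: field_simps)
  then have "n = 0" using * by linarith
  then show ?thesis using * T by simp
qed

text \<open>With \<open>K\<close> the image on the circle of the complement of the interval, the continuous functions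
\<open>min 1 (i \<sqdot> infdist z K)\<close> increase to the indicator of the complement of \<open>K\<close>.  The point 0 is added to
that complement so that \<open>K\<close> is never empty.\<close>

lemma approximable_indicator_interval: "approximable (indicator {a<..<b})"
proof (rule approximable_dominated_convergence)
  define K where "K = (\<lambda>t. cis (2 * pi * t / T)) ` (({0..T} - {a<..<b}) \<union> {0})"
  have "compact (({0..T} - {a<..<b}) \<union> {0})"
    by (intro compact_Un compact_diff compact_Icc open_greaterThanLessThan) simp
  then have "compact K"
    unfolding K_def using T by (intro compact_continuous_image continuous_intros) auto
  then have K: "closed K" "K \<noteq> {}"
    by (rule compact_imp_closed) (simp add: K_def)
  have K_iff: "cis (2 * pi * t / T) \<in> K \<longleftrightarrow> t \<notin> {a<..<b}" if "0 < t" "t < T" for t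
  proof
    assume "cis (2 * pi * t / T) \<in> K"
    then obtain s where "s \<in> ({0..T} - {a<..<b}) \<union> {0}" "cis (2 * pi * s / T) = cis (2 * pi * t / T)"
      unfolding K_def by force
    with cis_circle_inj[of s t] that T show "t \<notin> {a<..<b}" by auto
  qed (use that in \<open>auto simp: K_def\<close>)
  define \<phi> where "\<phi> = (\<lambda>i::nat. \<lambda>z. min 1 (real i * infdist z K))"
  show "approximable (\<lambda>t. complex_of_real (\<phi> i (cis (2 * pi * t / T))))" for i
    unfolding \<phi>_def by (intro approximable_continuous_on_circle continuous_intros)
  show "AE t in lborel_upto T. cmod (complex_of_real (\<phi> i (cis (2 * pi * t / T)))) \<le> cmod (trig T 0 t)" for i
    by (intro AE_I2) (auto simp: \<phi>_def infdist_nonneg)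
  show "AE t in lborel_upto T. (\<lambda>i. complex_of_real (\<phi> i (cis (2 * pi * t / T)))) \<longlonglongrightarrow> indicator {a<..<b} t"
  proof (rule AE_I2)
    fix t assume "t \<in> space (lborel_upto T)"
    then have t: "0 < t" "t < T" by auto
    define d where "d = infdist (cis (2 * pi * t / T)) K"
    have d0: "d = 0 \<longleftrightarrow> t \<notin> {a<..<b}"
      unfolding d_def K_iff[OF t, symmetric] using in_closed_iff_infdist_zero[OF K] by blast
    show "(\<lambda>i. complex_of_real (\<phi> i (cis (2 * pi * t / T)))) \<longlonglongrightarrow> indicator {a<..<b} t"
    proof (cases "t \<in> {a<..<b}")
      case True
      then have d: "d > 0" using d0 infdist_nonneg[of _ K] by (metis d_def less_eq_real_def)
      obtain N :: nat where N: "1 / d < real N" using reals_Archimedean2 by blast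
      have "complex_of_real (\<phi> i (cis (2 * pi * t / T))) = 1" if "i \<ge> N" for i
      proof -
        have "1 / d \<le> real i" using N that by linarith
        then have "1 \<le> real i * d" using d by (simp add: field_simps)
        then show ?thesis by (simp add: \<phi>_def d_def)
      qed
      then show ?thesis using True
        by (intro tendsto_eventually) (auto simp: eventually_sequentially)
    next
      case False
      then show ?thesis using d0 by (simp add: \<phi>_def d_def[symmetric])
    qed
  qed
  show "square_integrable (lborel_upto T) (trig T 0)" by (rule square_integrable_E)
qed (intro borel_measurable_lborel_upto, measurable)

lemma approximable_indicator:
  assumes "A \<in> sets borel" shows "approximable (indicator A)"
  using assms
proof (induction rule: borel_real_induct)
  case (interval a b)
  show ?case by (rule approximable_indicator_interval)
next
  case (compl A)
  have "approximable (\<lambda>t. trig T 0 t - indicator A t)"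
    by (rule approximable_diff[OF approximable_finite_span[OF finite_span.member] compl(2)])
  then show ?case by (rule approximable_cong) (auto simp: indicator_def)
next
  case (union A)
  note [measurable] = union(1)
  have ind: "(\<lambda>t. \<Sum>i<n. indicator (A i) t) = (indicator (\<Union>i<n. A i) :: real \<Rightarrow> complex)" for n
    using union(2) by (intro ext indicator_UN_disjoint[symmetric]) (auto intro: disjoint_family_on_mono)
  show ?case
  proof (rule approximable_dominated_convergence)
    show "approximable (indicator (\<Union>i<n. A i))" for n
      unfolding ind[symmetric] by (intro approximable_sum union)
    show "square_integrable (lborel_upto T) (trig T 0)" by (rule square_integrable_E)
    show "AE t in lborel_upto T. cmod (indicator (\<Union>i<n. A i) t) \<le> cmod (trig T 0 t)" for n
      by (simp add: indicator_def)
    show "AE t in lborel_upto T. (\<lambda>n. indicator (\<Union>i<n. A i) t) \<longlonglongrightarrow> (indicator (\<Union>i. A i) t :: complex)"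
      by (intro AE_I2 LIMSEQ_indicator_UN)
  qed (intro borel_measurable_lborel_upto, measurable)
qed

text \<open>Completeness of the exponentials in \<open>L\<^sup>2(0,T)\<close>, by approximating with simple functions.\<close>

theorem trig_complete:
  assumes f: "square_integrable (lborel_upto T) f"
  shows "approximable f"
proof -
  have "f \<in> borel_measurable (lborel_upto T)" using f by (simp add: square_integrable_def)
  from borel_measurable_implies_sequence_metric[OF this, of 0]
  obtain F where F: "\<And>i. simple_function (lborel_upto T) (F i)"
      "\<And>t. t \<in> space (lborel_upto T) \<Longrightarrow> (\<lambda>i. F i t) \<longlonglongrightarrow> f t"
      "\<And>i t. t \<in> space (lborel_upto T) \<Longrightarrow> cmod (F i t) \<le> 2 * cmod (f t)"
    unfolding dist_norm diff_zero norm_minus_commute[of 0] by metis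
  show ?thesis
  proof (rule approximable_dominated_convergence)
    fix i
    let ?S = "\<lambda>y. F i -` {y} \<inter> space (lborel_upto T)"
    have "?S y \<in> sets borel" for y
      using simple_functionD(2)[OF F(1), of i "{y}"]
      by (auto simp: lborel_upto_def sets_restrict_space)
    then have "approximable (\<lambda>t. \<Sum>y\<in>F i ` space (lborel_upto T). y * indicator (?S y) t)"
      by (intro approximable_sum approximable_scale approximable_indicator)
    then show "approximable (F i)"
    proof (rule approximable_cong)
      fix t assume t: "t \<in> space (lborel_upto T)"
      show "(\<Sum>y\<in>F i ` space (lborel_upto T). y * indicator (?S y) t) = F i t"
        by (rule trans[OF sum.cong simple_function_indicator_representation_banach[OF F(1) t, symmetric]])
          (auto simp: indicator_def)
    qed
  next
    show "square_integrable (lborel_upto T) (\<lambda>t. 2 * f t)" using f by (rule square_integrable_scale)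
    show "AE t in lborel_upto T. (\<lambda>i. F i t) \<longlonglongrightarrow> f t" using F(2) by (rule AE_I2)
    show "AE t in lborel_upto T. cmod (F i t) \<le> cmod (2 * f t)" for i
      using F(3) by (intro AE_I2) (simp add: norm_mult)
  qed (use f in \<open>simp add: square_integrable_def\<close>)
qed

end

section \<open>Fourier inversion\<close>

definition fourier :: "(real \<Rightarrow> complex) \<Rightarrow> real \<Rightarrow> complex" where
  "fourier f \<xi> = (LINT t|lborel. f t * cis (- 2 * pi * \<xi> * t))"

text \<open>The vanishing of integrals passes from intervals to all Borel sets by complements and disjoint
unions, and a function all of whose integrals vanish is zero almost everywhere.\<close>

lemma AE_zero_if_interval_integrals_zero:
  fixes W :: "real \<Rightarrow> complex"
  assumes W: "integrable lborel W"
    and zero: "\<And>a b. a < b \<Longrightarrow> (LINT t:{a<..<b}|lborel. W t) = 0"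
  shows "AE t in lborel. W t = 0"
proof (rule sigma_finite_measure.density_zero[OF sigma_finite_lborel W])
  fix A :: "real set" assume A: "A \<in> sets lborel"
  have set_int: "set_integrable lborel A W" if "A \<in> sets borel" for A
    using W that unfolding set_integrable_def by (intro integrable_mult_indicator) auto
  have total: "(LINT t|lborel. W t) = 0"
  proof -
    have "(\<lambda>n. LINT t:{- real n<..<real n}|lborel. W t) \<longlonglongrightarrow> (LINT t:(\<Union>n. {- real n<..<real n})|lborel. W t)"
      by (rule set_integral_cont_up) (auto simp: incseq_def intro: set_int)
    moreover have "(\<Union>n. {- real n<..<real n}) = UNIV"
    proof -
      have "\<exists>n. x \<in> {- real n<..<real n}" for x
      proof -
        obtain n where "\<bar>x\<bar> < real n" using reals_Archimedean2 by blast
        then show ?thesis by (intro exI[of _ n]) auto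
      qed
      then show ?thesis by blast
    qed
    moreover have "(LINT t:{- real n<..<real n}|lborel. W t) = 0" for n
      using zero[of "- real n" "real n"] by (cases "n = 0") (auto simp: set_lebesgue_integral_def)
    ultimately show ?thesis
      by (simp add: LIMSEQ_const_iff set_lebesgue_integral_def)
  qed
  have "A \<in> sets borel" using A by simp
  then show "(LINT t:A|lborel. W t) = 0"
  proof (induction rule: borel_real_induct)
    case (interval a b)
    show ?case using zero[of a b] by (cases "a < b") (auto simp: set_lebesgue_integral_def)
  next
    case (compl A)
    note [measurable] = compl(1)
    have "(LINT t:A \<union> - A|lborel. W t) = (LINT t:A|lborel. W t) + (LINT t:- A|lborel. W t)"
      by (intro set_integral_Un set_int) auto
    then show ?case using compl(2) total by (simp add: set_lebesgue_integral_def)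
  next
    case (union A)
    note [measurable] = union(1)
    have "(LINT t:(\<Union>i. A i)|lborel. W t) = (\<Sum>i. LINT t:A i|lborel. W t)"
      using union(2) by (intro lebesgue_integral_countable_add set_int) (auto simp: disjoint_family_on_def)
    then show ?case using union(3) by simp
  qed
qed

text \<open>A Gaussian cut-off in frequency, tending to 1 as \<open>r\<close> grows, and its Fourier transform
\<open>gauss_kernel\<close>, an approximate identity.\<close>

definition gauss_weight :: "real \<Rightarrow> real \<Rightarrow> real" where
  "gauss_weight r \<xi> = exp (- (2 * pi * \<xi> / r)\<^sup>2 / 2)"

definition gauss_kernel :: "real \<Rightarrow> real \<Rightarrow> real" where
  "gauss_kernel r y = r * std_normal_density (r * y)"

lemma gauss_weight_measurable [measurable]: "gauss_weight r \<in> borel_measurable borel"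
  unfolding gauss_weight_def[abs_def] by measurable

lemma gauss_kernel_measurable [measurable]: "gauss_kernel r \<in> borel_measurable borel"
  unfolding gauss_kernel_def[abs_def] by measurable

lemma gauss_weight_eq:
  "gauss_weight r \<xi> = sqrt (2 * pi) * std_normal_density (0 + 2 * pi / r * \<xi>)"
  by (simp add: gauss_weight_def std_normal_density_def power_divide power_mult_distrib)

lemma integrable_gauss_weight:
  assumes "r > 0" shows "integrable lborel (gauss_weight r)"
proof -
  have "integrable lborel (\<lambda>\<xi>. std_normal_density (0 + 2 * pi / r * \<xi>))"
    using assms by (intro lborel_integrable_real_affine integrable_normal_density) auto
  then show ?thesis unfolding gauss_weight_eq[abs_def] by (rule integrable_mult_right)
qed

lemma gauss_weight_bounds: "0 \<le> gauss_weight r \<xi>" "gauss_weight r \<xi> \<le> 1"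
  by (simp_all add: gauss_weight_def)

lemma gauss_kernel_nonneg: "r > 0 \<Longrightarrow> 0 \<le> gauss_kernel r y"
  by (simp add: gauss_kernel_def normal_density_nonneg)

text \<open>The characteristic function of the standard normal distribution, rescaled.\<close>

lemma fourier_gauss_weight:
  assumes "r > 0"
  shows "(LINT \<xi>|lborel. of_real (gauss_weight r \<xi>) * cis (2 * pi * \<xi> * y)) = of_real (gauss_kernel r y)"
proof -
  define s where "s = 2 * pi / r"
  have s: "s > 0" using assms by (simp add: s_def)
  let ?F = "\<lambda>x. std_normal_density x *\<^sub>R cis (r * y * x)"
  have "of_real (exp (- (r * y)\<^sup>2 / 2)) = char std_normal_distribution (r * y)"
    by (simp add: char_std_normal_distribution)
  also have "\<dots> = (LINT x|lborel. ?F x)"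
    unfolding char_def by (subst integral_density) (auto simp: normal_density_nonneg cis_conv_exp)
  also have "\<dots> = \<bar>s\<bar> *\<^sub>R (LINT \<xi>|lborel. ?F (0 + s * \<xi>))"
    using s by (intro lborel_integral_real_affine) auto
  finally have "(LINT \<xi>|lborel. ?F (0 + s * \<xi>)) = of_real (exp (- (r * y)\<^sup>2 / 2) / s)"
    using s by (simp add: scaleR_conv_of_real field_simps)
  moreover have "of_real (gauss_weight r \<xi>) * cis (2 * pi * \<xi> * y) = of_real (sqrt (2 * pi)) * ?F (0 + s * \<xi>)" for \<xi>
  proof -
    have "r * y * (0 + s * \<xi>) = 2 * pi * \<xi> * y" using assms by (simp add: s_def)
    then show ?thesis unfolding gauss_weight_eq s_def[symmetric] by (simp only:) (simp add: scaleR_conv_of_real)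
  qed
  ultimately have "(LINT \<xi>|lborel. of_real (gauss_weight r \<xi>) * cis (2 * pi * \<xi> * y))
      = of_real (sqrt (2 * pi) * (exp (- (r * y)\<^sup>2 / 2) / s))"
    by (simp only: integral_mult_right_zero of_real_mult)
  also have "sqrt (2 * pi) * (exp (- (r * y)\<^sup>2 / 2) / s) = gauss_kernel r y"
  proof -
    have "sqrt (2 * pi) / s = r * (1 / sqrt (2 * pi))"
    proof -
      have "sqrt (2 * pi) * sqrt (2 * pi) = 2 * pi" by simp
      then show ?thesis using assms by (simp add: s_def field_simps)
    qed
    then have "sqrt (2 * pi) / s * exp (- (r * y)\<^sup>2 / 2) = r * (1 / sqrt (2 * pi)) * exp (- (r * y)\<^sup>2 / 2)"
      by simp
    then show ?thesis by (simp add: gauss_kernel_def std_normal_density_def)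
  qed
  finally show ?thesis .
qed

lemma integrable_product_lborel:
  fixes f :: "real \<Rightarrow> complex" and w :: "real \<Rightarrow> complex" and c :: "real \<Rightarrow> real \<Rightarrow> complex"
  assumes f: "integrable lborel f" and w: "integrable lborel w"
    and c: "(\<lambda>(x, y). c x y) \<in> borel_measurable (borel \<Otimes>\<^sub>M borel)" "\<And>x y. cmod (c x y) \<le> C"
  shows "integrable (lborel \<Otimes>\<^sub>M lborel) (\<lambda>(x, y). f x * w y * c x y)"
proof (rule Bochner_Integration.integrable_bound)
  have [measurable]: "f \<in> borel_measurable borel" "w \<in> borel_measurable borel" using f w by auto
  note c(1)[measurable]
  show "(\<lambda>(x, y). f x * w y * c x y) \<in> borel_measurable (lborel \<Otimes>\<^sub>M lborel)"
    by measurable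
  have "0 \<le> C" using c(2)[of 0 0] norm_ge_zero order_trans by blast
  show "integrable (lborel \<Otimes>\<^sub>M lborel) (\<lambda>(x, y). C * (cmod (f x) * cmod (w y)))"
  proof (rule lborel_pair.Fubini_integrable)
    show "integrable lborel (\<lambda>x. \<integral>y. norm (case (x, y) of (x, y) \<Rightarrow> C * (cmod (f x) * cmod (w y))) \<partial>lborel)"
      using f by (simp add: norm_mult abs_mult)
    show "AE x in lborel. integrable lborel (\<lambda>y. case (x, y) of (x, y) \<Rightarrow> C * (cmod (f x) * cmod (w y)))"
      using w by simp
  qed measurable
  have "cmod (f x * w y * c x y) \<le> norm (C * (cmod (f x) * cmod (w y)))" for x y
    using mult_left_mono[OF c(2)[of x y], of "cmod (f x) * cmod (w y)"] \<open>0 \<le> C\<close>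
    by (simp add: norm_mult abs_mult mult_ac)
  then show "AE p in lborel \<Otimes>\<^sub>M lborel. norm (case p of (x, y) \<Rightarrow> f x * w y * c x y)
      \<le> norm (case p of (x, y) \<Rightarrow> C * (cmod (f x) * cmod (w y)))"
    by (intro AE_I2) (auto split: prod.splits)
qed


lemma regularized_inversion:
  assumes f: "integrable lborel f" and r: "r > 0"
  shows "(LINT \<xi>|lborel. fourier f \<xi> * of_real (gauss_weight r \<xi>) * cis (2 * pi * \<xi> * x))
    = (LINT t|lborel. f t * of_real (gauss_kernel r (x - t)))"
proof -
  have [measurable]: "f \<in> borel_measurable borel" using f by auto
  let ?u = "\<lambda>t \<xi>. f t * of_real (gauss_weight r \<xi>) * cis (2 * pi * \<xi> * (x - t))"
  have int: "integrable (lborel \<Otimes>\<^sub>M lborel) (\<lambda>(t, \<xi>). ?u t \<xi>)"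
    by (rule integrable_product_lborel[OF f, where C=1])
      (use integrable_gauss_weight[OF r] in \<open>auto simp: complex_of_real_integrable_eq\<close>)
  have "fourier f \<xi> * of_real (gauss_weight r \<xi>) * cis (2 * pi * \<xi> * x) = (LINT t|lborel. ?u t \<xi>)" for \<xi>
  proof -
    have "cis (- 2 * pi * \<xi> * t) * cis (2 * pi * \<xi> * x) = cis (2 * pi * \<xi> * (x - t))" for t
      by (simp add: cis_mult algebra_simps)
    then have "?u t \<xi> = f t * cis (- 2 * pi * \<xi> * t) * (of_real (gauss_weight r \<xi>) * cis (2 * pi * \<xi> * x))" for t
      by (metis mult.assoc mult.commute)
    then have "(LINT t|lborel. ?u t \<xi>) = fourier f \<xi> * (of_real (gauss_weight r \<xi>) * cis (2 * pi * \<xi> * x))"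
      by (simp only: integral_mult_left_zero fourier_def)
    then show ?thesis by (simp only: mult.assoc)
  qed
  then have "(LINT \<xi>|lborel. fourier f \<xi> * of_real (gauss_weight r \<xi>) * cis (2 * pi * \<xi> * x))
      = (LINT \<xi>|lborel. LINT t|lborel. ?u t \<xi>)"
    by (simp only:)
  also have "\<dots> = (LINT t|lborel. LINT \<xi>|lborel. ?u t \<xi>)"
    by (rule lborel_pair.Fubini_integral[OF int])
  also have "\<dots> = (LINT t|lborel. f t * of_real (gauss_kernel r (x - t)))"
    unfolding mult.assoc[of "f _"] integral_mult_right_zero fourier_gauss_weight[OF r] ..
  finally show ?thesis .
qed

lemma integral_std_normal_density: "(LINT u|lborel. std_normal_density u) = 1"
  by (rule integral_normal_density) simp

lemma integral_gauss_kernel_interval: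
  assumes r: "r > 0"
  shows "(LINT x|lborel. indicator {a<..<b} x * gauss_kernel r (x - t))
    = (LINT u|lborel. indicator {a<..<b} (t + u / r) * std_normal_density u)"
proof -
  have "(LINT x|lborel. indicator {a<..<b} x * gauss_kernel r (x - t))
    = \<bar>1 / r\<bar> *\<^sub>R (LINT u|lborel. indicator {a<..<b} (t + 1 / r * u) * gauss_kernel r (t + 1 / r * u - t))"
    using r by (intro lborel_integral_real_affine) auto
  also have "\<dots> = (LINT u|lborel. (1 / r) * (indicator {a<..<b} (t + 1 / r * u) * gauss_kernel r (t + 1 / r * u - t)))"
    using r by simp
  also have "\<dots> = (LINT u|lborel. indicator {a<..<b} (t + u / r) * std_normal_density u)"
    using r by (intro Bochner_Integration.integral_cong) (auto simp: gauss_kernel_def)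
  finally show ?thesis .
qed

lemma gauss_kernel_interval_bound:
  assumes r: "r > 0"
  shows "\<bar>LINT x|lborel. indicator {a<..<b} x * gauss_kernel r (x - t)\<bar> \<le> 1"
proof -
  have "\<bar>LINT u|lborel. indicator {a<..<b} (t + u / r) * std_normal_density u\<bar>
      \<le> (LINT u|lborel. \<bar>indicator {a<..<b} (t + u / r) * std_normal_density u\<bar>)"
    by (rule integral_abs_bound)
  also have "\<dots> \<le> (LINT u|lborel. std_normal_density u)"
    by (rule integral_mono') (auto simp: indicator_def normal_density_nonneg intro!: integrable_normal_density)
  finally show ?thesis unfolding integral_gauss_kernel_interval[OF r] integral_std_normal_density .
qed

text \<open>Only the convolution with indicators of intervals is examined: it converges at every point except the
end points, which is enough to identify interval integrals.\<close>

lemma gauss_kernel_approximate_identity: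
  assumes "t \<noteq> a" "t \<noteq> b"
  shows "(\<lambda>n. LINT x|lborel. indicator {a<..<b} x * gauss_kernel (real (Suc n)) (x - t)) \<longlonglongrightarrow> indicator {a<..<b} t"
proof -
  have "(\<lambda>n. LINT u|lborel. indicator {a<..<b} (t + u / real (Suc n)) * std_normal_density u)
      \<longlonglongrightarrow> (LINT u|lborel. indicator {a<..<b} t * std_normal_density u)"
  proof (rule integral_dominated_convergence[where w=std_normal_density])
    show "AE u in lborel. (\<lambda>n. indicator {a<..<b} (t + u / real (Suc n)) * std_normal_density u)
        \<longlonglongrightarrow> indicator {a<..<b} t * std_normal_density u"
    proof (rule AE_I2)
      fix u :: real
      have lim: "(\<lambda>n. t + u / real (Suc n)) \<longlonglongrightarrow> t"
        using tendsto_add[OF tendsto_const tendsto_mult[OF tendsto_const LIMSEQ_inverse_real_of_nat], of t u]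
        by (simp add: divide_inverse)
      have ev: "\<forall>\<^sub>F n in sequentially. (t + u / real (Suc n) \<in> {a<..<b}) = (t \<in> {a<..<b})"
      proof (cases "t \<in> {a<..<b}")
        case True
        then show ?thesis using topological_tendstoD[OF lim, of "{a<..<b}"] by auto
      next
        case False
        then have "t \<in> - {a..b}" using assms by auto
        then have "\<forall>\<^sub>F n in sequentially. t + u / real (Suc n) \<in> - {a..b}"
          by (intro topological_tendstoD[OF lim]) auto
        then show ?thesis by eventually_elim (use False in auto)
      qed
      show "(\<lambda>n. indicator {a<..<b} (t + u / real (Suc n)) * std_normal_density u)
        \<longlonglongrightarrow> indicator {a<..<b} t * std_normal_density u"
        by (rule tendsto_eventually) (use ev in eventually_elim, simp add: indicator_def)
    qed
    show "AE u in lborel. norm (indicator {a<..<b} (t + u / real (Suc n)) * std_normal_density u)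
        \<le> std_normal_density u" for n
      by (intro AE_I2) (auto simp: indicator_def normal_density_nonneg)
    show "integrable lborel std_normal_density" by (rule integrable_normal_density) simp
  qed measurable
  then show ?thesis
    by (simp add: integral_gauss_kernel_interval integral_std_normal_density)
qed

lemma integral_regularized_inversion:
  assumes f: "integrable lborel f" and r: "r > 0"
  shows "(LINT x:{a<..<b}|lborel. LINT t|lborel. f t * complex_of_real (gauss_kernel r (x - t)))
    = (LINT t|lborel. f t * of_real (LINT x|lborel. indicator {a<..<b} x * gauss_kernel r (x - t)))"
proof -
  have [measurable]: "f \<in> borel_measurable borel" using f by auto
  let ?I = "\<lambda>x. indicator {a<..<b} x :: complex"
  have I: "integrable lborel ?I"
  proof -
    have "emeasure lborel {a<..<b} < \<infinity>" by (cases "a \<le> b") auto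
    then have "integrable lborel (\<lambda>x. complex_of_real (indicat_real {a<..<b} x))"
      by (intro integrable_of_real integrable_real_indicator) auto
    then show ?thesis by (simp add: of_real_indicator)
  qed
  \<comment> \<open>A crude bound that suffices for Fubini; r is fixed here.\<close>
  have "gauss_kernel r y \<le> r" for y
  proof -
    have "std_normal_density (r * y) \<le> 1 / sqrt (2 * pi) * 1"
      unfolding std_normal_density_def by (intro mult_left_mono) auto
    also have "\<dots> \<le> 1" using pi_ge_two by (simp add: real_le_rsqrt)
    finally show ?thesis using r by (simp add: gauss_kernel_def mult_left_le)
  qed
  then have int: "integrable (lborel \<Otimes>\<^sub>M lborel) (\<lambda>(t, x). f t * ?I x * complex_of_real (gauss_kernel r (x - t)))"
    by (intro integrable_product_lborel[OF f I, where C=r]) (auto simp: gauss_kernel_nonneg[OF r])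
  have "(LINT x:{a<..<b}|lborel. LINT t|lborel. f t * complex_of_real (gauss_kernel r (x - t)))
      = (LINT x|lborel. LINT t|lborel. f t * ?I x * complex_of_real (gauss_kernel r (x - t)))"
    unfolding set_lebesgue_integral_def
    by (intro Bochner_Integration.integral_cong) (auto simp: indicator_def)
  also have "\<dots> = (LINT t|lborel. LINT x|lborel. f t * ?I x * complex_of_real (gauss_kernel r (x - t)))"
    by (rule lborel_pair.Fubini_integral[OF int])
  also have "\<dots> = (LINT t|lborel. f t * (LINT x|lborel. of_real (indicator {a<..<b} x * gauss_kernel r (x - t))))"
    by (simp only: mult.assoc integral_mult_right_zero of_real_mult of_real_indicator)
  finally show ?thesis by (simp only: integral_complex_of_real)
qed

text \<open>The regularized inversion integrals converge to the inverse transform of \<open>fourier f\<close> everywhere, while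
their integrals over an interval converge to the integral of \<open>f\<close>.  So \<open>f\<close> and the inverse transform
have equal integrals over all intervals.\<close>

lemma fourier_inversion:
  assumes f: "integrable lborel f" and F: "integrable lborel (fourier f)"
  shows "AE x in lborel. f x = (LINT \<xi>|lborel. fourier f \<xi> * cis (2 * pi * \<xi> * x))"
proof -
  define h where "h x = (LINT \<xi>|lborel. fourier f \<xi> * cis (2 * pi * \<xi> * x))" for x
  define h' where "h' n x = (LINT \<xi>|lborel. fourier f \<xi> * of_real (gauss_weight (real (Suc n)) \<xi>) * cis (2 * pi * \<xi> * x))"
    for n x
  define B where "B = (LINT \<xi>|lborel. cmod (fourier f \<xi>))"
  have [measurable]: "f \<in> borel_measurable borel" "fourier f \<in> borel_measurable borel" using f F by auto
  have h_meas [measurable]: "h \<in> borel_measurable borel"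
    unfolding h_def[abs_def] by (rule lborel.borel_measurable_lebesgue_integral) measurable
  have h'_meas [measurable]: "h' n \<in> borel_measurable borel" for n
    unfolding h'_def[abs_def] by (rule lborel.borel_measurable_lebesgue_integral) measurable
  have h_bound: "cmod (h x) \<le> B" for x
    unfolding h_def B_def by (rule order_trans[OF integral_norm_bound]) (simp add: norm_mult)
  have h'_bound: "cmod (h' n x) \<le> B" for n x
  proof -
    have "cmod (h' n x) \<le> (LINT \<xi>|lborel. cmod (fourier f \<xi> * of_real (gauss_weight (real (Suc n)) \<xi>) * cis (2 * pi * \<xi> * x)))"
      unfolding h'_def by (rule integral_norm_bound)
    also have "\<dots> \<le> B"
      unfolding B_def using F
      by (intro integral_mono') (auto simp: norm_mult gauss_weight_bounds mult_left_le)
    finally show ?thesis .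
  qed
  have h'_lim: "(\<lambda>n. h' n x) \<longlonglongrightarrow> h x" for x
    unfolding h'_def h_def
  proof (rule integral_dominated_convergence[where w="\<lambda>\<xi>. cmod (fourier f \<xi>)"])
    show "AE \<xi> in lborel. (\<lambda>n. fourier f \<xi> * of_real (gauss_weight (real (Suc n)) \<xi>) * cis (2 * pi * \<xi> * x))
        \<longlonglongrightarrow> fourier f \<xi> * cis (2 * pi * \<xi> * x)"
    proof (rule AE_I2)
      fix \<xi> :: real
      have "(\<lambda>n. inverse (real (Suc n))) \<longlonglongrightarrow> 0" by (rule LIMSEQ_inverse_real_of_nat)
      then have "(\<lambda>n. gauss_weight (real (Suc n)) \<xi>) \<longlonglongrightarrow> exp (- (2 * pi * \<xi> * 0)\<^sup>2 / 2)"
        unfolding gauss_weight_def divide_inverse[of "2 * pi * \<xi>"] by (intro tendsto_intros) auto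
      then have "(\<lambda>n. gauss_weight (real (Suc n)) \<xi>) \<longlonglongrightarrow> 1"
        by simp
      then have "(\<lambda>n. fourier f \<xi> * of_real (gauss_weight (real (Suc n)) \<xi>) * cis (2 * pi * \<xi> * x))
          \<longlonglongrightarrow> fourier f \<xi> * of_real 1 * cis (2 * pi * \<xi> * x)"
        by (intro tendsto_intros)
      then show "(\<lambda>n. fourier f \<xi> * of_real (gauss_weight (real (Suc n)) \<xi>) * cis (2 * pi * \<xi> * x))
          \<longlonglongrightarrow> fourier f \<xi> * cis (2 * pi * \<xi> * x)" by simp
    qed
    show "AE \<xi> in lborel. norm (fourier f \<xi> * of_real (gauss_weight (real (Suc n)) \<xi>) * cis (2 * pi * \<xi> * x))
        \<le> cmod (fourier f \<xi>)" for n
      by (intro AE_I2) (simp add: norm_mult gauss_weight_bounds mult_left_le)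
    show "integrable lborel (\<lambda>\<xi>. cmod (fourier f \<xi>))" using F by simp
  qed measurable
  have h_int: "set_integrable lborel {a<..<b} h" for a b
    unfolding set_integrable_def
  proof (rule Bochner_Integration.integrable_bound)
    show "integrable lborel (\<lambda>x. B * indicat_real {a<..<b} x)"
      by (cases "a \<le> b") (auto intro!: integrable_real_indicator)
    have "0 \<le> B" using h_bound[of 0] norm_ge_zero order_trans by blast
    then show "AE x in lborel. norm (indicat_real {a<..<b} x *\<^sub>R h x) \<le> norm (B * indicat_real {a<..<b} x)"
      using h_bound by (intro AE_I2) (simp add: indicator_def)
  qed measurable
  have interval: "(LINT x:{a<..<b}|lborel. h x) = (LINT x:{a<..<b}|lborel. f x)" if "a < b" for a b
  proof -
    have "(\<lambda>n. LINT x:{a<..<b}|lborel. h' n x) \<longlonglongrightarrow> (LINT x:{a<..<b}|lborel. h x)"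
      unfolding set_lebesgue_integral_def
    proof (rule integral_dominated_convergence[where w="\<lambda>x. B * indicat_real {a<..<b} x"])
      show "AE x in lborel. (\<lambda>n. indicat_real {a<..<b} x *\<^sub>R h' n x) \<longlonglongrightarrow> indicat_real {a<..<b} x *\<^sub>R h x"
        by (intro AE_I2 tendsto_scaleR tendsto_const h'_lim)
      show "AE x in lborel. norm (indicat_real {a<..<b} x *\<^sub>R h' n x) \<le> B * indicat_real {a<..<b} x" for n
        using h'_bound by (intro AE_I2) (simp add: indicator_def)
      show "integrable lborel (\<lambda>x. B * indicat_real {a<..<b} x)"
        using that by (auto intro!: integrable_real_indicator)
    qed measurable
    moreover have "(\<lambda>n. LINT x:{a<..<b}|lborel. h' n x) \<longlonglongrightarrow> (LINT x:{a<..<b}|lborel. f x)"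
    proof -
      have "(\<lambda>n. LINT t|lborel. f t * complex_of_real (LINT x|lborel. indicator {a<..<b} x * gauss_kernel (real (Suc n)) (x - t)))
          \<longlonglongrightarrow> (LINT t|lborel. f t * complex_of_real (indicator {a<..<b} t))"
      proof (rule integral_dominated_convergence[where w="\<lambda>t. cmod (f t)"])
        have "AE t in lborel. t \<noteq> a \<and> t \<noteq> b"
          using AE_lborel_singleton[of a] AE_lborel_singleton[of b] by eventually_elim auto
        then show "AE t in lborel. (\<lambda>n. f t * complex_of_real (LINT x|lborel. indicator {a<..<b} x * gauss_kernel (real (Suc n)) (x - t)))
          \<longlonglongrightarrow> f t * complex_of_real (indicator {a<..<b} t)"
          by eventually_elim (intro tendsto_mult tendsto_const tendsto_of_real gauss_kernel_approximate_identity, auto)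
        show "AE t in lborel. norm (f t * complex_of_real (LINT x|lborel. indicator {a<..<b} x * gauss_kernel (real (Suc n)) (x - t)))
            \<le> cmod (f t)" for n
          using gauss_kernel_interval_bound[of "real (Suc n)" a b]
          by (intro AE_I2) (simp add: norm_mult mult_left_le)
        show "integrable lborel (\<lambda>t. cmod (f t))" using f by simp
      qed measurable
      moreover have "(LINT t|lborel. f t * complex_of_real (indicator {a<..<b} t)) = (LINT x:{a<..<b}|lborel. f x)"
        unfolding set_lebesgue_integral_def by (simp add: scaleR_conv_of_real mult.commute)
      ultimately show ?thesis
        unfolding h'_def by (simp only: regularized_inversion[OF f] integral_regularized_inversion[OF f] of_nat_0_less_iff zero_less_Suc)
    qed
    ultimately show ?thesis by (rule LIMSEQ_unique)
  qed
  have "AE x in lborel. indicator {- real N<..<real N} x *\<^sub>R (f x - h x) = 0" for N :: nat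
  proof (rule AE_zero_if_interval_integrals_zero)
    let ?J = "{- real N<..<real N}"
    have f_int: "set_integrable lborel {a<..<b} f" for a b
      unfolding set_integrable_def using f by (intro integrable_mult_indicator) auto
    show "integrable lborel (\<lambda>x. indicator ?J x *\<^sub>R (f x - h x))"
      using set_integral_diff(1)[OF f_int h_int] by (simp add: set_integrable_def)
    fix a b :: real
    let ?a = "max a (- real N)" and ?b = "min b (real N)"
    have "(LINT x:{a<..<b}|lborel. indicator ?J x *\<^sub>R (f x - h x)) = (LINT x:{?a<..<?b}|lborel. f x - h x)"
      unfolding set_lebesgue_integral_def
      by (intro Bochner_Integration.integral_cong) (auto simp: indicator_def)
    also have "\<dots> = (LINT x:{?a<..<?b}|lborel. f x) - (LINT x:{?a<..<?b}|lborel. h x)"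
      by (rule set_integral_diff(2)[OF f_int h_int])
    also have "\<dots> = 0"
    proof (cases "?a < ?b")
      case True
      show ?thesis using interval[OF True] by (simp only: diff_self)
    next
      case False
      then have "{?a<..<?b} = {}" by auto
      then show ?thesis by (simp only: set_lebesgue_integral_def) simp
    qed
    finally show "(LINT x:{a<..<b}|lborel. indicator ?J x *\<^sub>R (f x - h x)) = 0" .
  qed
  then have "AE x in lborel. \<forall>N::nat. indicator {- real N<..<real N} x *\<^sub>R (f x - h x) = 0"
    unfolding AE_all_countable by (rule allI)
  then show ?thesis
  proof eventually_elim
    case (elim x)
    obtain N :: nat where "\<bar>x\<bar> < real N" using reals_Archimedean2 by blast
    then have "x \<in> {- real N<..<real N}" by auto
    then show ?case using elim[rule_format, of N] by (simp add: h_def)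
  qed
qed

corollary AE_norm_le_integral_fourier:
  assumes f: "integrable lborel f" and F: "integrable lborel (fourier f)"
  shows "AE x in lborel. cmod (f x) \<le> (LINT \<xi>|lborel. cmod (fourier f \<xi>))"
  using fourier_inversion[OF assms]
proof eventually_elim
  case (elim x)
  show ?case
    unfolding elim by (rule order_trans[OF integral_norm_bound]) (simp add: norm_mult)
qed

section \<open>Feichtinger's algebra embeds into Wiener's\<close>

text \<open>Membership in the Wiener amalgam space \<open>W(L\<^sup>\<infinity>, \<ell>\<^sup>1)\<close>, stated for all step lengths at once
because both the step 1 of the quasi-periodization and the step \<open>1 / \<beta>\<close> of the folding occur.\<close>

definition wiener :: "(real \<Rightarrow> complex) \<Rightarrow> bool" where
  "wiener g \<longleftrightarrow> g \<in> borel_measurable borel \<and>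
     (\<forall>a>0. \<exists>C\<ge>0. AE t in lborel.
        (\<integral>\<^sup>+k. ennreal (cmod (g (t + of_int k * a))) \<partial>count_space (UNIV :: int set)) \<le> ennreal C)"

lemma norm_gauss: "cmod (gauss t) = 2 powr (1/4) * exp (- pi * t\<^sup>2)"
  unfolding gauss_def norm_of_real by simp

lemma gauss_real: "0 < Re (gauss t)" "cmod (gauss t) = Re (gauss t)"
  unfolding norm_gauss by (simp_all add: gauss_def)

lemma gauss_measurable [measurable]: "gauss \<in> borel_measurable borel"
  unfolding gauss_def[abs_def] by measurable

lemma Re_gauss_mono: "0 \<le> s \<Longrightarrow> \<bar>t\<bar> \<le> s \<Longrightarrow> Re (gauss s) \<le> Re (gauss t)"
  by (simp add: gauss_def mult_left_mono power2_le_iff_abs_le)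

lemma square_integrable_gauss: "square_integrable lborel (\<lambda>t. gauss (t - x))"
proof -
  \<comment> \<open>The squared Gaussian window is a multiple of the normal density with this deviation.\<close>
  define \<sigma> where "\<sigma> = 1 / (2 * sqrt pi)"
  have \<sigma>: "\<sigma> > 0" "2 * \<sigma>\<^sup>2 = 1 / (2 * pi)"
    by (simp_all add: \<sigma>_def power_divide power_mult_distrib)
  have "(cmod (gauss (t - x)))\<^sup>2 = (2 powr (1/4))\<^sup>2 * sqrt (2 * pi * \<sigma>\<^sup>2) * normal_density x \<sigma> t" for t
  proof -
    have "normal_density x \<sigma> t = 1 / sqrt (2 * pi * \<sigma>\<^sup>2) * exp (- (t - x)\<^sup>2 / (2 * \<sigma>\<^sup>2))"
      by (simp add: normal_density_def)
    also have "- (t - x)\<^sup>2 / (2 * \<sigma>\<^sup>2) = 2 * (- pi * (t - x)\<^sup>2)"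
      unfolding \<sigma>(2) by simp
    also have "exp \<dots> = (exp (- pi * (t - x)\<^sup>2))\<^sup>2" by (rule exp_double)
    finally show ?thesis
      using \<sigma>(1) unfolding norm_gauss by (simp add: power_mult_distrib)
  qed
  then have "integrable lborel (\<lambda>t. (cmod (gauss (t - x)))\<^sup>2)"
    using \<sigma>(1) by (simp only:) (intro integrable_mult_right integrable_normal_density)
  then show ?thesis by (simp add: square_integrable_def)
qed

text \<open>For almost every \<open>x\<close> the function \<open>g \<sqdot> cnj (h\<^sub>0(\<sqdot> - x))\<close> has the integrable Fourier transform
\<open>V g (x, \<sqdot>)\<close>, so it is bounded by \<open>v x\<close>.  Where \<open>x\<close> is within distance \<open>a\<close> of \<open>s\<close>, the Gaussian is
at least \<open>c\<close>, hence \<open>a \<sqdot> c \<sqdot> \<bar>g s\<bar>\<close> is at most the integral of \<open>v\<close> over \<open>(s, s + a)\<close>.  The intervals for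
\<open>s = t + k a\<close> tile the line, so that the sum over \<open>k\<close> is at most \<open>\<parallel>v\<parallel>\<^sub>1\<close>.\<close>

lemma S0_imp_wiener:
  assumes "g \<in> S0" shows "wiener g"
  unfolding wiener_def
proof (intro conjI allI impI)
  have g: "square_integrable lborel g" and V: "integrable (lborel \<Otimes>\<^sub>M lborel) (\<lambda>(x, \<xi>). STFT gauss g x \<xi>)"
    using assms by (auto simp: S0_def L2_def square_integrable_def lborel_prod)
  show g_meas [measurable]: "g \<in> borel_measurable borel" using g by (simp add: square_integrable_def)
  fix a :: real assume a: "a > 0"
  define v where "v x = (LINT \<xi>|lborel. cmod (STFT gauss g x \<xi>))" for x
  have Vn: "integrable (lborel \<Otimes>\<^sub>M lborel) (\<lambda>(x, \<xi>). cmod (STFT gauss g x \<xi>))"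
    using integrable_norm[OF V] by (simp add: case_prod_unfold)
  have v_int: "integrable lborel v"
    using lborel_pair.integrable_fst[OF Vn] by (simp add: v_def[abs_def])
  have [measurable]: "v \<in> borel_measurable borel" using v_int by auto
  have v_nonneg: "v x \<ge> 0" for x by (simp add: v_def)
  have "AE x in lborel. integrable lborel (STFT gauss g x)"
    using lborel_pair.AE_integrable_fst[OF V] by simp
  then have "AE x in lborel. AE t in lborel. cmod (g t) * Re (gauss (t - x)) \<le> v x"
  proof eventually_elim
    case (elim x)
    let ?f = "\<lambda>t. g t * cnj (gauss (t - x))"
    have f: "integrable lborel ?f" by (rule integrable_mult_cnj[OF g square_integrable_gauss])
    have eq: "STFT gauss g x = fourier ?f" by (rule ext) (simp add: STFT_def fourier_def)
    have "AE t in lborel. cmod (?f t) \<le> (LINT \<xi>|lborel. cmod (fourier ?f \<xi>))"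
      using f elim unfolding eq by (rule AE_norm_le_integral_fourier)
    then show ?case
      by (simp add: v_def eq norm_mult gauss_real(2))
  qed
  then have ae: "AE t in lborel. AE x in lborel. cmod (g t) * Re (gauss (t - x)) \<le> v x"
    by (subst (asm) lborel_pair.AE_commute) measurable
  define c where "c = Re (gauss a)"
  have c: "c > 0" unfolding c_def by (rule gauss_real(1))
  from ae have local: "AE s in lborel. ennreal (a * c) * ennreal (cmod (g s)) \<le> (\<integral>\<^sup>+y. ennreal (v (y + s)) \<partial>lborel_upto a)"
  proof eventually_elim
    case (elim s)
    have "AE y in lborel_upto a. cmod (g s) * Re (gauss (s - (y + s))) \<le> v (y + s)"
      by (rule AE_lborel_upto[OF AE_lborel_translate[OF elim]])
    moreover have "AE y in lborel_upto a. y \<in> {0<..<a}"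
      using AE_space[of "lborel_upto a"] by simp
    ultimately have "AE y in lborel_upto a. ennreal (cmod (g s) * c) \<le> ennreal (v (y + s))"
    proof eventually_elim
      case (elim y)
      have "c \<le> Re (gauss (s - (y + s)))" unfolding c_def using elim(2) by (intro Re_gauss_mono) auto
      then have "cmod (g s) * c \<le> cmod (g s) * Re (gauss (s - (y + s)))" by (rule mult_left_mono) simp
      then show ?case using elim(1) by (intro ennreal_leI) linarith
    qed
    then have "(\<integral>\<^sup>+y. ennreal (cmod (g s) * c) \<partial>lborel_upto a) \<le> (\<integral>\<^sup>+y. ennreal (v (y + s)) \<partial>lborel_upto a)"
      by (rule nn_integral_mono_AE)
    moreover have "(\<integral>\<^sup>+y. ennreal (cmod (g s) * c) \<partial>lborel_upto a) = ennreal (a * c) * ennreal (cmod (g s))"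
      using a c by (simp add: lborel_upto.emeasure_eq_measure measure_lborel_upto ennreal_mult[symmetric] mult_ac)
    ultimately show ?case by simp
  qed
  define C where "C = (LINT x|lborel. v x) / (a * c)"
  have C: "0 \<le> C" unfolding C_def using a c v_nonneg by simp
  moreover have "AE t in lborel. (\<integral>\<^sup>+k. ennreal (cmod (g (t + of_int k * a))) \<partial>count_space (UNIV :: int set)) \<le> ennreal C"
    using AE_lborel_translates[OF local, of a]
  proof eventually_elim
    case (elim t)
    let ?S = "\<integral>\<^sup>+k. ennreal (cmod (g (t + of_int k * a))) \<partial>count_space (UNIV :: int set)"
    have "ennreal (a * c) * ?S = (\<integral>\<^sup>+k. ennreal (a * c) * ennreal (cmod (g (t + of_int k * a))) \<partial>count_space (UNIV :: int set))"
      by (rule nn_integral_cmult[symmetric]) simp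
    also have "\<dots> \<le> (\<integral>\<^sup>+k. \<integral>\<^sup>+y. ennreal (v (y + (t + of_int k * a))) \<partial>lborel_upto a \<partial>count_space (UNIV :: int set))"
      using elim by (intro nn_integral_mono) auto
    also have "\<dots> = (\<integral>\<^sup>+y. \<integral>\<^sup>+k. ennreal (v (t + (y + of_int k * a))) \<partial>count_space (UNIV :: int set) \<partial>lborel_upto a)"
    proof -
      have [measurable]: "(\<lambda>(y, k::int). ennreal (v (t + (y + of_int k * a)))) \<in> borel_measurable (lborel_upto a \<Otimes>\<^sub>M count_space UNIV)"
        using measurable_compose[OF translate_measurable_upto[of a a], of "\<lambda>x. ennreal (v (t + x))" borel]
        by (simp add: case_prod_unfold)
      show ?thesis
        unfolding add.left_commute[of _ t] by (rule upto_int.Fubini') measurable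
    qed
    also have "\<dots> = (\<integral>\<^sup>+x. ennreal (v (t + x)) \<partial>lborel)"
      by (rule nn_integral_tiling[OF a, symmetric]) measurable
    also have "\<dots> = (\<integral>\<^sup>+x. ennreal (v x) \<partial>lborel)"
      using nn_integral_real_affine[of "\<lambda>x. ennreal (v x)" 1 t] by simp
    also have "\<dots> = ennreal (LINT x|lborel. v x)"
      by (rule nn_integral_eq_integral[OF v_int]) (simp add: v_nonneg)
    also have "\<dots> = ennreal (a * c) * ennreal C"
      using a c C by (subst ennreal_mult[symmetric]) (auto simp: C_def)
    finally show "?S \<le> ennreal C"
      using a c by (subst (asm) ennreal_mult_le_mult_iff) auto
  qed
  ultimately show "\<exists>C\<ge>0. AE t in lborel.
      (\<integral>\<^sup>+k. ennreal (cmod (g (t + of_int k * a))) \<partial>count_space (UNIV :: int set)) \<le> ennreal C"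
    by blast
qed

section \<open>Folding a quasi-periodic function against a window\<close>

lemma L2_quasi_iff:
  "f \<in> L2_quasi \<nu> \<longleftrightarrow> f \<in> borel_measurable borel \<and> square_integrable (lborel_upto 1) f \<and>
     (\<forall>t. \<forall>k::int. f (t + of_int k) = cis (2 * pi * of_int k * \<nu>) * f t)"
  by (auto simp: L2_quasi_def square_integrable_def integrable_lborel_upto borel_measurable_lborel_upto)

lemma L2_quasi_measurable: "f \<in> L2_quasi \<nu> \<Longrightarrow> f \<in> borel_measurable borel"
  and L2_quasi_square_integrable: "f \<in> L2_quasi \<nu> \<Longrightarrow> square_integrable (lborel_upto 1) f"
  and L2_quasi_shift: "f \<in> L2_quasi \<nu> \<Longrightarrow> f (t + of_int k) = cis (2 * pi * of_int k * \<nu>) * f t"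
  by (auto simp: L2_quasi_iff)

lemma L2_quasi_norm_shift: "f \<in> L2_quasi \<nu> \<Longrightarrow> cmod (f (t + of_int k)) = cmod (f t)"
  by (simp add: L2_quasi_shift norm_mult)

lemma L2_01_inner_eq_inner_on: "L2_01_inner f g = inner_on (lborel_upto 1) f g"
  by (simp add: L2_01_inner_def inner_on_def integral_lborel_upto)

lemma L2_01_norm_eq_norm_on: "L2_01_norm f = norm_on (lborel_upto 1) f"
  by (simp add: L2_01_norm_def norm_on_def integral_lborel_upto)

lemma L2_quasi_scale: "f \<in> L2_quasi \<nu> \<Longrightarrow> (\<lambda>t. c * f t) \<in> L2_quasi \<nu>"
  by (auto simp: L2_quasi_iff)

lemma L2_quasi_diff: "f \<in> L2_quasi \<nu> \<Longrightarrow> g \<in> L2_quasi \<nu> \<Longrightarrow> (\<lambda>t. f t - g t) \<in> L2_quasi \<nu>"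
  unfolding L2_quasi_iff by (auto simp: right_diff_distrib)

lemma L2_quasi_sum:
  "(\<And>i. i \<in> F \<Longrightarrow> f i \<in> L2_quasi \<nu>) \<Longrightarrow> (\<lambda>t. \<Sum>i\<in>F. f i t) \<in> L2_quasi \<nu>"
  unfolding L2_quasi_iff
  by (intro conjI borel_measurable_sum square_integrable_sum) (auto simp: sum_distrib_left)

lemma wienerD:
  assumes "wiener g" "a > 0"
  obtains C where "C \<ge> 0"
    "AE t in lborel. (\<integral>\<^sup>+k. ennreal (cmod (g (t + of_int k * a))) \<partial>count_space (UNIV :: int set)) \<le> ennreal C"
  using assms unfolding wiener_def by blast

lemma wiener_measurable: "wiener g \<Longrightarrow> g \<in> borel_measurable borel"
  by (simp add: wiener_def)

text \<open>Integrating a 1-periodic function against \<open>\<bar>g\<bar>\<close> over the line costs a constant times its integral over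
one period.\<close>

lemma nn_integral_periodic_wiener:
  assumes g: "wiener g"
  obtains C where "C \<ge> 0" "\<And>F. F \<in> borel_measurable borel \<Longrightarrow> (\<And>t k. F (t + of_int (k::int)) = F t) \<Longrightarrow>
    (\<integral>\<^sup>+t. F t * ennreal (cmod (g t)) \<partial>lborel) \<le> ennreal C * (\<integral>\<^sup>+t. F t \<partial>lborel_upto 1)"
proof -
  have [measurable]: "g \<in> borel_measurable borel" using g by (rule wiener_measurable)
  obtain C where C: "C \<ge> 0"
    "AE t in lborel. (\<integral>\<^sup>+k. ennreal (cmod (g (t + of_int k * 1))) \<partial>count_space (UNIV :: int set)) \<le> ennreal C"
    by (rule wienerD[OF g zero_less_one])
  show ?thesis
  proof (rule that[OF C(1)])
    fix F :: "real \<Rightarrow> ennreal"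
    assume [measurable]: "F \<in> borel_measurable borel" and F: "\<And>t k. F (t + of_int (k::int)) = F t"
    have "(\<integral>\<^sup>+t. F t * ennreal (cmod (g t)) \<partial>lborel)
      = (\<integral>\<^sup>+t. \<integral>\<^sup>+k. F (t + of_int k * 1) * ennreal (cmod (g (t + of_int k * 1))) \<partial>count_space (UNIV :: int set) \<partial>lborel_upto 1)"
      by (rule nn_integral_tiling) auto
    also have "\<dots> = (\<integral>\<^sup>+t. F t * (\<integral>\<^sup>+k. ennreal (cmod (g (t + of_int k * 1))) \<partial>count_space (UNIV :: int set)) \<partial>lborel_upto 1)"
      by (simp add: F nn_integral_cmult)
    also have "\<dots> \<le> (\<integral>\<^sup>+t. F t * ennreal C \<partial>lborel_upto 1)"
      using AE_lborel_upto[OF C(2), of 1]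
      by (intro nn_integral_mono_AE) (auto elim!: eventually_mono intro: mult_left_mono)
    also have "\<dots> = ennreal C * (\<integral>\<^sup>+t. F t \<partial>lborel_upto 1)"
      by (subst nn_integral_multc) (auto simp: mult.commute intro: borel_measurable_lborel_upto)
    finally show "(\<integral>\<^sup>+t. F t * ennreal (cmod (g t)) \<partial>lborel) \<le> ennreal C * (\<integral>\<^sup>+t. F t \<partial>lborel_upto 1)" .
  qed
qed

lemma integrable_mult_wiener:
  assumes f: "f \<in> L2_quasi \<nu>" and g: "wiener g"
  shows "integrable lborel (\<lambda>t. f t * cnj (g t))"
proof (rule integrableI_bounded)
  have [measurable]: "f \<in> borel_measurable borel" "g \<in> borel_measurable borel"
    using f g by (auto intro: wiener_measurable L2_quasi_measurable)
  show "(\<lambda>t. f t * cnj (g t)) \<in> borel_measurable lborel" by measurable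
  obtain C where C: "C \<ge> 0" "\<And>F. F \<in> borel_measurable borel \<Longrightarrow> (\<And>t k. F (t + of_int (k::int)) = F t) \<Longrightarrow>
    (\<integral>\<^sup>+t. F t * ennreal (cmod (g t)) \<partial>lborel) \<le> ennreal C * (\<integral>\<^sup>+t. F t \<partial>lborel_upto 1)"
    using nn_integral_periodic_wiener[OF g] by blast
  have one: "square_integrable (lborel_upto 1) (\<lambda>t. 1)"
    by (rule square_integrable_bounded[OF finite_measure_lborel_upto, where C=1]) auto
  have "integrable (lborel_upto 1) f"
    using integrable_mult_cnj[OF L2_quasi_square_integrable[OF f] one] by simp
  then have "(\<integral>\<^sup>+t. ennreal (cmod (f t)) \<partial>lborel_upto 1) < \<infinity>"
    by (simp add: integrable_iff_bounded)
  moreover have "(\<integral>\<^sup>+t. ennreal (cmod (f t)) * ennreal (cmod (g t)) \<partial>lborel)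
      \<le> ennreal C * (\<integral>\<^sup>+t. ennreal (cmod (f t)) \<partial>lborel_upto 1)"
    using f by (intro C(2)) (auto simp: L2_quasi_norm_shift)
  ultimately have "(\<integral>\<^sup>+t. ennreal (cmod (f t)) * ennreal (cmod (g t)) \<partial>lborel) < \<infinity>"
    using ennreal_mult_less_top order_le_less_trans by (metis ennreal_less_top infinity_ennreal_def)
  then show "(\<integral>\<^sup>+t. ennreal (norm (f t * cnj (g t))) \<partial>lborel) < \<infinity>"
    by (simp add: norm_mult ennreal_mult)
qed

lemma wiener_integrable:
  assumes g: "wiener g" shows "integrable lborel g"
proof -
  have [measurable]: "g \<in> borel_measurable borel" using g by (rule wiener_measurable)
  obtain C where C: "C \<ge> 0" "\<And>F. F \<in> borel_measurable borel \<Longrightarrow> (\<And>t k. F (t + of_int (k::int)) = F t) \<Longrightarrow>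
    (\<integral>\<^sup>+t. F t * ennreal (cmod (g t)) \<partial>lborel) \<le> ennreal C * (\<integral>\<^sup>+t. F t \<partial>lborel_upto 1)"
    using nn_integral_periodic_wiener[OF g] by blast
  have "(\<integral>\<^sup>+t. ennreal (cmod (g t)) \<partial>lborel) \<le> ennreal C * (\<integral>\<^sup>+t. 1 \<partial>lborel_upto 1)"
    using C(2)[of "\<lambda>t. 1"] by simp
  also have "\<dots> < \<infinity>"
    by (simp add: lborel_upto.emeasure_eq_measure ennreal_mult_less_top)
  finally show ?thesis by (intro integrableI_bounded) auto
qed

text \<open>The map \<open>P\<^sub>g\<close> above.  For \<open>f\<close> in \<open>L\<^sup>2\<^sub>\<nu>(0,1)\<close> the product is not periodic in general, and \<open>T\<close> need not be
rational, so this mixes the two lattices \<open>\<int>\<close> and \<open>T \<int>\<close>.\<close>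

definition fold_window :: "real \<Rightarrow> (real \<Rightarrow> complex) \<Rightarrow> (real \<Rightarrow> complex) \<Rightarrow> real \<Rightarrow> complex" where
  "fold_window T g f = periodize T (\<lambda>t. f t * cnj (g t))"

lemma fold_window_measurable:
  assumes "f \<in> L2_quasi \<nu>" "wiener g" shows "fold_window T g f \<in> borel_measurable borel"
proof -
  have [measurable]: "f \<in> borel_measurable borel" "g \<in> borel_measurable borel"
    using assms by (auto intro: wiener_measurable L2_quasi_measurable)
  show ?thesis unfolding fold_window_def by measurable
qed

lemma norm_periodize_le:
  "ennreal (cmod (periodize T u t)) \<le> (\<integral>\<^sup>+k. ennreal (cmod (u (t + of_int k * T))) \<partial>count_space (UNIV :: int set))"
proof (cases "integrable (count_space (UNIV :: int set)) (\<lambda>k. u (t + of_int k * T))")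
  case True
  then show ?thesis unfolding periodize_def by (rule integral_norm_bound_ennreal)
next
  case False
  then show ?thesis by (simp add: periodize_def not_integrable_integral_eq)
qed

text \<open>Cauchy-Schwarz with \<open>\<bar>g\<bar>\<close> split into two square roots.\<close>

lemma fold_window_square_le:
  "ennreal ((cmod (fold_window T g f t))\<^sup>2) \<le>
    (\<integral>\<^sup>+k. ennreal ((cmod (f (t + of_int k * T)))\<^sup>2) * ennreal (cmod (g (t + of_int k * T))) \<partial>count_space (UNIV :: int set))
    * (\<integral>\<^sup>+k. ennreal (cmod (g (t + of_int k * T))) \<partial>count_space (UNIV :: int set))"
proof -
  let ?f = "\<lambda>k::int. cmod (f (t + of_int k * T))" and ?g = "\<lambda>k::int. cmod (g (t + of_int k * T))"
  have "ennreal ((cmod (fold_window T g f t))\<^sup>2) = (ennreal (cmod (fold_window T g f t)))\<^sup>2"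
    by (simp add: ennreal_power)
  also have "\<dots> \<le> (\<integral>\<^sup>+k. ennreal (cmod (f (t + of_int k * T) * cnj (g (t + of_int k * T)))) \<partial>count_space (UNIV :: int set))\<^sup>2"
    unfolding fold_window_def by (intro power_mono norm_periodize_le) simp
  also have "\<dots> = (\<integral>\<^sup>+k. ennreal (?f k * sqrt (?g k)) * ennreal (sqrt (?g k)) \<partial>count_space (UNIV :: int set))\<^sup>2"
    by (simp add: norm_mult ennreal_mult[symmetric] mult.assoc)
  also have "\<dots> \<le> (\<integral>\<^sup>+k. (ennreal (?f k * sqrt (?g k)))\<^sup>2 \<partial>count_space (UNIV :: int set))
      * (\<integral>\<^sup>+k. (ennreal (sqrt (?g k)))\<^sup>2 \<partial>count_space (UNIV :: int set))"
    by (rule Cauchy_Schwarz_nn_integral) auto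
  also have "\<dots> = (\<integral>\<^sup>+k. ennreal ((?f k)\<^sup>2) * ennreal (?g k) \<partial>count_space (UNIV :: int set))
      * (\<integral>\<^sup>+k. ennreal (?g k) \<partial>count_space (UNIV :: int set))"
    by (simp add: ennreal_power power_mult_distrib ennreal_mult)
  finally show ?thesis .
qed

text \<open>By the preceding inequality and the amalgam bound for step \<open>T\<close>, the square of the norm is at most a
constant times the integral of \<open>\<bar>f\<bar>\<^sup>2 \<bar>g\<bar>\<close> over the line.  As \<open>\<bar>f\<bar>\<^sup>2\<close> is 1-periodic, the amalgam bound
for step 1 finishes the estimate.\<close>

lemma fold_window_bounded:
  assumes g: "wiener g" and T: "T > 0"
  obtains K where "K > 0"
    "\<And>f. f \<in> L2_quasi \<nu> \<Longrightarrow> square_integrable (lborel_upto T) (fold_window T g f)"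
    "\<And>f. f \<in> L2_quasi \<nu> \<Longrightarrow> norm_on (lborel_upto T) (fold_window T g f) \<le> K * norm_on (lborel_upto 1) f"
proof -
  have [measurable]: "g \<in> borel_measurable borel" using g by (rule wiener_measurable)
  obtain C where C: "C \<ge> 0" "\<And>F. F \<in> borel_measurable borel \<Longrightarrow> (\<And>t k. F (t + of_int (k::int)) = F t) \<Longrightarrow>
    (\<integral>\<^sup>+t. F t * ennreal (cmod (g t)) \<partial>lborel) \<le> ennreal C * (\<integral>\<^sup>+t. F t \<partial>lborel_upto 1)"
    using nn_integral_periodic_wiener[OF g] by blast
  obtain D where D: "D \<ge> 0"
    "AE t in lborel. (\<integral>\<^sup>+k. ennreal (cmod (g (t + of_int k * T))) \<partial>count_space (UNIV :: int set)) \<le> ennreal D"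
    by (rule wienerD[OF g T])
  \<comment> \<open>The summand 1 makes the constant positive even if the window vanishes.\<close>
  define K where "K = sqrt (D * C) + 1"
  have K: "K > 0" "D * C \<le> K\<^sup>2"
    using C(1) D(1) by (auto simp: K_def power2_sum add_nonneg_pos)
  have key: "square_integrable (lborel_upto T) (fold_window T g f) \<and>
     norm_on (lborel_upto T) (fold_window T g f) \<le> K * norm_on (lborel_upto 1) f" if f: "f \<in> L2_quasi \<nu>" for f
  proof -
    have [measurable]: "f \<in> borel_measurable borel" using f by (rule L2_quasi_measurable)
    note P_meas = borel_measurable_lborel_upto[OF fold_window_measurable[OF f g, of T], of T]
    have f2: "(\<integral>\<^sup>+t. ennreal ((cmod (f t))\<^sup>2) \<partial>lborel_upto 1) = ennreal ((norm_on (lborel_upto 1) f)\<^sup>2)"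
      unfolding norm_on_square using L2_quasi_square_integrable[OF f]
      by (intro nn_integral_eq_integral) (auto simp: square_integrable_def)
    have "(\<integral>\<^sup>+t. ennreal ((cmod (fold_window T g f t))\<^sup>2) \<partial>lborel_upto T)
      \<le> (\<integral>\<^sup>+t. (\<integral>\<^sup>+k. ennreal ((cmod (f (t + of_int k * T)))\<^sup>2) * ennreal (cmod (g (t + of_int k * T))) \<partial>count_space (UNIV :: int set))
            * ennreal D \<partial>lborel_upto T)"
    proof (rule nn_integral_mono_AE)
      show "AE t in lborel_upto T. ennreal ((cmod (fold_window T g f t))\<^sup>2) \<le>
        (\<integral>\<^sup>+k. ennreal ((cmod (f (t + of_int k * T)))\<^sup>2) * ennreal (cmod (g (t + of_int k * T))) \<partial>count_space (UNIV :: int set)) * ennreal D"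
        using AE_lborel_upto[OF D(2), of T]
      proof eventually_elim
        case (elim t)
        show ?case by (rule order_trans[OF fold_window_square_le mult_left_mono[OF elim]]) simp
      qed
    qed
    also have "\<dots> = (\<integral>\<^sup>+t. (\<integral>\<^sup>+k. ennreal D * (ennreal ((cmod (f (t + of_int k * T)))\<^sup>2) * ennreal (cmod (g (t + of_int k * T)))) \<partial>count_space (UNIV :: int set))
           \<partial>lborel_upto T)"
      by (simp add: nn_integral_cmult mult.commute)
    also have "\<dots> = (\<integral>\<^sup>+t. ennreal D * (ennreal ((cmod (f t))\<^sup>2) * ennreal (cmod (g t))) \<partial>lborel)"
      by (rule nn_integral_tiling[OF T, symmetric]) measurable
    also have "\<dots> = ennreal D * (\<integral>\<^sup>+t. ennreal ((cmod (f t))\<^sup>2) * ennreal (cmod (g t)) \<partial>lborel)"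
      by (rule nn_integral_cmult) measurable
    also have "\<dots> \<le> ennreal D * (ennreal C * (\<integral>\<^sup>+t. ennreal ((cmod (f t))\<^sup>2) \<partial>lborel_upto 1))"
      using f by (intro mult_left_mono C(2)) (auto simp: L2_quasi_norm_shift)
    also have "\<dots> = ennreal (D * C * (norm_on (lborel_upto 1) f)\<^sup>2)"
      using C(1) D(1) by (simp add: f2 ennreal_mult mult.assoc)
    finally have le: "(\<integral>\<^sup>+t. ennreal ((cmod (fold_window T g f t))\<^sup>2) \<partial>lborel_upto T)
        \<le> ennreal (D * C * (norm_on (lborel_upto 1) f)\<^sup>2)" .
    have int: "integrable (lborel_upto T) (\<lambda>t. (cmod (fold_window T g f t))\<^sup>2)"
      using P_meas by (intro integrableI_bounded) (auto intro: order_le_less_trans[OF le])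
    have "ennreal ((norm_on (lborel_upto T) (fold_window T g f))\<^sup>2) \<le> ennreal (D * C * (norm_on (lborel_upto 1) f)\<^sup>2)"
      using le nn_integral_eq_integral[OF int] by (simp add: norm_on_square)
    then have "(norm_on (lborel_upto T) (fold_window T g f))\<^sup>2 \<le> D * C * (norm_on (lborel_upto 1) f)\<^sup>2"
      using C(1) D(1) by (subst (asm) ennreal_le_iff) auto
    also have "\<dots> \<le> (K * norm_on (lborel_upto 1) f)\<^sup>2"
      unfolding power_mult_distrib using K(2) by (rule mult_right_mono) simp
    finally have "norm_on (lborel_upto T) (fold_window T g f) \<le> K * norm_on (lborel_upto 1) f"
      by (rule power2_le_imp_le) (use K(1) in simp)
    with int P_meas show ?thesis by (simp add: square_integrable_def)
  qed
  show ?thesis by (rule that[OF K(1)]) (use key in auto)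
qed

section \<open>Gabor coefficients as Fourier coefficients\<close>

text \<open>Removing the phase \<open>cis (2 \<pi> \<nu> t)\<close> turns quasi-periodization into periodization.  The identity holds
everywhere, also where the sums diverge.\<close>

lemma quasi_periodize_eq:
  "quasi_periodize \<nu> h t = cis (2 * pi * \<nu> * t) * periodize 1 (\<lambda>s. cis (- 2 * pi * \<nu> * s) * h s) t"
proof -
  have "quasi_periodize \<nu> h t = (\<Sum>\<^sub>\<infinity>k\<in>UNIV. cis (- 2 * pi * of_int k * \<nu>) * h (t + of_int k))"
    unfolding quasi_periodize_def
    by (rule infsum_reindex_bij_witness[where i=uminus and j=uminus]) auto
  also have "\<dots> = (LINT k|count_space UNIV. cis (2 * pi * \<nu> * t) * (cis (- 2 * pi * \<nu> * (t + of_int k * 1)) * h (t + of_int k * 1)))"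
  proof -
    have "cis (2 * pi * \<nu> * t) * cis (- 2 * pi * \<nu> * (t + of_int k * 1)) = cis (- 2 * pi * of_int k * \<nu>)" for k :: int
      unfolding cis_mult by (rule arg_cong[where f=cis]) (simp add: algebra_simps)
    then show ?thesis
      unfolding infsum_eq_integral_count_space mult.assoc[symmetric] by (simp only: mult_1_right)
  qed
  finally show ?thesis by (simp only: periodize_def integral_mult_right_zero)
qed

lemma quasi_periodize_shift:
  "quasi_periodize \<nu> h (t + of_int k) = cis (2 * pi * of_int k * \<nu>) * quasi_periodize \<nu> h t"
proof -
  have "periodize 1 u (t + of_int k) = periodize 1 u t" for u
    using periodize_translate[of 1 u t k] by simp
  moreover have "cis (2 * pi * \<nu> * (t + of_int k)) = cis (2 * pi * of_int k * \<nu>) * cis (2 * pi * \<nu> * t)"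
    unfolding cis_mult by (rule arg_cong[where f=cis]) (simp add: algebra_simps)
  ultimately show ?thesis
    unfolding quasi_periodize_eq by (simp only: mult.assoc)
qed

text \<open>Under a shift by \<open>k\<close> the function \<open>f\<close> acquires exactly the phase with which the summand of index \<open>k\<close> is
weighted, so that \<open>f\<close> can be moved under the sum.\<close>

lemma mult_cnj_quasi_periodize:
  assumes "f \<in> L2_quasi \<nu>"
  shows "f t * cnj (quasi_periodize \<nu> h t) = periodize 1 (\<lambda>s. f s * cnj (h s)) t"
proof -
  let ?p = "\<lambda>t. f t * cis (- 2 * pi * \<nu> * t)"
  have p: "?p (t + of_int k * 1) = ?p t" for t and k :: int
  proof -
    have "?p (t + of_int k * 1) = f t * (cis (2 * pi * of_int k * \<nu>) * cis (- 2 * pi * \<nu> * (t + of_int k)))"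
      using L2_quasi_shift[OF assms, of t k] by simp
    also have "cis (2 * pi * of_int k * \<nu>) * cis (- 2 * pi * \<nu> * (t + of_int k)) = cis (- 2 * pi * \<nu> * t)"
      unfolding cis_mult by (rule arg_cong[where f=cis]) (simp add: algebra_simps)
    finally show ?thesis .
  qed
  have "f t * cnj (quasi_periodize \<nu> h t) = cnj (periodize 1 (\<lambda>s. cis (- 2 * pi * \<nu> * s) * h s) t) * ?p t"
    unfolding quasi_periodize_eq by (simp add: cis_cnj mult_ac)
  also have "cnj (periodize 1 (\<lambda>s. cis (- 2 * pi * \<nu> * s) * h s) t) = periodize 1 (\<lambda>s. cis (2 * pi * \<nu> * s) * cnj (h s)) t"
    unfolding periodize_def Bochner_Integration.integral_cnj[symmetric] by (simp add: cis_cnj)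
  also have "\<dots> * ?p t = periodize 1 (\<lambda>s. cis (2 * pi * \<nu> * s) * cnj (h s) * ?p s) t"
    by (rule periodize_mult_periodic[symmetric]) (rule p)
  also have "(\<lambda>s. cis (2 * pi * \<nu> * s) * cnj (h s) * ?p s) = (\<lambda>s. f s * cnj (h s))"
  proof
    fix s
    have "cis (2 * pi * \<nu> * s) * cis (- 2 * pi * \<nu> * s) = 1" by (simp add: cis_mult)
    then show "cis (2 * pi * \<nu> * s) * cnj (h s) * ?p s = f s * cnj (h s)"
      by (metis mult.assoc mult.commute mult.right_neutral)
  qed
  finally show ?thesis .
qed

lemma modulation_eq_trig: "\<beta> > 0 \<Longrightarrow> modulation (\<beta> * of_int n) g = (\<lambda>t. trig (1 / \<beta>) n t * g t)"
  by (simp add: modulation_def trig_def mult_ac)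

lemma trig_periodic: "T > 0 \<Longrightarrow> trig T n (t + of_int k * T) = trig T n t"
proof -
  assume T: "T > 0"
  have "2 * pi * of_int n * (t + of_int k * T) / T = 2 * pi * of_int n * t / T + 2 * pi * of_int (n * k)"
    using T by (simp add: field_simps)
  then have "trig T n (t + of_int k * T) = cis (2 * pi * of_int n * t / T) * cis (2 * pi * of_int (n * k))"
    unfolding trig_def by (simp only: cis_mult)
  then show ?thesis using cis_multiple_2pi[of "of_int (n * k)"] by (simp add: trig_def)
qed

lemma wiener_modulation:
  assumes "wiener g" shows "wiener (modulation \<xi> g)"
proof -
  have [measurable]: "g \<in> borel_measurable borel" using assms by (rule wiener_measurable)
  have "modulation \<xi> g \<in> borel_measurable borel" unfolding modulation_def by measurable
  then show ?thesis using assms by (simp add: wiener_def modulation_def norm_mult)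
qed

text \<open>Unfold from \<open>(0, 1)\<close> to the line and fold onto \<open>(0, T)\<close>; the modulation by \<open>\<beta> n\<close> is \<open>T\<close>-periodic and
becomes the exponential of a Fourier series.\<close>

lemma gabor_coefficient:
  assumes f: "f \<in> L2_quasi \<nu>" and g: "wiener g" and \<beta>: "\<beta> > 0"
  shows "inner_on (lborel_upto 1) f (gabor_system \<nu> \<beta> g n) = inner_on (lborel_upto (1 / \<beta>)) (fold_window (1 / \<beta>) g f) (trig (1 / \<beta>) n)"
proof -
  let ?T = "1 / \<beta>" and ?h = "modulation (\<beta> * of_int n) g"
  have T: "?T > 0" using \<beta> by simp
  have int: "integrable lborel (\<lambda>t. f t * cnj (?h t))"
    by (rule integrable_mult_wiener[OF f wiener_modulation[OF g]])
  have "inner_on (lborel_upto 1) f (gabor_system \<nu> \<beta> g n) = (LINT t|lborel_upto 1. periodize 1 (\<lambda>s. f s * cnj (?h s)) t)"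
    by (simp add: inner_on_def gabor_system_def mult_cnj_quasi_periodize[OF f])
  also have "\<dots> = (LINT s|lborel. f s * cnj (?h s))"
    by (rule integral_periodize[OF _ int]) simp
  also have "\<dots> = (LINT t|lborel_upto ?T. periodize ?T (\<lambda>s. f s * cnj (?h s)) t)"
    by (rule integral_periodize[OF T int, symmetric])
  also have "(\<lambda>s. f s * cnj (?h s)) = (\<lambda>s. f s * cnj (g s) * cnj (trig ?T n s))"
    by (simp add: modulation_eq_trig[OF \<beta>] mult_ac)
  also have "periodize ?T \<dots> = (\<lambda>t. fold_window ?T g f t * cnj (trig ?T n t))"
    unfolding fold_window_def by (rule ext, rule periodize_mult_periodic) (simp only: trig_periodic[OF T])
  finally show ?thesis by (simp only: inner_on_def)
qed

lemma gabor_system_in_L2_quasi: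
  assumes g: "wiener g" shows "gabor_system \<nu> \<beta> g n \<in> L2_quasi \<nu>"
  unfolding L2_quasi_iff
proof (intro conjI allI)
  let ?h = "modulation (\<beta> * of_int n) g"
  have h: "wiener ?h" by (rule wiener_modulation[OF g])
  have [measurable]: "?h \<in> borel_measurable borel" using h by (rule wiener_measurable)
  have "quasi_periodize \<nu> ?h = (\<lambda>t. cis (2 * pi * \<nu> * t) * periodize 1 (\<lambda>s. cis (- 2 * pi * \<nu> * s) * ?h s) t)"
    by (rule ext) (rule quasi_periodize_eq)
  then show meas: "gabor_system \<nu> \<beta> g n \<in> borel_measurable borel"
    unfolding gabor_system_def by simp
  show "gabor_system \<nu> \<beta> g n (t + of_int k) = cis (2 * pi * of_int k * \<nu>) * gabor_system \<nu> \<beta> g n t" for t k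
    unfolding gabor_system_def by (rule quasi_periodize_shift)
  obtain C where C: "C \<ge> 0"
    "AE t in lborel. (\<integral>\<^sup>+k. ennreal (cmod (?h (t + of_int k * 1))) \<partial>count_space (UNIV :: int set)) \<le> ennreal C"
    by (rule wienerD[OF h zero_less_one])
  have "AE t in lborel_upto 1. cmod (gabor_system \<nu> \<beta> g n t) \<le> C"
    using AE_lborel_upto[OF C(2), of 1]
  proof eventually_elim
    case (elim t)
    have "ennreal (cmod (gabor_system \<nu> \<beta> g n t)) = ennreal (cmod (periodize 1 (\<lambda>s. cis (- 2 * pi * \<nu> * s) * ?h s) t))"
      by (simp add: gabor_system_def quasi_periodize_eq norm_mult)
    also have "\<dots> \<le> ennreal C"
      by (rule order_trans[OF norm_periodize_le]) (use elim in \<open>simp add: norm_mult\<close>)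
    finally show ?case using C(1) by simp
  qed
  then show "square_integrable (lborel_upto 1) (gabor_system \<nu> \<beta> g n)"
    by (rule square_integrable_bounded[OF finite_measure_lborel_upto borel_measurable_lborel_upto[OF meas]])
qed

section \<open>The frame operator as a sesquilinear form\<close>

text \<open>The sesquilinear form \<open>\<langle>S f, h\<rangle>\<close> of the frame-type operator, by \<open>frame_form_has_sum\<close> below.\<close>

definition frame_form where
  "frame_form T g \<gamma> f h = of_real T * inner_on (lborel_upto T) (fold_window T g f) (fold_window T \<gamma> h)"

lemma frame_form_cnj: "frame_form T \<gamma> g h f = cnj (frame_form T g \<gamma> f h)"
  by (simp add: frame_form_def inner_on_cnj[of _ "fold_window T g f"])

lemma has_sum_finite_sum:
  fixes f :: "'i \<Rightarrow> 'j \<Rightarrow> complex"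
  shows "(\<And>i. i \<in> F \<Longrightarrow> (f i has_sum s i) A) \<Longrightarrow> ((\<lambda>x. \<Sum>i\<in>F. f i x) has_sum (\<Sum>i\<in>F. s i)) A"
  by (induction F rule: infinite_finite_induct) (auto intro: has_sum_add)

context
  fixes \<nu> \<beta> :: real assumes \<beta>: "\<beta> > 0"
begin

lemma inverse_\<beta>_pos: "1 / \<beta> > 0" using \<beta> by simp

interpretation trig: orthogonal_system "lborel_upto (1 / \<beta>)" "trig (1 / \<beta>)" "1 / \<beta>"
  by (rule orthogonal_system_trig[OF inverse_\<beta>_pos])

lemma square_integrable_fold_window:
  assumes "wiener g" "f \<in> L2_quasi \<nu>"
  shows "square_integrable (lborel_upto (1 / \<beta>)) (fold_window (1 / \<beta>) g f)"
  using fold_window_bounded[OF assms(1) inverse_\<beta>_pos] assms(2) by blast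

text \<open>Parseval's identity on \<open>(0, T)\<close>.\<close>

lemma frame_form_has_sum:
  assumes g: "wiener g" and \<gamma>: "wiener \<gamma>" and f: "f \<in> L2_quasi \<nu>" and h: "h \<in> L2_quasi \<nu>"
  shows "((\<lambda>n. inner_on (lborel_upto 1) f (gabor_system \<nu> \<beta> g n) * cnj (inner_on (lborel_upto 1) h (gabor_system \<nu> \<beta> \<gamma> n)))
    has_sum frame_form (1 / \<beta>) g \<gamma> f h) UNIV"
  unfolding gabor_coefficient[OF f g \<beta>] gabor_coefficient[OF h \<gamma> \<beta>] frame_form_def
  by (rule trig.Parseval[OF trig_complete[OF inverse_\<beta>_pos] ]) (intro square_integrable_fold_window g \<gamma> f h)+

lemma gabor_coefficients_square_sum:
  assumes g: "wiener g" and f: "f \<in> L2_quasi \<nu>"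
  shows "((\<lambda>n. (cmod (inner_on (lborel_upto 1) f (gabor_system \<nu> \<beta> g n)))\<^sup>2)
    has_sum (1 / \<beta>) * (norm_on (lborel_upto (1 / \<beta>)) (fold_window (1 / \<beta>) g f))\<^sup>2) UNIV"
  unfolding gabor_coefficient[OF f g \<beta>]
  by (rule trig.Parseval_norm[OF trig_complete[OF inverse_\<beta>_pos]]) (intro square_integrable_fold_window g f)

text \<open>Linearity is read off from the series, whose coefficients are exactly linear in \<open>f\<close>; the folded
functions are so only almost everywhere.\<close>

lemma frame_form_diff_left:
  assumes g: "wiener g" and \<gamma>: "wiener \<gamma>" and f: "f \<in> L2_quasi \<nu>" "f' \<in> L2_quasi \<nu>" and h: "h \<in> L2_quasi \<nu>"
  shows "frame_form (1 / \<beta>) g \<gamma> (\<lambda>t. f t - f' t) h = frame_form (1 / \<beta>) g \<gamma> f h - frame_form (1 / \<beta>) g \<gamma> f' h"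
proof (rule has_sum_unique[OF frame_form_has_sum[OF g \<gamma> L2_quasi_diff[OF f] h]])
  have "inner_on (lborel_upto 1) (\<lambda>t. f t - f' t) G = inner_on (lborel_upto 1) f G - inner_on (lborel_upto 1) f' G"
    if "G \<in> L2_quasi \<nu>" for G
    using f that by (intro inner_on_diff_left L2_quasi_square_integrable)
  then show "((\<lambda>n. inner_on (lborel_upto 1) (\<lambda>t. f t - f' t) (gabor_system \<nu> \<beta> g n) * cnj (inner_on (lborel_upto 1) h (gabor_system \<nu> \<beta> \<gamma> n)))
      has_sum frame_form (1 / \<beta>) g \<gamma> f h - frame_form (1 / \<beta>) g \<gamma> f' h) UNIV"
    using has_sum_add[OF frame_form_has_sum[OF g \<gamma> f(1) h]
        has_sum_cmult_right[OF frame_form_has_sum[OF g \<gamma> f(2) h], of "-1"]]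
    by (simp add: gabor_system_in_L2_quasi[OF g] left_diff_distrib)
qed

lemma frame_form_sum_left:
  assumes g: "wiener g" and \<gamma>: "wiener \<gamma>" and e: "\<And>i. i \<in> F \<Longrightarrow> e i \<in> L2_quasi \<nu>" and h: "h \<in> L2_quasi \<nu>"
  shows "frame_form (1 / \<beta>) g \<gamma> (\<lambda>t. \<Sum>i\<in>F. c i * e i t) h = (\<Sum>i\<in>F. c i * frame_form (1 / \<beta>) g \<gamma> (e i) h)"
proof -
  let ?M = "lborel_upto 1"
  have mem: "(\<lambda>t. \<Sum>i\<in>F. c i * e i t) \<in> L2_quasi \<nu>"
    by (intro L2_quasi_sum L2_quasi_scale e)
  show ?thesis
  proof (rule has_sum_unique[OF frame_form_has_sum[OF g \<gamma> mem h]])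
    have "inner_on ?M (\<lambda>t. \<Sum>i\<in>F. c i * e i t) G = (\<Sum>i\<in>F. c i * inner_on ?M (e i) G)" if G: "G \<in> L2_quasi \<nu>" for G
    proof -
      have "inner_on ?M (\<lambda>t. \<Sum>i\<in>F. c i * e i t) G = (\<Sum>i\<in>F. inner_on ?M (\<lambda>t. c i * e i t) G)"
        by (intro inner_on_sum_left L2_quasi_square_integrable[where \<nu>=\<nu>] L2_quasi_scale e G)
      then show ?thesis by (simp only: inner_on_scale_left)
    qed
    then have eq: "inner_on ?M (\<lambda>t. \<Sum>i\<in>F. c i * e i t) (gabor_system \<nu> \<beta> g n) * cnj (inner_on ?M h (gabor_system \<nu> \<beta> \<gamma> n))
        = (\<Sum>i\<in>F. c i * (inner_on ?M (e i) (gabor_system \<nu> \<beta> g n) * cnj (inner_on ?M h (gabor_system \<nu> \<beta> \<gamma> n))))" for n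
      by (simp add: gabor_system_in_L2_quasi[OF g] sum_distrib_right mult.assoc)
    show "((\<lambda>n. inner_on ?M (\<lambda>t. \<Sum>i\<in>F. c i * e i t) (gabor_system \<nu> \<beta> g n) * cnj (inner_on ?M h (gabor_system \<nu> \<beta> \<gamma> n)))
        has_sum (\<Sum>i\<in>F. c i * frame_form (1 / \<beta>) g \<gamma> (e i) h)) UNIV"
      unfolding eq by (intro has_sum_finite_sum has_sum_cmult_right frame_form_has_sum g \<gamma> e h)
  qed
qed

lemma frame_form_bounded:
  assumes g: "wiener g" and \<gamma>: "wiener \<gamma>"
  obtains K where "K > 0" "\<And>f h. f \<in> L2_quasi \<nu> \<Longrightarrow> h \<in> L2_quasi \<nu> \<Longrightarrow>
    cmod (frame_form (1 / \<beta>) g \<gamma> f h) \<le> K * norm_on (lborel_upto 1) f * norm_on (lborel_upto 1) h"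
proof -
  obtain A where A: "A > 0" "\<And>f. f \<in> L2_quasi \<nu> \<Longrightarrow>
      norm_on (lborel_upto (1 / \<beta>)) (fold_window (1 / \<beta>) g f) \<le> A * norm_on (lborel_upto 1) f"
    using fold_window_bounded[OF g inverse_\<beta>_pos] by metis
  obtain B where B: "B > 0" "\<And>f. f \<in> L2_quasi \<nu> \<Longrightarrow>
      norm_on (lborel_upto (1 / \<beta>)) (fold_window (1 / \<beta>) \<gamma> f) \<le> B * norm_on (lborel_upto 1) f"
    using fold_window_bounded[OF \<gamma> inverse_\<beta>_pos] by metis
  show ?thesis
  proof (rule that)
    show "1 / \<beta> * (A * B) > 0" using A B \<beta> by simp
    fix f h assume f: "f \<in> L2_quasi \<nu>" and h: "h \<in> L2_quasi \<nu>"
    have "cmod (frame_form (1 / \<beta>) g \<gamma> f h)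
        = 1 / \<beta> * cmod (inner_on (lborel_upto (1 / \<beta>)) (fold_window (1 / \<beta>) g f) (fold_window (1 / \<beta>) \<gamma> h))"
      unfolding frame_form_def norm_mult norm_of_real using \<beta> by simp
    also have "\<dots> \<le> 1 / \<beta> * (norm_on (lborel_upto (1 / \<beta>)) (fold_window (1 / \<beta>) g f) * norm_on (lborel_upto (1 / \<beta>)) (fold_window (1 / \<beta>) \<gamma> h))"
      using \<beta> by (intro mult_left_mono Cauchy_Schwarz_inner_on square_integrable_fold_window g \<gamma> f h) simp
    also have "\<dots> \<le> 1 / \<beta> * ((A * norm_on (lborel_upto 1) f) * (B * norm_on (lborel_upto 1) h))"
      using A B \<beta> f h by (intro mult_left_mono mult_mono) auto
    finally show "cmod (frame_form (1 / \<beta>) g \<gamma> f h) \<le> 1 / \<beta> * (A * B) * norm_on (lborel_upto 1) f * norm_on (lborel_upto 1) h"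
      by (simp only: mult_ac)
  qed
qed

text \<open>Norm convergence gives weak convergence, hence one direction.  Conversely, for the error
\<open>d = S\<^sub>F f - f\<close> of a partial sum, the form expresses \<open>\<parallel>d\<parallel>\<^sup>2 = \<langle>d, d\<rangle>\<close> as \<open>- T\<close> times the inner product
of the Fourier remainder of \<open>P\<^sub>g f\<close> with \<open>P\<^sub>\<gamma> d\<close>.  As \<open>\<parallel>P\<^sub>\<gamma> d\<parallel> \<le> K \<parallel>d\<parallel>\<close>, a factor \<open>\<parallel>d\<parallel>\<close> cancels and the
error is controlled by that remainder, which tends to 0.\<close>

lemma frame_op_eq_id_iff_form:
  assumes g: "wiener g" and \<gamma>: "wiener \<gamma>"
  shows "frame_op_eq_id \<nu> \<beta> g \<gamma> \<longleftrightarrow>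
    (\<forall>f\<in>L2_quasi \<nu>. \<forall>h\<in>L2_quasi \<nu>. frame_form (1 / \<beta>) g \<gamma> f h = inner_on (lborel_upto 1) f h)"
proof -
  let ?M = "lborel_upto 1" and ?MT = "lborel_upto (1 / \<beta>)"
  define a where "a f n = inner_on ?M f (gabor_system \<nu> \<beta> g n)" for f n
  define S where "S F f = (\<lambda>t. \<Sum>n\<in>F. a f n * gabor_system \<nu> \<beta> \<gamma> n t)" for F f
  have S_mem: "S F f \<in> L2_quasi \<nu>" for F f
    unfolding S_def by (intro L2_quasi_sum L2_quasi_scale gabor_system_in_L2_quasi \<gamma>)
  have S_inner_on: "inner_on ?M (S F f) h = (\<Sum>n\<in>F. a f n * cnj (inner_on ?M h (gabor_system \<nu> \<beta> \<gamma> n)))" if h: "h \<in> L2_quasi \<nu>" for F f h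
  proof -
    have "inner_on ?M (S F f) h = (\<Sum>n\<in>F. inner_on ?M (\<lambda>t. a f n * gabor_system \<nu> \<beta> \<gamma> n t) h)"
      unfolding S_def by (intro inner_on_sum_left L2_quasi_square_integrable[where \<nu>=\<nu>] L2_quasi_scale gabor_system_in_L2_quasi \<gamma> h)
    then show ?thesis by (simp add: inner_on_scale_left inner_on_cnj[of ?M _ h])
  qed
  have value_iff: "frame_op_value \<nu> \<beta> g \<gamma> f f \<longleftrightarrow>
      ((\<lambda>F. norm_on ?M (\<lambda>t. S F f t - f t)) \<longlongrightarrow> 0) (finite_subsets_at_top UNIV)" for f
    by (simp add: frame_op_value_def L2_01_norm_eq_norm_on L2_01_inner_eq_inner_on S_def a_def)
  show ?thesis
  proof (intro iffI ballI)
    fix f h assume *: "frame_op_eq_id \<nu> \<beta> g \<gamma>" and f: "f \<in> L2_quasi \<nu>" and h: "h \<in> L2_quasi \<nu>"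
    have lim: "((\<lambda>F. norm_on ?M (\<lambda>t. S F f t - f t)) \<longlongrightarrow> 0) (finite_subsets_at_top UNIV)"
      using * f by (simp add: frame_op_eq_id_def value_iff)
    have "((\<lambda>F. inner_on ?M (S F f) h - inner_on ?M f h) \<longlongrightarrow> 0) (finite_subsets_at_top UNIV)"
    proof (rule Lim_null_comparison)
      show "((\<lambda>F. norm_on ?M (\<lambda>t. S F f t - f t) * norm_on ?M h) \<longlongrightarrow> 0) (finite_subsets_at_top UNIV)"
        using tendsto_mult_left_zero[OF lim] .
      have "norm (inner_on ?M (S F f) h - inner_on ?M f h) \<le> norm_on ?M (\<lambda>t. S F f t - f t) * norm_on ?M h" for F
        using Cauchy_Schwarz_inner_on[OF L2_quasi_square_integrable[OF L2_quasi_diff[OF S_mem f]] L2_quasi_square_integrable[OF h], of F f]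
          inner_on_diff_left[OF L2_quasi_square_integrable[OF S_mem] L2_quasi_square_integrable[OF f] L2_quasi_square_integrable[OF h], of F f]
        by simp
      then show "\<forall>\<^sub>F F in finite_subsets_at_top UNIV. norm (inner_on ?M (S F f) h - inner_on ?M f h)
          \<le> norm_on ?M (\<lambda>t. S F f t - f t) * norm_on ?M h"
        by (intro always_eventually allI)
    qed
    then have "((\<lambda>F. inner_on ?M (S F f) h) \<longlongrightarrow> inner_on ?M f h) (finite_subsets_at_top UNIV)"
      by (rule LIM_zero_cancel)
    moreover have "((\<lambda>F. inner_on ?M (S F f) h) \<longlongrightarrow> frame_form (1 / \<beta>) g \<gamma> f h) (finite_subsets_at_top UNIV)"
      using frame_form_has_sum[OF g \<gamma> f h] unfolding S_inner_on[OF h] has_sum_def a_def .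
    ultimately show "frame_form (1 / \<beta>) g \<gamma> f h = inner_on ?M f h"
      using tendsto_unique[OF finite_subsets_at_top_neq_bot] by blast
  next
    assume *: "\<forall>f\<in>L2_quasi \<nu>. \<forall>h\<in>L2_quasi \<nu>. frame_form (1 / \<beta>) g \<gamma> f h = inner_on ?M f h"
    show "frame_op_eq_id \<nu> \<beta> g \<gamma>"
      unfolding frame_op_eq_id_def value_iff
    proof
      fix f assume f: "f \<in> L2_quasi \<nu>"
      let ?P = "fold_window (1 / \<beta>) g f"
      have P: "square_integrable ?MT ?P" by (rule square_integrable_fold_window[OF g f])
      obtain K where K: "K > 0" "\<And>f. f \<in> L2_quasi \<nu> \<Longrightarrow> norm_on ?MT (fold_window (1 / \<beta>) \<gamma> f) \<le> K * norm_on ?M f"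
        using fold_window_bounded[OF \<gamma> inverse_\<beta>_pos] by metis
      have bound: "norm_on ?M (\<lambda>t. S F f t - f t) \<le> 1 / \<beta> * K * norm_on ?MT (\<lambda>t. ?P t - trig.expansion F ?P t)" for F
      proof -
        define d where "d = (\<lambda>t. S F f t - f t)"
        have d: "d \<in> L2_quasi \<nu>" unfolding d_def by (rule L2_quasi_diff[OF S_mem f])
        let ?Q = "fold_window (1 / \<beta>) \<gamma> d"
        have Q: "square_integrable ?MT ?Q" by (rule square_integrable_fold_window[OF \<gamma> d])
        have "complex_of_real ((norm_on ?M d)\<^sup>2) = inner_on ?M d d" by (rule inner_on_self[symmetric])
        also have "\<dots> = inner_on ?M (S F f) d - inner_on ?M f d"
          by (subst d_def) (rule inner_on_diff_left[OF L2_quasi_square_integrable[OF S_mem] L2_quasi_square_integrable[OF f] L2_quasi_square_integrable[OF d]])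
        also have "inner_on ?M (S F f) d = of_real (1 / \<beta>) * inner_on ?MT (trig.expansion F ?P) ?Q"
          unfolding S_inner_on[OF d] a_def gabor_coefficient[OF f g \<beta>] gabor_coefficient[OF d \<gamma> \<beta>] trig.inner_on_expansion[OF Q]
          using \<beta> by simp
        also have "inner_on ?M f d = of_real (1 / \<beta>) * inner_on ?MT ?P ?Q"
          using * f d by (simp add: frame_form_def)
        also have "of_real (1 / \<beta>) * inner_on ?MT (trig.expansion F ?P) ?Q - of_real (1 / \<beta>) * inner_on ?MT ?P ?Q
            = - (of_real (1 / \<beta>) * inner_on ?MT (\<lambda>t. ?P t - trig.expansion F ?P t) ?Q)"
          unfolding inner_on_diff_left[OF P trig.square_integrable_expansion Q] by (simp only: right_diff_distrib minus_diff_eq)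
        finally have "cmod (complex_of_real ((norm_on ?M d)\<^sup>2))
            = cmod (of_real (1 / \<beta>) * inner_on ?MT (\<lambda>t. ?P t - trig.expansion F ?P t) ?Q)"
          by (simp only: norm_minus_cancel)
        then have "(norm_on ?M d)\<^sup>2 = 1 / \<beta> * cmod (inner_on ?MT (\<lambda>t. ?P t - trig.expansion F ?P t) ?Q)"
          unfolding norm_mult norm_of_real using \<beta> by simp
        also have "\<dots> \<le> 1 / \<beta> * (norm_on ?MT (\<lambda>t. ?P t - trig.expansion F ?P t) * norm_on ?MT ?Q)"
          using \<beta> by (intro mult_left_mono Cauchy_Schwarz_inner_on square_integrable_diff P Q trig.square_integrable_expansion) simp
        also have "\<dots> \<le> 1 / \<beta> * (norm_on ?MT (\<lambda>t. ?P t - trig.expansion F ?P t) * (K * norm_on ?M d))"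
          using \<beta> K(2)[OF d] by (intro mult_left_mono) auto
        finally have sq: "norm_on ?M d * norm_on ?M d \<le> (1 / \<beta> * K * norm_on ?MT (\<lambda>t. ?P t - trig.expansion F ?P t)) * norm_on ?M d"
          by (simp only: power2_eq_square mult_ac)
        show ?thesis
        proof (cases "norm_on ?M d = 0")
          case True
          then show ?thesis using K(1) \<beta> unfolding d_def by simp
        next
          case False
          then have "norm_on ?M d > 0" using norm_on_nonneg[of ?M d] by linarith
          from mult_right_le_imp_le[OF sq this] show ?thesis unfolding d_def .
        qed
      qed
      show "((\<lambda>F. norm_on ?M (\<lambda>t. S F f t - f t)) \<longlongrightarrow> 0) (finite_subsets_at_top UNIV)"
      proof (rule Lim_null_comparison)
        show "\<forall>\<^sub>F F in finite_subsets_at_top UNIV. norm (norm_on ?M (\<lambda>t. S F f t - f t))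
            \<le> 1 / \<beta> * K * norm_on ?MT (\<lambda>t. ?P t - trig.expansion F ?P t)"
          using bound by (intro always_eventually allI) (simp only: real_norm_def abs_of_nonneg norm_on_nonneg)
        show "((\<lambda>F. 1 / \<beta> * K * norm_on ?MT (\<lambda>t. ?P t - trig.expansion F ?P t)) \<longlongrightarrow> 0) (finite_subsets_at_top UNIV)"
          by (rule tendsto_mult_right_zero[OF trig.expansion_tendsto[OF trig_complete[OF inverse_\<beta>_pos P]]])
      qed
    qed
  qed
qed

text \<open>Both frame bounds are inequalities between \<open>\<parallel>P\<^sub>g f\<parallel>\<close> and \<open>\<parallel>f\<parallel>\<close>; the lower one is Cauchy-Schwarz for
\<open>\<parallel>f\<parallel>\<^sup>2 = \<langle>S f, f\<rangle> = T \<langle>P\<^sub>g f, P\<^sub>\<gamma> f\<rangle>\<close>.\<close>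

lemma frame_op_eq_id_imp_gabor_frame:
  assumes g: "wiener g" and \<gamma>: "wiener \<gamma>" and id: "frame_op_eq_id \<nu> \<beta> g \<gamma>"
  shows "is_gabor_frame \<nu> \<beta> g"
proof -
  let ?M = "lborel_upto 1" and ?MT = "lborel_upto (1 / \<beta>)"
  obtain A where A: "A > 0" "\<And>f. f \<in> L2_quasi \<nu> \<Longrightarrow> norm_on ?MT (fold_window (1 / \<beta>) g f) \<le> A * norm_on ?M f"
    using fold_window_bounded[OF g inverse_\<beta>_pos] by metis
  obtain B where B: "B > 0" "\<And>f. f \<in> L2_quasi \<nu> \<Longrightarrow> norm_on ?MT (fold_window (1 / \<beta>) \<gamma> f) \<le> B * norm_on ?M f"
    using fold_window_bounded[OF \<gamma> inverse_\<beta>_pos] by metis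
  have form: "frame_form (1 / \<beta>) g \<gamma> f f = inner_on ?M f f" if "f \<in> L2_quasi \<nu>" for f
    using id that unfolding frame_op_eq_id_iff_form[OF g \<gamma>] by blast
  have lower: "norm_on ?M f \<le> 1 / \<beta> * B * norm_on ?MT (fold_window (1 / \<beta>) g f)" if f: "f \<in> L2_quasi \<nu>" for f
  proof -
    let ?P = "fold_window (1 / \<beta>) g f" and ?Q = "fold_window (1 / \<beta>) \<gamma> f"
    have "cmod (complex_of_real ((norm_on ?M f)\<^sup>2)) = cmod (of_real (1 / \<beta>) * inner_on ?MT ?P ?Q)"
      using form[OF f] unfolding frame_form_def inner_on_self by (simp only:)
    then have "(norm_on ?M f)\<^sup>2 = 1 / \<beta> * cmod (inner_on ?MT ?P ?Q)"
      unfolding norm_mult norm_of_real using \<beta> by simp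
    also have "\<dots> \<le> 1 / \<beta> * (norm_on ?MT ?P * norm_on ?MT ?Q)"
      using \<beta> by (intro mult_left_mono Cauchy_Schwarz_inner_on square_integrable_fold_window g \<gamma> f) simp
    also have "\<dots> \<le> 1 / \<beta> * (norm_on ?MT ?P * (B * norm_on ?M f))"
      using \<beta> B(2)[OF f] by (intro mult_left_mono) auto
    finally have sq: "norm_on ?M f * norm_on ?M f \<le> (1 / \<beta> * B * norm_on ?MT ?P) * norm_on ?M f"
      by (simp only: power2_eq_square mult_ac)
    show ?thesis
    proof (cases "norm_on ?M f = 0")
      case True
      then show ?thesis using B(1) \<beta> by simp
    next
      case False
      then have "norm_on ?M f > 0" using norm_on_nonneg[of ?M f] by linarith
      from mult_right_le_imp_le[OF sq this] show ?thesis .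
    qed
  qed
  show ?thesis
    unfolding is_gabor_frame_def L2_01_inner_eq_inner_on L2_01_norm_eq_norm_on
  proof (intro exI conjI ballI)
    show "\<beta> / B\<^sup>2 > 0" "A\<^sup>2 / \<beta> > 0" using A(1) B(1) \<beta> by simp_all
    fix f assume f: "f \<in> L2_quasi \<nu>"
    note sum = gabor_coefficients_square_sum[OF g f]
    let ?P = "fold_window (1 / \<beta>) g f"
    show "(\<lambda>n. (cmod (inner_on ?M f (gabor_system \<nu> \<beta> g n)))\<^sup>2) summable_on UNIV"
      using sum by (rule has_sum_imp_summable)
    have val: "(\<Sum>\<^sub>\<infinity>n. (cmod (inner_on ?M f (gabor_system \<nu> \<beta> g n)))\<^sup>2) = 1 / \<beta> * (norm_on ?MT ?P)\<^sup>2"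
      using sum by (rule infsumI)
    have "(norm_on ?M f)\<^sup>2 \<le> (1 / \<beta> * B * norm_on ?MT ?P)\<^sup>2"
      using lower[OF f] by (rule power_mono) simp
    then have "\<beta> / B\<^sup>2 * (norm_on ?M f)\<^sup>2 \<le> \<beta> / B\<^sup>2 * (1 / \<beta> * B * norm_on ?MT ?P)\<^sup>2"
      using \<beta> by (intro mult_left_mono) auto
    also have "\<dots> = 1 / \<beta> * (norm_on ?MT ?P)\<^sup>2"
      using \<beta> B(1) by (simp add: power_mult_distrib power_divide power2_eq_square)
    finally show "\<beta> / B\<^sup>2 * (norm_on ?M f)\<^sup>2 \<le> (\<Sum>\<^sub>\<infinity>n. (cmod (inner_on ?M f (gabor_system \<nu> \<beta> g n)))\<^sup>2)"
      unfolding val .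
    have "(norm_on ?MT ?P)\<^sup>2 \<le> (A * norm_on ?M f)\<^sup>2"
      using A(2)[OF f] by (rule power_mono) simp
    then have "1 / \<beta> * (norm_on ?MT ?P)\<^sup>2 \<le> 1 / \<beta> * (A * norm_on ?M f)\<^sup>2"
      using \<beta> by (intro mult_left_mono) auto
    then show "(\<Sum>\<^sub>\<infinity>n. (cmod (inner_on ?M f (gabor_system \<nu> \<beta> g n)))\<^sup>2) \<le> A\<^sup>2 / \<beta> * (norm_on ?M f)\<^sup>2"
      unfolding val by (simp add: power_mult_distrib)
  qed
qed

end

section \<open>The quasi-periodic exponentials\<close>

definition quasi_trig :: "real \<Rightarrow> int \<Rightarrow> real \<Rightarrow> complex" where
  "quasi_trig \<nu> l t = cis (2 * pi * \<nu> * t) * trig 1 l t"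

lemma norm_quasi_trig [simp]: "cmod (quasi_trig \<nu> l t) = 1"
  by (simp add: quasi_trig_def norm_mult)

lemma quasi_trig_measurable [measurable]: "quasi_trig \<nu> l \<in> borel_measurable borel"
  unfolding quasi_trig_def[abs_def] by measurable

text \<open>Multiplication by a unimodular function is an isometry, which transfers orthogonality and
completeness from the trigonometric system to the quasi-periodic one.\<close>

lemma inner_on_rotate:
  "inner_on M (\<lambda>t. cis (c t) * f t) (\<lambda>t. cis (c t) * g t) = inner_on M f g"
proof -
  have "cis (c t) * f t * cnj (cis (c t) * g t) = f t * cnj (g t)" for t
  proof -
    have "cis (c t) * cnj (cis (c t)) = 1" by (simp add: cis_cnj cis_mult)
    then show ?thesis by (metis (no_types, opaque_lifting) complex_cnj_mult mult.assoc mult.commute mult.right_neutral)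
  qed
  then show ?thesis by (simp only: inner_on_def)
qed

lemma norm_on_rotate: "norm_on M (\<lambda>t. cis (c t) * f t) = norm_on M f"
  by (simp add: norm_on_def norm_mult)

lemma quasi_trig_in_L2_quasi: "quasi_trig \<nu> l \<in> L2_quasi \<nu>"
  unfolding L2_quasi_iff
proof (intro conjI allI)
  show "square_integrable (lborel_upto 1) (quasi_trig \<nu> l)"
    by (rule square_integrable_bounded[OF finite_measure_lborel_upto borel_measurable_lborel_upto[OF quasi_trig_measurable], where C=1]) simp
  fix t :: real and k :: int
  have "cis (2 * pi * \<nu> * (t + of_int k)) = cis (2 * pi * of_int k * \<nu>) * cis (2 * pi * \<nu> * t)"
    unfolding cis_mult by (rule arg_cong[where f=cis]) (simp add: algebra_simps)
  then show "quasi_trig \<nu> l (t + of_int k) = cis (2 * pi * of_int k * \<nu>) * quasi_trig \<nu> l t"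
    using trig_periodic[of 1 l t k] by (simp add: quasi_trig_def)
qed simp

lemma orthogonal_system_quasi_trig: "orthogonal_system (lborel_upto 1) (quasi_trig \<nu>) 1"
proof
  interpret T: orthogonal_system "lborel_upto 1" "trig 1" 1
    by (rule orthogonal_system_trig) simp
  show "square_integrable (lborel_upto 1) (quasi_trig \<nu> n)" for n
    using quasi_trig_in_L2_quasi by (rule L2_quasi_square_integrable)
  show "inner_on (lborel_upto 1) (quasi_trig \<nu> m) (quasi_trig \<nu> n) = (if m = n then complex_of_real 1 else 0)" for m n
    unfolding quasi_trig_def[abs_def] inner_on_rotate by (rule T.inner_on_E)
qed simp

lemma quasi_trig_complete:
  assumes f: "f \<in> L2_quasi \<nu>"
  shows "orthogonal_system.approximable (lborel_upto 1) (quasi_trig \<nu>) f"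
proof -
  interpret T: orthogonal_system "lborel_upto 1" "trig 1" 1
    by (rule orthogonal_system_trig) simp
  interpret Q: orthogonal_system "lborel_upto 1" "quasi_trig \<nu>" 1
    by (rule orthogonal_system_quasi_trig)
  have span: "(\<lambda>t. cis (2 * pi * \<nu> * t) * R t) \<in> Q.finite_span" if "R \<in> T.finite_span" for R
    using that
  proof (induction rule: T.finite_span.induct)
    case (member n)
    have "quasi_trig \<nu> n \<in> Q.finite_span" by (rule Q.finite_span.member)
    then show ?case unfolding quasi_trig_def[abs_def] .
  next
    case (scale f c)
    show ?case using Q.finite_span.scale[OF scale.IH, of c] by (simp only: mult.left_commute)
  next
    case (add f g)
    show ?case using Q.finite_span.add[OF add.IH] by (simp only: distrib_left)
  qed
  let ?f = "\<lambda>t. cis (- (2 * pi * \<nu> * t)) * f t"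
  have f_eq: "cis (2 * pi * \<nu> * t) * ?f t = f t" for t
    unfolding mult.assoc[symmetric] cis_mult by simp
  have [measurable]: "f \<in> borel_measurable borel" using f by (rule L2_quasi_measurable)
  have "square_integrable (lborel_upto 1) ?f"
    by (rule square_integrable_dominated[OF L2_quasi_square_integrable[OF f]])
      (auto simp: norm_mult intro!: borel_measurable_lborel_upto)
  then have approx: "T.approximable ?f" by (rule trig_complete[OF zero_less_one])
  show ?thesis
    unfolding Q.approximable_def
  proof (intro conjI allI impI)
    show "square_integrable (lborel_upto 1) f" by (rule L2_quasi_square_integrable[OF f])
    fix \<epsilon> :: real assume "\<epsilon> > 0"
    then obtain R where R: "R \<in> T.finite_span" "norm_on (lborel_upto 1) (\<lambda>t. ?f t - R t) < \<epsilon>"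
      using approx unfolding T.approximable_def by blast
    have "norm_on (lborel_upto 1) (\<lambda>t. f t - cis (2 * pi * \<nu> * t) * R t)
        = norm_on (lborel_upto 1) (\<lambda>t. cis (2 * pi * \<nu> * t) * (?f t - R t))"
      by (simp only: right_diff_distrib f_eq)
    also have "\<dots> < \<epsilon>" using R(2) by (simp only: norm_on_rotate)
    finally show "\<exists>R\<in>Q.finite_span. norm_on (lborel_upto 1) (\<lambda>t. f t - R t) < \<epsilon>"
      using span[OF R(1)] by (intro bexI[where x="\<lambda>t. cis (2 * pi * \<nu> * t) * R t"])
  qed
qed

section \<open>The duality condition\<close>

text \<open>
In the first argument the two forms agree on the partial sums \<open>S\<^sub>F f\<close>; on \<open>f - S\<^sub>F f\<close> both are at most a
constant times its norm, which tends to 0.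
\<close>

lemma frame_form_eq_inner_on_of_basis:
  assumes \<beta>: "\<beta> > 0" and g: "wiener g" and \<gamma>: "wiener \<gamma>" and h: "h \<in> L2_quasi \<nu>"
    and basis: "\<And>l. frame_form (1 / \<beta>) g \<gamma> (quasi_trig \<nu> l) h = inner_on (lborel_upto 1) (quasi_trig \<nu> l) h"
    and f: "f \<in> L2_quasi \<nu>"
  shows "frame_form (1 / \<beta>) g \<gamma> f h = inner_on (lborel_upto 1) f h"
proof -
  interpret Q: orthogonal_system "lborel_upto 1" "quasi_trig \<nu>" 1
    by (rule orthogonal_system_quasi_trig)
  let ?M = "lborel_upto 1" and ?B = "\<lambda>f. frame_form (1 / \<beta>) g \<gamma> f h"
  obtain K where K: "K > 0" "\<And>f h. f \<in> L2_quasi \<nu> \<Longrightarrow> h \<in> L2_quasi \<nu> \<Longrightarrow> cmod (frame_form (1 / \<beta>) g \<gamma> f h) \<le> K * norm_on ?M f * norm_on ?M h"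
    using frame_form_bounded[OF \<beta> g \<gamma>] by blast
  let ?d = "\<lambda>F t. f t - Q.expansion F f t"
  have S: "Q.expansion F f \<in> L2_quasi \<nu>" for F
    unfolding Q.expansion_def[abs_def] by (intro L2_quasi_sum L2_quasi_scale quasi_trig_in_L2_quasi)
  have d: "?d F \<in> L2_quasi \<nu>" for F by (rule L2_quasi_diff[OF f S])
  have exp_eq: "?B (Q.expansion F f) = inner_on ?M (Q.expansion F f) h" for F
  proof -
    have "?B (Q.expansion F f) = (\<Sum>l\<in>F. inner_on ?M f (quasi_trig \<nu> l) / of_real 1 * ?B (quasi_trig \<nu> l))"
      unfolding Q.expansion_def[abs_def]
      by (rule frame_form_sum_left[OF \<beta> g \<gamma> _ h]) (rule quasi_trig_in_L2_quasi)
    also have "\<dots> = inner_on ?M (Q.expansion F f) h"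
      unfolding Q.inner_on_expansion[OF L2_quasi_square_integrable[OF h]] basis by (simp add: inner_on_cnj[of ?M _ h])
    finally show ?thesis .
  qed
  have bound: "cmod (?B f - inner_on ?M f h) \<le> (K + 1) * norm_on ?M h * norm_on ?M (?d F)" for F
  proof -
    have "cmod (?B f - inner_on ?M f h) = cmod (?B (?d F) - inner_on ?M (?d F) h)"
      using exp_eq[of F] frame_form_diff_left[OF \<beta> g \<gamma> f S h, of F]
        inner_on_diff_left[OF L2_quasi_square_integrable[OF f] L2_quasi_square_integrable[OF S] L2_quasi_square_integrable[OF h], of F]
      by simp
    also have "\<dots> \<le> cmod (?B (?d F)) + cmod (inner_on ?M (?d F) h)" by (rule norm_triangle_ineq4)
    also have "\<dots> \<le> K * norm_on ?M (?d F) * norm_on ?M h + norm_on ?M (?d F) * norm_on ?M h"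
      by (rule add_mono[OF K(2)[OF d h] Cauchy_Schwarz_inner_on[OF L2_quasi_square_integrable[OF d] L2_quasi_square_integrable[OF h]]])
    also have "\<dots> = (K + 1) * norm_on ?M h * norm_on ?M (?d F)" by (simp add: algebra_simps)
    finally show ?thesis .
  qed
  have "((\<lambda>F. (K + 1) * norm_on ?M h * norm_on ?M (?d F)) \<longlongrightarrow> 0) (finite_subsets_at_top UNIV)"
    by (rule tendsto_mult_right_zero[OF Q.expansion_tendsto[OF quasi_trig_complete[OF f]]])
  then have "cmod (?B f - inner_on ?M f h) \<le> 0"
    by (rule tendsto_lowerbound) (use bound finite_subsets_at_top_neq_bot in \<open>auto intro: always_eventually\<close>)
  then show ?thesis by simp
qed

text \<open>The density argument is applied twice.  Exchanging \<open>g\<close> with \<open>\<gamma>\<close> conjugates the form and swaps its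
arguments, so that density in the first argument suffices.\<close>

lemma frame_form_eq_inner_on_iff_basis:
  assumes \<beta>: "\<beta> > 0" and g: "wiener g" and \<gamma>: "wiener \<gamma>"
  shows "(\<forall>f\<in>L2_quasi \<nu>. \<forall>h\<in>L2_quasi \<nu>. frame_form (1 / \<beta>) g \<gamma> f h = inner_on (lborel_upto 1) f h) \<longleftrightarrow>
    (\<forall>l m. frame_form (1 / \<beta>) g \<gamma> (quasi_trig \<nu> l) (quasi_trig \<nu> m) = (if l = m then 1 else 0))"
    (is "?L \<longleftrightarrow> ?R")
proof
  interpret Q: orthogonal_system "lborel_upto 1" "quasi_trig \<nu>" 1
    by (rule orthogonal_system_quasi_trig)
  note mem = quasi_trig_in_L2_quasi
  show ?R if ?L using that mem by (simp add: Q.inner_on_E)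
  assume R: ?R
  have 1: "frame_form (1 / \<beta>) g \<gamma> (quasi_trig \<nu> l) (quasi_trig \<nu> m) = inner_on (lborel_upto 1) (quasi_trig \<nu> l) (quasi_trig \<nu> m)" for l m
    using R by (simp add: Q.inner_on_E)
  have 2: "frame_form (1 / \<beta>) g \<gamma> (quasi_trig \<nu> l) h = inner_on (lborel_upto 1) (quasi_trig \<nu> l) h"
    if h: "h \<in> L2_quasi \<nu>" for l h
  proof -
    have "frame_form (1 / \<beta>) \<gamma> g h (quasi_trig \<nu> l) = inner_on (lborel_upto 1) h (quasi_trig \<nu> l)"
    proof (rule frame_form_eq_inner_on_of_basis[OF \<beta> \<gamma> g mem _ h])
      show "frame_form (1 / \<beta>) \<gamma> g (quasi_trig \<nu> m) (quasi_trig \<nu> l) = inner_on (lborel_upto 1) (quasi_trig \<nu> m) (quasi_trig \<nu> l)" for m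
        unfolding frame_form_cnj[of _ \<gamma> g "quasi_trig \<nu> m"] 1 by (rule inner_on_cnj[symmetric])
    qed
    then show ?thesis
      unfolding frame_form_cnj[of _ \<gamma> g h] inner_on_cnj[of _ h] by simp
  qed
  show ?L
  proof (intro ballI)
    fix f h assume f: "f \<in> L2_quasi \<nu>" and h: "h \<in> L2_quasi \<nu>"
    show "frame_form (1 / \<beta>) g \<gamma> f h = inner_on (lborel_upto 1) f h"
      by (rule frame_form_eq_inner_on_of_basis[OF \<beta> g \<gamma> h 2[OF h] f])
  qed
qed

text \<open>The factor \<open>q = P\<^sub>\<gamma> (e m)\<close> is \<open>T\<close>-periodic, so the integral over \<open>(0, T)\<close> unfolds to the integral of
\<open>e l \<sqdot> cnj g \<sqdot> cnj q\<close> over the line.  Expanding \<open>q\<close> and exchanging sum and integral leaves for each \<open>n\<close> a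
correlation of \<open>\<gamma>\<close> with the translate of \<open>g\<close> by \<open>n T\<close>, after the substitution \<open>t = s - n T\<close>.  That
substitution produces the phase \<open>cis (- 2 \<pi> (\<nu> + l) n T)\<close>, which is why the index in the duality
condition is \<open>- l\<close> and is shifted by \<open>\<nu>\<close>.\<close>

lemma frame_form_basis_eq_duality_sum:
  assumes \<beta>: "\<beta> > 0" and g: "wiener g" and \<gamma>: "wiener \<gamma>"
  shows "frame_form (1 / \<beta>) g \<gamma> (quasi_trig \<nu> l) (quasi_trig \<nu> m) =
    complex_of_real (1 / \<beta>) * (\<Sum>\<^sub>\<infinity>n\<in>(UNIV :: int set).
      L2_inner \<gamma> (modulation (of_int (m - l)) (translation (of_int n / \<beta>) g))
        * cis (2 * pi * (of_int n * (of_int (- l) - \<nu>) / \<beta>)))"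
proof -
  define T where "T = 1 / \<beta>"
  have T: "T > 0" using \<beta> by (simp add: T_def)
  let ?e = "quasi_trig \<nu> l" and ?e' = "quasi_trig \<nu> m"
  define q where "q = fold_window T \<gamma> ?e'"
  have [measurable]: "g \<in> borel_measurable borel" "\<gamma> \<in> borel_measurable borel"
    using g \<gamma> by (auto intro: wiener_measurable)
  have q_meas [measurable]: "q \<in> borel_measurable borel"
    unfolding q_def by (rule fold_window_measurable[OF quasi_trig_in_L2_quasi \<gamma>])
  obtain C where C: "C \<ge> 0"
    "AE t in lborel. (\<integral>\<^sup>+k. ennreal (cmod (\<gamma> (t + of_int k * T))) \<partial>count_space (UNIV :: int set)) \<le> ennreal C"
    by (rule wienerD[OF \<gamma> T])
  let ?u = "\<lambda>(t, n::int). ?e t * cnj (g t) * (cnj (?e' (t + of_int n * T)) * \<gamma> (t + of_int n * T))"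
  have shift: "(\<lambda>p. v (fst p + real_of_int (snd p) * T)) \<in> borel_measurable (lborel \<Otimes>\<^sub>M count_space UNIV)"
    if "v \<in> borel_measurable borel" for v :: "real \<Rightarrow> complex"
    using measurable_compose[OF translate_measurable[of lborel T] that] by (simp add: case_prod_unfold)
  note [measurable] = shift[of \<gamma>] shift[OF quasi_trig_measurable[of \<nu> m]]
  have u_meas: "?u \<in> borel_measurable (lborel \<Otimes>\<^sub>M count_space UNIV)"
    unfolding case_prod_unfold by measurable
  have u_int: "integrable (lborel \<Otimes>\<^sub>M count_space (UNIV :: int set)) ?u"
  proof (rule integrableI_bounded[OF u_meas])
    have "(\<integral>\<^sup>+p. ennreal (norm (?u p)) \<partial>(lborel \<Otimes>\<^sub>M count_space (UNIV :: int set)))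
        = (\<integral>\<^sup>+t. \<integral>\<^sup>+n. ennreal (norm (?u (t, n))) \<partial>count_space (UNIV :: int set) \<partial>lborel)"
      by (rule int_count.nn_integral_fst[symmetric]) (use u_meas in measurable)
    also have "\<dots> = (\<integral>\<^sup>+t. ennreal (cmod (g t)) * (\<integral>\<^sup>+n. ennreal (cmod (\<gamma> (t + of_int n * T))) \<partial>count_space (UNIV :: int set)) \<partial>lborel)"
      by (simp add: norm_mult ennreal_mult nn_integral_cmult)
    also have "\<dots> \<le> (\<integral>\<^sup>+t. ennreal (cmod (g t)) * ennreal C \<partial>lborel)"
    proof (rule nn_integral_mono_AE)
      show "AE t in lborel. ennreal (cmod (g t)) * (\<integral>\<^sup>+n. ennreal (cmod (\<gamma> (t + of_int n * T))) \<partial>count_space (UNIV :: int set))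
          \<le> ennreal (cmod (g t)) * ennreal C"
        using C(2) by eventually_elim (rule mult_left_mono, auto)
    qed
    also have "\<dots> = (\<integral>\<^sup>+t. ennreal (cmod (g t)) \<partial>lborel) * ennreal C"
      by (rule nn_integral_multc) measurable
    also have "\<dots> < \<infinity>"
      using wiener_integrable[OF g] by (auto simp: integrable_iff_bounded ennreal_mult_less_top)
    finally show "(\<integral>\<^sup>+p. ennreal (norm (?u p)) \<partial>(lborel \<Otimes>\<^sub>M count_space (UNIV :: int set))) < \<infinity>" .
  qed
  have q_cnj: "cnj (q t) = (LINT n|count_space (UNIV :: int set). cnj (?e' (t + of_int n * T)) * \<gamma> (t + of_int n * T))" for t
    unfolding q_def fold_window_def periodize_def Bochner_Integration.integral_cnj[symmetric] by simp
  have inner: "(LINT n|count_space (UNIV :: int set). ?u (t, n)) = ?e t * cnj (g t) * cnj (q t)" for t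
    unfolding q_cnj prod.case by (rule integral_mult_right_zero)
  have v_int: "integrable lborel (\<lambda>t. ?e t * cnj (g t) * cnj (q t))"
    using real_int.integrable_fst'[OF u_int] unfolding inner .
  have "inner_on (lborel_upto T) (fold_window T g ?e) q = (LINT t|lborel_upto T. periodize T (\<lambda>s. ?e s * cnj (g s) * cnj (q s)) t)"
  proof -
    have "cnj (q (t + of_int k * T)) = cnj (q t)" for t k
      unfolding q_def fold_window_def periodize_translate ..
    then have "periodize T (\<lambda>s. ?e s * cnj (g s) * cnj (q s)) t = fold_window T g ?e t * cnj (q t)" for t
      unfolding fold_window_def by (rule periodize_mult_periodic)
    then show ?thesis by (simp only: inner_on_def)
  qed
  also have "\<dots> = (LINT t|lborel. ?e t * cnj (g t) * cnj (q t))"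
    by (rule integral_periodize[OF T v_int])
  also have "\<dots> = (LINT t|lborel. LINT n|count_space (UNIV :: int set). ?u (t, n))"
    by (simp only: inner)
  also have "\<dots> = (LINT n|count_space (UNIV :: int set). LINT t|lborel. ?u (t, n))"
    by (rule real_int.Fubini_integral[symmetric]) (use u_int in \<open>simp only: case_prod_eta\<close>)
  also have "\<dots> = (LINT n|count_space (UNIV :: int set).
      L2_inner \<gamma> (modulation (of_int (m - l)) (translation (of_int n / \<beta>) g))
        * cis (2 * pi * (of_int n * (of_int (- l) - \<nu>) / \<beta>)))"
  proof (rule Bochner_Integration.integral_cong)
    fix n :: int
    let ?c = "cis (2 * pi * (of_int n * (of_int (- l) - \<nu>) / \<beta>))"
    have "(LINT t|lborel. ?u (t, n)) = \<bar>1\<bar> *\<^sub>R (LINT s|lborel. ?u (- (of_int n * T) + 1 * s, n))"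
      by (rule lborel_integral_real_affine) simp
    also have "\<dots> = (LINT s|lborel. \<gamma> s * cnj (modulation (of_int (m - l)) (translation (of_int n / \<beta>) g) s) * ?c)"
    proof -
      have "?e (- (of_int n * T) + 1 * s) * cnj (?e' s) = cnj (cis (2 * pi * of_int (m - l) * s)) * ?c" for s
      proof -
        have "?e (- (of_int n * T) + 1 * s) * cnj (?e' s) =
            cis (2 * pi * \<nu> * (s - of_int n * T) + 2 * pi * of_int l * (s - of_int n * T) + (- (2 * pi * \<nu> * s + 2 * pi * of_int m * s)))"
          by (simp add: quasi_trig_def trig_def cis_mult cis_cnj)
        also have "\<dots> = cis (- (2 * pi * of_int (m - l) * s) + 2 * pi * (of_int n * (of_int (- l) - \<nu>) / \<beta>))"
          by (rule arg_cong[where f=cis]) (simp add: T_def algebra_simps diff_divide_distrib add_divide_distrib)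
        finally show ?thesis by (simp only: cis_mult cis_cnj)
      qed
      then have u_eq: "?u (- (of_int n * T) + 1 * s, n) = \<gamma> s * cnj (modulation (of_int (m - l)) (translation (of_int n / \<beta>) g) s) * ?c" for s
        by (simp add: modulation_def translation_def T_def mult_ac)
      show ?thesis
        unfolding abs_one scaleR_one by (intro Bochner_Integration.integral_cong refl u_eq)
    qed
    also have "\<dots> = L2_inner \<gamma> (modulation (of_int (m - l)) (translation (of_int n / \<beta>) g)) * ?c"
      unfolding L2_inner_def by (rule integral_mult_left_zero)
    finally show "(LINT t|lborel. ?u (t, n)) = L2_inner \<gamma> (modulation (of_int (m - l)) (translation (of_int n / \<beta>) g)) * ?c" .
  qed simp
  finally show ?thesis
    unfolding frame_form_def infsum_eq_integral_count_space T_def[symmetric] q_def[symmetric] by (simp only: T_def)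
qed

text \<open>The index pairs correspond by \<open>(k, l) = (m - l', - l')\<close>, a bijection of \<open>\<int> \<times> \<int>\<close>.\<close>

lemma duality_condition_iff_form:
  assumes \<beta>: "\<beta> > 0" and g: "wiener g" and \<gamma>: "wiener \<gamma>"
  shows "duality_condition \<nu> \<beta> g \<gamma> \<longleftrightarrow>
    (\<forall>l m. frame_form (1 / \<beta>) g \<gamma> (quasi_trig \<nu> l) (quasi_trig \<nu> m) = (if l = m then 1 else 0))"
proof -
  define X where "X k l = complex_of_real (1 / \<beta>) * (\<Sum>\<^sub>\<infinity>n\<in>(UNIV :: int set).
      L2_inner \<gamma> (modulation (of_int k) (translation (of_int n / \<beta>) g))
        * cis (2 * pi * (of_int n * (of_int l - \<nu>) / \<beta>)))" for k l :: int
  have form: "frame_form (1 / \<beta>) g \<gamma> (quasi_trig \<nu> l) (quasi_trig \<nu> m) = X (m - l) (- l)" for l m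
    unfolding X_def by (rule frame_form_basis_eq_duality_sum[OF assms])
  have dual: "duality_condition \<nu> \<beta> g \<gamma> \<longleftrightarrow> (\<forall>k l. X k l = (if k = 0 then 1 else 0))"
    by (simp only: duality_condition_def X_def)
  show ?thesis
    unfolding dual form
  proof (intro iffI allI)
    fix k l assume "\<forall>l m. X (m - l) (- l) = (if l = m then 1 else 0)"
    from this[rule_format, of "k - l" "- l"] show "X k l = (if k = 0 then 1 else 0)" by auto
  qed auto
qed

lemma frame_op_eq_id_iff_duality_condition:
  assumes "\<beta> > 0" "wiener g" "wiener \<gamma>"
  shows "frame_op_eq_id \<nu> \<beta> g \<gamma> \<longleftrightarrow> duality_condition \<nu> \<beta> g \<gamma>"
  by (simp only: frame_op_eq_id_iff_form[OF assms] frame_form_eq_inner_on_iff_basis[OF assms] duality_condition_iff_form[OF assms])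

theorem corollary1:
  fixes \<nu> \<beta> :: real and g \<gamma> :: "real \<Rightarrow> complex"
  assumes "\<beta> > 0"
    and "g \<in> S0" and "\<gamma> \<in> S0"
    and "L2_norm g = 1"
  shows "(frame_op_eq_id \<nu> \<beta> g \<gamma> \<longleftrightarrow> duality_condition \<nu> \<beta> g \<gamma>)
    \<and> (frame_op_eq_id \<nu> \<beta> g \<gamma> \<or> (\<exists>\<gamma>'\<in>S0. duality_condition \<nu> \<beta> g \<gamma>')
         \<longrightarrow> is_gabor_frame \<nu> \<beta> g)"
proof -
  have g: "wiener g" using assms(2) by (rule S0_imp_wiener)
  have iff: "frame_op_eq_id \<nu> \<beta> g \<gamma>' \<longleftrightarrow> duality_condition \<nu> \<beta> g \<gamma>'" if "\<gamma>' \<in> S0" for \<gamma>'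
    by (rule frame_op_eq_id_iff_duality_condition[OF assms(1) g S0_imp_wiener[OF that]])
  have frame: "is_gabor_frame \<nu> \<beta> g" if "\<gamma>' \<in> S0" "frame_op_eq_id \<nu> \<beta> g \<gamma>'" for \<gamma>'
    by (rule frame_op_eq_id_imp_gabor_frame[OF assms(1) g S0_imp_wiener[OF that(1)] that(2)])
  show ?thesis using iff frame assms(3) by blast
qed

end
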